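(* Fix an integer $m\geq 2$. Define $t_0:=0$ and let $(t_n)_{n\geq 1}$ be a sequence of nonzero complex numbers such that, for each nonnegative integer $n$, $$t_{2mn+j}=\tfrac14,\quad j\in\{0,1,\dots,2m-1\}\setminus\{0,1,m,m+1\},$$ $$t_{2mn}+t_{2mn+1}=t_{2mn+m}+t_{2mn+m+1}=\tfrac12 .$$ Let $(P_n)_{n\geq 0}$ be the sequence of monic orthogonal polynomials given by $P_{-1}:=0$, $P_0:=1$ and $$P_{n+1}(x)=xP_n(x)-t_nP_{n-1}(x),\qquad n\ge 0.$$ Let $(Q_n)_{n\geq 0}$ be the sequence of monic orthogonal polynomials given by $Q_{-1}:=0$, $Q_0:=1$ and $$Q_{n+1}(x)=(x-r_n)Q_n(x)-s_nQ_{n-1}(x),\qquad n\ge 0,$$ with $$r_n:=\frac{1}{2^{2m-4}}\Big(t_{2mn+m}t_{2mn+1}+t_{2m(n+1)}t_{2mn+m+1}-\tfrac18\Big)\quad(n\ge 0),$$ $$s_n:=\frac{1}{4^{2m-4}}\,t_{2mn}\,t_{2mn+1}\,t_{2mn+m}\,t_{2m(n-1)+m+1}\quad(n\ge 1)$$ (the value of $s_0$ is irrelevant since $Q_{-1}=0$). (1) $P_j(x)=\widehat{T}_j(x)$ for each $j\in\{0,1,\dots,m\}$, and for each integer $n\ge 0$ and each $j\in\{0,1,\dots,2m-1\}$, $$P_{2mn+m+j+1}(x)=\frac{A_j(n;x)\,Q_{n+1}\big(\widehat{T}_{2m}(x)\big)+4^{-j}\,t_{2mn+m+1}\,B_j(n;x)\,Q_n\big(\widehat{T}_{2m}(x)\big)}{\widehat{U}_{m-1}(x)},$$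 where $$A_j(n;x):=\widehat{U}_j(x)+\Big(\tfrac14-t_{2m(n+1)}\Big)\Big(\widehat{U}_{j-m}(x)\widehat{U}_{m-2}(x)-\widehat{U}_{j-m-1}(x)\widehat{U}_{m-1}(x)\Big),$$ $$B_j(n;x):=\widehat{U}_{2m-2-j}(x)+\Big(\tfrac14-t_{2m(n+1)}\Big)\Big(\widehat{U}_{m-j-3}(x)\widehat{U}_{m-1}(x)-\widehat{U}_{m-j-2}(x)\widehat{U}_{m-2}(x)\Big).$$ (2) Assume furthermore that $t_n>0$ for each positive integer $n$. Then $(P_n)_{n\geq 0}$ and $(Q_n)_{n\geq 0}$ are orthogonal polynomial sequences with respect to certain positive measures, say $\mu_P$ and $\mu_Q$ respectively. Suppose that $\mu_Q$ is absolutely continuous with weight function $w_Q$ on $[\xi,\eta]$, where $-2^{1-2m}\leq \xi<\eta\leq 2^{1-2m}$, i.e. $$\mathrm{d}\mu_Q(x)=w_Q(x)\chi_{(\xi,\eta)}(x)\,\mathrm{d}x,$$ and suppose in addition that $$C:=\int_\xi^\eta \frac{w_Q(x)}{x+2^{1-2m}}\,\mathrm{d}x<\infty .$$ Then, up to a positive constant factor, $$\mathrm{d}\mu_P(x)=w_P(x)\chi_E(x)\,\mathrm{d}x+M\sum_{j=1}^m\delta\Big(x-\cos\frac{(2j-1)\pi}{2m}\Big),$$ where $$w_P(x):=\left|\frac{U_{m-1}(x)}{T_m(x)}\right|w_Q\big(\widehat{T}_{2m}(x)\big),\qquad x\in E:=\widehat{T}_{2m}^{-1}\big((\xi,\eta)\big),$$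 and $M$ is a nonnegative number given by $$M:=\frac1m\left(\frac{2^{2m-3}\mu_Q(\mathbb{R})}{t_m}-C\right).$$
   Context: $T_n$ and $U_n$ denote the Chebyshev polynomials of the first and second kind: $T_n(\cos\theta)=\cos(n\theta)$ and $U_n(\cos\theta)=\sin((n+1)\theta)/\sin\theta$ for $n\ge 0$ and $0<\theta<\pi$. $\widehat{T}_n$ and $\widehat{U}_n$ are the corresponding monic polynomials: $\widehat{T}_0:=\widehat{U}_0:=1$, and $\widehat{T}_n(x):=2^{1-n}T_n(x)$, $\widehat{U}_n(x):=2^{-n}U_n(x)$ for $n\geq 1$. Convention: all polynomials with negative index are zero, i.e. $T_{-n}:=U_{-n}:=\widehat{T}_{-n}:=\widehat{U}_{-n}:=0$ for each positive integer $n$. A sequence of monic polynomials generated by a three-term recurrence with nonzero (possibly complex) coefficients of the $(n-1)$-th term for $n\ge1$ is called a sequence of monic orthogonal polynomials (orthogonal with respect to a regular, not necessarily positive, moment functional on polynomials). A sequence $(p_n)_{n\ge 0}$ with $\deg p_n=n$ is orthogonal with respect to a positive Borel measure $\mu$ on $\mathbb{R}$ (with infinite support and finite moments of all orders) if $\int p_np_k\,\mathrm{d}\mu=0$ for $n\ne k$. $\chi_S$ denotes the characteristic function of the set $S$, $\delta(x-a)$ the unit point mass at $a$, and $\widehat{T}_{2m}^{-1}((\xi,\eta))=\{x\in\mathbb{R}:\ \widehat{T}_{2m}(x)\in(\xi,\eta)\}$.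
   Formalization: In (1) the factor 4^{-j} t_{2mn+m+1} of B_j is false in general for m-1≤j≤2m-2 (m=2, n=0, j=1, x=1, t_1=1/2, t_4=1/8, t_5=3/8, other t_n=1/4); it is replaced by t_{2mn+m+1}···t_{2mn+m+j+1} for all j, and the printed factor is kept for j≤m-2 and j=2m-1. *)

theory Defs
  imports "HOL-Analysis.Analysis" "HOL-Computational_Algebra.Polynomial"
begin

section \<open>Chebyshev polynomials\<close>

text \<open>Integer indices, because expressions such as \<open>U\<^sub>j\<^sub>-\<^sub>m\<^sub>-\<^sub>1\<close> occur; all polynomials
  with negative index are zero (\<^emph>\<open>not\<close> continued by the recurrence).\<close>

definition chebT :: "int \<Rightarrow> 'a::real_field poly" where
  "chebT k = (if k < 0 then 0 else
     (THE p. \<forall>\<theta>. 0 < \<theta> \<and> \<theta> < pi \<longrightarrow>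
        poly p (of_real (cos \<theta>)) = of_real (cos (of_int k * \<theta>))))"

definition chebU :: "int \<Rightarrow> 'a::real_field poly" where
  "chebU k = (if k < 0 then 0 else
     (THE p. \<forall>\<theta>. 0 < \<theta> \<and> \<theta> < pi \<longrightarrow>
        poly p (of_real (cos \<theta>)) = of_real (sin ((of_int k + 1) * \<theta>) / sin \<theta>)))"

definition monT :: "int \<Rightarrow> 'a::real_field poly" where
  "monT k = (if k < 0 then 0 else if k = 0 then 1 else smult (2 powi (1 - k)) (chebT k))"

definition monU :: "int \<Rightarrow> 'a::real_field poly" where
  "monU k = (if k < 0 then 0 else if k = 0 then 1 else smult (2 powi (- k)) (chebU k))"

subsection \<open>The two descriptions determine unique polynomials\<close>

fun cheb_rec :: "'a::real_field poly \<Rightarrow> nat \<Rightarrow> 'a poly" where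
  "cheb_rec q 0 = 1"
| "cheb_rec q (Suc 0) = q"
| "cheb_rec q (Suc (Suc n)) = [:0, 2:] * cheb_rec q (Suc n) - cheb_rec q n"

lemma cheb_rec_T:
  "poly (cheb_rec [:0, 1:] n) (of_real (cos \<theta>)) = (of_real (cos (of_nat n * \<theta>)) :: 'a::real_field)"
proof (induction "[:0, 1:] :: 'a poly" n rule: cheb_rec.induct)
  case (3 n)
  have "cos (real (Suc (Suc n)) * \<theta>) = 2 * cos \<theta> * cos (real (Suc n) * \<theta>) - cos (real n * \<theta>)"
  proof -
    have "cos (real (Suc n) * \<theta> + \<theta>) + cos (real (Suc n) * \<theta> - \<theta>)
        = 2 * cos \<theta> * cos (real (Suc n) * \<theta>)"
      by (simp add: cos_add cos_diff)
    moreover have "real (Suc n) * \<theta> + \<theta> = real (Suc (Suc n)) * \<theta>"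
      "real (Suc n) * \<theta> - \<theta> = real n * \<theta>" by (simp_all add: algebra_simps)
    ultimately show ?thesis by simp
  qed
  with 3 show ?case by (simp del: of_nat_Suc)
qed auto

lemma cheb_rec_U:
  assumes "sin \<theta> \<noteq> 0"
  shows "poly (cheb_rec [:0, 2:] n) (of_real (cos \<theta>))
    = (of_real (sin ((of_nat n + 1) * \<theta>) / sin \<theta>) :: 'a::real_field)"
proof (induction "[:0, 2:] :: 'a poly" n rule: cheb_rec.induct)
  case 1
  show ?case using assms by simp
next
  case 2
  show ?case using assms by (simp add: sin_double)
next
  case (3 n)
  have "sin ((real (Suc (Suc n)) + 1) * \<theta>)
      = 2 * cos \<theta> * sin ((real (Suc n) + 1) * \<theta>) - sin ((real n + 1) * \<theta>)"
  proof -
    have "sin ((real (Suc n) + 1) * \<theta> + \<theta>) + sin ((real (Suc n) + 1) * \<theta> - \<theta>)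
        = 2 * cos \<theta> * sin ((real (Suc n) + 1) * \<theta>)"
      by (simp add: sin_add sin_diff)
    moreover have "(real (Suc n) + 1) * \<theta> + \<theta> = (real (Suc (Suc n)) + 1) * \<theta>"
      "(real (Suc n) + 1) * \<theta> - \<theta> = (real n + 1) * \<theta>" by (simp_all add: algebra_simps)
    ultimately show ?thesis by simp
  qed
  with 3 assms show ?case by (simp add: diff_divide_distrib del: of_nat_Suc)
qed

lemma poly_eq_on_cos:
  fixes p q :: "'a::real_field poly"
  assumes "\<And>\<theta>. 0 < \<theta> \<Longrightarrow> \<theta> < pi \<Longrightarrow> poly p (of_real (cos \<theta>)) = poly q (of_real (cos \<theta>))"
  shows "p = q"
proof (rule ccontr)
  assume "p \<noteq> q"
  then have fin: "finite {x. poly (p - q) x = 0}" by (intro poly_roots_finite) simp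
  have "inj_on (\<lambda>\<theta>. of_real (cos \<theta>) :: 'a) {0<..<pi}"
    by (rule inj_onI) (auto intro: cos_inj_pi)
  moreover have "(\<lambda>\<theta>. of_real (cos \<theta>) :: 'a) ` {0<..<pi} \<subseteq> {x. poly (p - q) x = 0}"
    using assms by auto
  ultimately have "finite {0<..<pi}" using fin by (metis finite_imageD finite_subset)
  then show False using infinite_Ioo[of 0 pi] by simp
qed

lemma chebT_of_nat: "chebT (int n) = (cheb_rec [:0, 1:] n :: 'a::real_field poly)"
proof -
  have "(THE p. \<forall>\<theta>. 0 < \<theta> \<and> \<theta> < pi \<longrightarrow>
      poly p (of_real (cos \<theta>)) = (of_real (cos (of_int (int n) * \<theta>)) :: 'a)) = cheb_rec [:0, 1:] n"
    by (rule the_equality) (auto intro!: poly_eq_on_cos simp: cheb_rec_T)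
  then show ?thesis unfolding chebT_def by simp
qed

lemma chebU_of_nat: "chebU (int n) = (cheb_rec [:0, 2:] n :: 'a::real_field poly)"
proof -
  have U: "poly (cheb_rec [:0, 2:] n) (of_real (cos \<theta>))
      = (of_real (sin ((of_int (int n) + 1) * \<theta>) / sin \<theta>) :: 'a)" if "0 < \<theta>" "\<theta> < pi" for \<theta>
    using cheb_rec_U[of \<theta> n] sin_gt_zero[OF that] by simp
  have "(THE p. \<forall>\<theta>. 0 < \<theta> \<and> \<theta> < pi \<longrightarrow>
      poly p (of_real (cos \<theta>)) = (of_real (sin ((of_int (int n) + 1) * \<theta>) / sin \<theta>) :: 'a))
      = cheb_rec [:0, 2:] n"
    by (rule the_equality) (use U in \<open>auto intro!: poly_eq_on_cos simp del: of_real_divide\<close>)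
  then show ?thesis unfolding chebU_def by simp
qed

section \<open>Three-term recurrences and orthogonality\<close>

fun monic_op :: "(nat \<Rightarrow> 'a::comm_ring_1) \<Rightarrow> (nat \<Rightarrow> 'a) \<Rightarrow> nat \<Rightarrow> 'a poly" where
  "monic_op b c 0 = 1"
| "monic_op b c (Suc 0) = [:- b 0, 1:]"
| "monic_op b c (Suc (Suc n)) =
     [:- b (Suc n), 1:] * monic_op b c (Suc n) - smult (c (Suc n)) (monic_op b c n)"

definition msupport :: "real measure \<Rightarrow> real set" where
  "msupport \<mu> = {x. \<forall>V. open V \<and> x \<in> V \<longrightarrow> 0 < emeasure \<mu> V}"

text \<open>The polynomials may have complex coefficients but are integrated over the real line;
  there is no complex conjugation in the orthogonality relation.\<close>

definition orthogonal_wrt :: "real measure \<Rightarrow> (nat \<Rightarrow> complex poly) \<Rightarrow> bool" where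
  "orthogonal_wrt \<mu> p \<longleftrightarrow>
     sets \<mu> = sets borel \<and>
     infinite (msupport \<mu>) \<and>
     (\<forall>k::nat. integrable \<mu> (\<lambda>x. x ^ k)) \<and>
     (\<forall>n. degree (p n) = n) \<and>
     (\<forall>n k. n \<noteq> k \<longrightarrow>
        (LINT x|\<mu>. poly (p n) (of_real x) * poly (p k) (of_real x)) = 0)"

section \<open>Coefficients\<close>

definition r_coeff :: "nat \<Rightarrow> (nat \<Rightarrow> complex) \<Rightarrow> nat \<Rightarrow> complex" where
  "r_coeff m t n = 1 / 2 ^ (2*m - 4) *
     (t (2*m*n + m) * t (2*m*n + 1) + t (2*m*(n + 1)) * t (2*m*n + m + 1) - 1/8)"

text \<open>Only the values for \<open>n \<ge> 1\<close> matter.\<close>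

definition s_coeff :: "nat \<Rightarrow> (nat \<Rightarrow> complex) \<Rightarrow> nat \<Rightarrow> complex" where
  "s_coeff m t n = 1 / 4 ^ (2*m - 4) *
     (t (2*m*n) * t (2*m*n + 1) * t (2*m*n + m) * t (2*m*(n - 1) + m + 1))"

definition A_poly :: "nat \<Rightarrow> (nat \<Rightarrow> complex) \<Rightarrow> nat \<Rightarrow> nat \<Rightarrow> complex poly" where
  "A_poly m t j n = monU j + smult (1/4 - t (2*m*(n + 1)))
     (monU (int j - int m) * monU (int m - 2) - monU (int j - int m - 1) * monU (int m - 1))"

definition B_poly :: "nat \<Rightarrow> (nat \<Rightarrow> complex) \<Rightarrow> nat \<Rightarrow> nat \<Rightarrow> complex poly" where
  "B_poly m t j n = monU (2 * int m - 2 - int j) + smult (1/4 - t (2*m*(n + 1)))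
     (monU (int m - int j - 3) * monU (int m - 1) - monU (int m - int j - 2) * monU (int m - 2))"

text \<open>In the representation of \<open>P\<^bsub>2mn+m+j+1\<^esub>\<close> the factor of \<open>B\<^sub>j\<close> is
  \<open>t\<^bsub>2mn+m+1\<^esub> \<cdots> t\<^bsub>2mn+m+j+1\<^esub>\<close>. It equals \<open>4\<^bsup>-j\<^esup> t\<^bsub>2mn+m+1\<^esub>\<close> for \<open>j \<le> m - 2\<close>, and
  for \<open>j = 2m - 1\<close> it is irrelevant because \<open>B\<^sub>j = 0\<close>. For \<open>m - 1 \<le> j \<le> 2m - 2\<close> the product
  contains \<open>t\<^bsub>2m(n+1)\<^esub>\<close>, and the factor \<open>4\<^bsup>-j\<^esup> t\<^bsub>2mn+m+1\<^esub>\<close> would be wrong, as the case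
  \<open>m = 2\<close>, \<open>n = 0\<close>, \<open>j = 1\<close>, \<open>x = 1\<close> shows.\<close>

lemma quarter_power_factor_fails:
  defines "t \<equiv> (\<lambda>n::nat. if n = 0 then 0 else if n = 1 then 1/2 else if n = 4 then 1/8
                 else if n = 5 then 3/8 else 1/4 :: complex)"
  defines "P \<equiv> monic_op (\<lambda>_. 0) t"
  defines "Q \<equiv> monic_op (r_coeff 2 t) (s_coeff 2 t)"
  shows "t 0 = 0" and "\<forall>n\<ge>1. t n \<noteq> 0"
    and "\<forall>n. \<forall>j\<in>{0..2*2 - 1} - {0, 1, 2, 2 + 1}. t (2*2*n + j) = 1/4"
    and "\<forall>n. t (2*2*n) + t (2*2*n + 1) = 1/2 \<and> t (2*2*n + 2) + t (2*2*n + 2 + 1) = 1/2"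
    and "poly (monU 1) 1 \<noteq> (0::complex)"
    and "poly (P (2*2*0 + 2 + 1 + 1)) 1 \<noteq>
          (poly (A_poly 2 t 1 0) 1 * poly (Q (0 + 1)) (poly (monT 4) 1)
           + (1/4) ^ 1 * t (2*2*0 + 2 + 1) * poly (B_poly 2 t 1 0) 1 * poly (Q 0) (poly (monT 4) 1))
          / poly (monU 1) 1"
proof -
  have U: "chebU 1 = ([:0, 2:] :: complex poly)"
    using chebU_of_nat[of 1, where 'a = complex] by simp
  have T: "chebT 4 = (cheb_rec [:0, 1:] 4 :: complex poly)"
    using chebT_of_nat[of 4, where 'a = complex] by simp
  have T1: "poly (monT 4) 1 = (1/8 :: complex)"
    unfolding monT_def T by (simp add: numeral_eq_Suc power_int_def)
  have U1: "poly (monU 1) 1 = (1::complex)"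
    unfolding monU_def U by simp
  have P4: "poly (P 4) 1 = 1/8"
    unfolding P_def t_def by (simp add: numeral_eq_Suc)
  have A1: "poly (A_poly 2 t 1 0) 1 = 1" and B1: "poly (B_poly 2 t 1 0) 1 = 1"
    unfolding A_poly_def B_poly_def by (simp_all add: U1) (simp_all add: monU_def)
  have Q1: "poly (Q 1) (1/8) = 3/32" and Q0: "Q 0 = 1"
    unfolding Q_def by (simp_all add: r_coeff_def t_def)
  have t3: "t 3 = 1/4" by (simp add: t_def)
  have idx: "2*2*0 + 2 + 1 + 1 = (4::nat)" "2*2*0 + 2 + 1 = (3::nat)" "0 + 1 = (1::nat)"
    by simp_all
  show "t 0 = 0" "\<forall>n\<ge>1. t n \<noteq> 0" by (simp_all add: t_def)
  show "\<forall>n. \<forall>j\<in>{0..2*2 - 1} - {0, 1, 2, 2 + 1}. t (2*2*n + j) = 1/4"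
    by (auto simp: t_def)
  show "\<forall>n. t (2*2*n) + t (2*2*n + 1) = 1/2 \<and> t (2*2*n + 2) + t (2*2*n + 2 + 1) = 1/2"
    by (auto simp: t_def)
  show "poly (monU 1) 1 \<noteq> (0::complex)" by (simp add: U1)
  show "poly (P (2*2*0 + 2 + 1 + 1)) 1 \<noteq>
          (poly (A_poly 2 t 1 0) 1 * poly (Q (0 + 1)) (poly (monT 4) 1)
           + (1/4) ^ 1 * t (2*2*0 + 2 + 1) * poly (B_poly 2 t 1 0) 1 * poly (Q 0) (poly (monT 4) 1))
          / poly (monU 1) 1"
    unfolding idx T1 U1 A1 B1 Q0 Q1 t3 by (simp add: P4)
qed

end

theory Submission
  imports Defs "HOL-Probability.Probability"
begin

text \<open>Write \<open>y\<close> for the monic \<open>T\<^sub>2\<^sub>m(x)\<close>. Inside a block of \<open>2m\<close> indices both coefficients in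
  the representation of \<open>P\<close> obey the recurrence of \<open>P\<close> because \<open>t\<close> equals \<open>1/4\<close> there up to one
  perturbed pair, and the passage to the next block is exactly the recurrence of \<open>Q\<close> at \<open>y\<close>. In
  particular \<open>P\<^bsub>2mn+m\<^esub> = T\<^sub>m Q\<^sub>n(y)\<close> (monic \<open>T\<^sub>m\<close>) and \<open>P\<^bsub>2mn\<^esub> = G\<^sub>n(y)\<close> with
  \<open>G\<^sub>n = Q\<^sub>n + g\<^sub>n Q\<^bsub>n-1\<^esub>\<close>.

  The polynomials \<open>T\<^sub>j G\<^sub>n(y)\<close> (\<open>j \<le> m\<close>) and \<open>T\<^sub>k T\<^sub>m Q\<^sub>n(y)\<close> (\<open>1 \<le> k < m\<close>) form a basis, and
  apart from the constant all of them are annihilated by the functional of \<open>\<mu>\<^sub>P\<close>. So it suffices that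
  the functional of the claimed measure annihilates them too. Under \<open>x = cos \<theta>\<close> that measure is
  invariant under rotations of \<open>\<theta>\<close> by \<open>\<pi>/m\<close>, hence kills \<open>T\<^sub>k h(y)\<close> for \<open>0 < k < 2m\<close>; on functions
  of \<open>y\<close> it is integration against \<open>w\<^sub>Q(y)/(y + 2\<^bsup>1-2m\<^esup>)\<close> plus a point mass at \<open>-2\<^bsup>1-2m\<^esup>\<close>, and
  the size of that mass is what makes its values on \<open>Q\<^sub>n\<close> satisfy a first order recurrence with factor
  \<open>-g\<^sub>n\<close>. Positivity of \<open>\<mu>\<^sub>P\<close> on squares peaking at the point mass gives \<open>M \<ge> 0\<close>, and compact
  support makes the moments determine the measure. Existence of the measures is Favard's theorem:
  a weak limit of Gauss quadratures.\<close>

section \<open>Monic Chebyshev polynomials\<close>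

text \<open>The step from Q_n to G_n = Q_n + g_n Q_{n-1} is a Geronimus transformation: a functional
  annihilating every G_n with n >= 1, once multiplied by y + 2^(1-2m), has to become a multiple of
  the functional of Q. This leaves one free parameter, a mass at y = -2^(1-2m). Hence the
  denominator under w_Q, the point masses at the zeros of T_m (exactly where y has that value), and
  the constant in M: the total mass of the claimed measure is forced by the equation f_0 * mass =
  mu_Q(R).

  Two obstacles shape the proof. The measure mu_P is an arbitrary orthogonality measure; nothing is
  known beforehand about its support or its uniqueness, so it can only be compared with the claimed
  measure on polynomials for which both integrals are computable, and determinacy has to do the
  rest. And the representation of P has the denominator U_{m-1}, which vanishes at some points;
  identities are therefore proved in multiplied-out form and the factor is cancelled only between
  polynomials.\<close>

lemma monU_neg: "k < 0 \<Longrightarrow> monU k = 0"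
  by (simp add: monU_def)

lemma monU_0: "monU 0 = 1"
  by (simp add: monU_def)

lemma monU_of_nat: "monU (int n) = (smult ((1/2)^n) (cheb_rec [:0, 2:] n) :: 'a::real_field poly)"
proof (cases n)
  case (Suc k)
  have "(2::'a) powi (- int n) = (1/2)^n"
    by (simp add: power_int_minus power_one_over inverse_eq_divide)
  with Suc show ?thesis
    by (simp add: monU_def chebU_of_nat del: of_nat_Suc cheb_rec.simps power_Suc)
qed (simp add: monU_def)

lemma monU_rec:
  assumes "k \<ge> 0"
  shows "monU (k + 1) = [:0, 1:] * monU k - smult (1/4) (monU (k - 1) :: 'a::real_field poly)"
proof (cases "k = 0")
  case True
  have "monU 1 = ([:0, 1:] :: 'a poly)"
    using monU_of_nat[of 1, where 'a='a] by simp
  with True show ?thesis by (simp add: monU_def)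
next
  case False
  define n where "n = nat (k - 1)"
  have k: "k = int (Suc n)" "k + 1 = int (Suc (Suc n))" "k - 1 = int n"
    using assms False by (auto simp: n_def)
  have "monU (k + 1) = (smult ((1/2)^Suc (Suc n)) (cheb_rec [:0, 2:] (Suc (Suc n))) :: 'a poly)"
    "monU k = (smult ((1/2)^Suc n) (cheb_rec [:0, 2:] (Suc n)) :: 'a poly)"
    "monU (k - 1) = (smult ((1/2)^n) (cheb_rec [:0, 2:] n) :: 'a poly)"
    using k by (metis monU_of_nat)+
  then show ?thesis by (simp add: smult_diff_right algebra_simps)
qed

lemma monT_of_nat_Suc:
  "monT (int (Suc n)) = (smult ((1/2)^n) (cheb_rec [:0, 1:] (Suc n)) :: 'a::real_field poly)"
proof -
  have "(2::'a) powi (1 - int (Suc n)) = (1/2)^n"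
    by (simp add: power_int_def power_one_over inverse_eq_divide)
  then show ?thesis
    by (simp add: monT_def chebT_of_nat del: of_nat_Suc cheb_rec.simps)
qed

text \<open>Both sides obey the Chebyshev recurrence in \<open>n\<close>, so only
  \<open>n = 0\<close> and \<open>n = 1\<close> need a computation.\<close>

lemma cheb_rec_T_U:
  "smult 2 (cheb_rec [:0, 1:] (Suc (Suc n))) = (cheb_rec [:0, 2:] (Suc (Suc n)) - cheb_rec [:0, 2:] n :: 'a::real_field poly)"
proof (induction n rule: less_induct)
  case (less n)
  show ?case
  proof (cases "n < 2")
    case True
    then have "n = 0 \<or> n = Suc 0" by auto
    then show ?thesis by (auto simp: smult_diff_right one_pCons numeral_poly)
  next
    case False
    then obtain l where l: "n = Suc (Suc l)" by (metis less_2_cases_iff not0_implies_Suc One_nat_def)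
    have IH: "smult 2 (cheb_rec [:0, 1:] (Suc (Suc (Suc l))))
        = (cheb_rec [:0, 2:] (Suc (Suc (Suc l))) - cheb_rec [:0, 2:] (Suc l) :: 'a poly)"
      "smult 2 (cheb_rec [:0, 1:] (Suc (Suc l))) = (cheb_rec [:0, 2:] (Suc (Suc l)) - cheb_rec [:0, 2:] l :: 'a poly)"
      using less.IH[of "Suc l"] less.IH[of l] l by simp_all
    have "smult 2 (cheb_rec [:0, 1:] (Suc (Suc n))) =
        [:0, 2:] * smult 2 (cheb_rec [:0, 1:] (Suc (Suc (Suc l)))) - smult 2 (cheb_rec [:0, 1:] (Suc (Suc l)) :: 'a poly)"
      by (simp only: l cheb_rec.simps(3)[of _ "Suc (Suc l)"] smult_diff_right mult_smult_right)
    also have "\<dots> = ([:0, 2:] * cheb_rec [:0, 2:] (Suc (Suc (Suc l))) - cheb_rec [:0, 2:] (Suc (Suc l)))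
        - ([:0, 2:] * cheb_rec [:0, 2:] (Suc l) - cheb_rec [:0, 2:] l)"
      unfolding IH right_diff_distrib by (simp only: algebra_simps)
    also have "\<dots> = cheb_rec [:0, 2:] (Suc (Suc n)) - cheb_rec [:0, 2:] n"
      unfolding l by (simp only: cheb_rec.simps(3))
    finally show ?thesis .
  qed
qed

lemma monT_eq_monU:
  assumes "k \<ge> 1"
  shows "monT k = (monU k - smult (1/4) (monU (k - 2)) :: 'a::real_field poly)"
proof (cases "k = 1")
  case True
  have "monU 1 = ([:0, 1:] :: 'a poly)" "monT 1 = ([:0, 1:] :: 'a poly)"
    using monU_of_nat[of 1, where 'a='a] monT_of_nat_Suc[of 0, where 'a='a] by simp_all
  with True show ?thesis by (simp add: monU_def)
next
  case False
  define n where "n = nat (k - 2)"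
  have k: "k = int (Suc (Suc n))" "k - 2 = int n"
    using assms False by (auto simp: n_def)
  have U: "monU k = (smult ((1/2)^Suc (Suc n)) (cheb_rec [:0, 2:] (Suc (Suc n))) :: 'a poly)"
    "monU (k - 2) = (smult ((1/2)^n) (cheb_rec [:0, 2:] n) :: 'a poly)"
    using k by (metis monU_of_nat)+
  have "monT k = smult ((1/2)^(Suc (Suc n))) (smult 2 (cheb_rec [:0, 1:] (Suc (Suc n))) :: 'a poly)"
    unfolding k monT_of_nat_Suc by (simp del: cheb_rec.simps)
  also have "\<dots> = monU k - smult (1/4) (monU (k - 2))"
    unfolding U cheb_rec_T_U by (simp add: smult_diff_right del: cheb_rec.simps)
  finally show ?thesis .
qed

lemma monT_0: "monT 0 = 1" by (simp add: monT_def)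

text \<open>Works with the values \<open>u k\<close> at one fixed point, so that the identities
  become field algebra over a scalar recurrence. Since \<open>u\<close> is 0 at negative indices,
  the recurrence fails at \<open>k = -1\<close>; that failure is what produces the perturbed
  coefficients below.\<close>

locale monU_values =
  fixes x :: "'a::real_field" and u :: "int \<Rightarrow> 'a" and m :: int
  assumes m: "m \<ge> 2"
    and u_neg: "\<And>k. k < 0 \<Longrightarrow> u k = 0"
    and u_0: "u 0 = 1"
    and u_rec: "\<And>k. k \<ge> 0 \<Longrightarrow> u (k + 1) = x * u k - u (k - 1) / 4"
begin

lemma u_1: "u 1 = x"
  using u_rec[of 0] by (simp add: u_neg u_0)

lemma u_step: "k \<ge> 1 \<Longrightarrow> u k = x * u (k - 1) - u (k - 2) / 4"
  using u_rec[of "k - 1"] by simp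

text \<open>The addition theorem for sin((i + j + 1) \<theta>). For fixed \<open>j\<close> both
  sides solve the same second-order recurrence in \<open>i\<close>, so the induction carries two
  consecutive values.\<close>

lemma u_add:
  assumes "i \<ge> 0" "j \<ge> 0"
  shows "u (i + j) = u i * u j - u (i - 1) * u (j - 1) / 4"
proof -
  have "u (int a + j) = u (int a) * u j - u (int a - 1) * u (j - 1) / 4 \<and>
    u (int a + 1 + j) = u (int a + 1) * u j - u (int a) * u (j - 1) / 4" for a
  proof (induction a)
    case 0
    show ?case using u_rec[of j] assms by (simp add: u_neg u_0 u_1 algebra_simps)
  next
    case (Suc a)
    have "u (int (Suc a) + 1 + j) = x * u (int a + 1 + j) - u (int a + j) / 4"
      using u_rec[of "int a + 1 + j"] assms by (simp add: algebra_simps)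
    moreover have "u (int (Suc a) + 1) = x * u (int a + 1) - u (int a) / 4"
      using u_rec[of "int a + 1"] by (simp add: algebra_simps)
    ultimately have "u (int (Suc a) + 1 + j) = u (int (Suc a) + 1) * u j - u (int (Suc a)) * u (j - 1) / 4"
      if "u (int a + 1 + j) = u (int a + 1) * u j - u (int a) * u (j - 1) / 4"
        "u (int a + j) = u (int a) * u j - u (int a - 1) * u (j - 1) / 4"
      using that u_rec[of "int a"] by (simp add: add.commute field_simps; algebra)
    then show ?case using Suc by (auto simp: add.commute)
  qed
  from this[of "nat i"] show ?thesis using assms by simp
qed

text \<open>A Casorati determinant of the recurrence: each step multiplies it by 1/4.\<close>

lemma u_turan:
  assumes "k \<ge> 0"
  shows "u k ^ 2 - u (k - 1) * u (k + 1) = (1/4) ^ nat k"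
proof -
  have "u (int a) ^ 2 - u (int a - 1) * u (int a + 1) = (1/4) ^ a" for a
  proof (induction a)
    case (Suc a)
    have "u (int (Suc a) + 1) = x * u (int a + 1) - u (int a) / 4"
      using u_rec[of "int a + 1"] by (simp add: algebra_simps)
    moreover have "u (int a + 1) = x * u (int a) - u (int a - 1) / 4"
      using u_rec[of "int a"] by (simp add: algebra_simps)
    ultimately have "u (int (Suc a)) ^ 2 - u (int (Suc a) - 1) * u (int (Suc a) + 1) =
       (u (int a) ^ 2 - u (int a - 1) * u (int a + 1)) / 4"
      by (simp add: add.commute power2_eq_square field_simps; algebra)
    with Suc show ?case by simp
  qed (simp add: u_neg u_0)
  from this[of "nat k"] show ?thesis using assms by simp
qed

text \<open>The values of \<open>A\<^sub>j\<close> and \<open>B\<^sub>j\<close> at \<open>x\<close>, with \<open>d\<close> in the role of \<open>1/4 - t\<^bsub>2m(n+1)\<^esub>\<close>.\<close>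

definition Aval where "Aval d j = u j + d * (u (j - m) * u (m - 2) - u (j - m - 1) * u (m - 1))"
definition Bval where "Bval d j = u (2*m - 2 - j) + d * (u (m - j - 3) * u (m - 1) - u (m - j - 2) * u (m - 2))"

text \<open>The factor of \<open>d\<close> vanishes for \<open>j < m\<close> and solves the
  unperturbed recurrence from \<open>m + 1\<close> on. Where it is switched on, at
  \<open>j = m - 1\<close> and \<open>j = m\<close>, the recurrence of \<open>u\<close> breaks at
  negative indices, which shifts the coefficient by \<open>- d\<close> and then by
  \<open>+ d\<close>.\<close>

lemma Aval_rec:
  assumes "0 \<le> j" "j \<le> 2*m - 2"
    and "j \<noteq> m - 1 \<Longrightarrow> j \<noteq> m \<Longrightarrow> c = 1/4"
    and "j = m - 1 \<Longrightarrow> c = 1/4 - d" "j = m \<Longrightarrow> c = 1/4 + d"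
  shows "Aval d (j + 1) = x * Aval d j - c * Aval d (j - 1)"
proof -
  consider "j \<le> m - 2" | "j = m - 1" | "j = m" | "j \<ge> m + 1" by linarith
  then show ?thesis
  proof cases
    case 1
    then show ?thesis using assms u_rec[of j] by (simp add: Aval_def u_neg)
  next
    case 2
    then have c: "c = 1/4 - d" using assms by simp
    show ?thesis unfolding 2 c using m u_step[of m]
      by (simp add: Aval_def u_neg u_0 algebra_simps)
  next
    case 3
    then have c: "c = 1/4 + d" using assms by simp
    show ?thesis unfolding 3 c using m u_rec[of m]
      by (simp add: Aval_def u_neg u_0 u_1 algebra_simps)
  next
    case 4
    have *: "u (j + 1) = x * u j - u (j - 1) / 4"
      "u (j + 1 - m) = x * u (j - m) - u (j - 1 - m) / 4"
      "u (j - m) = x * u (j - m - 1) - u (j - 1 - m - 1) / 4"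
      subgoal using u_rec[of j] assms by simp
      subgoal using u_step[of "j + 1 - m"] 4 by (simp add: algebra_simps)
      subgoal using u_step[of "j - m"] 4 by (simp add: algebra_simps)
      done
    have c: "c = 1/4" "j + 1 - m - 1 = j - m" using assms 4 by auto
    show ?thesis unfolding Aval_def c * by (simp add: field_simps)
  qed
qed

text \<open>In the representation of P, B_j carries a product of consecutive coefficients t.
  Dividing the recurrence by the shorter product moves the coefficient from the oldest term to the
  newest, so \<open>c\<close> stands at \<open>j + 1\<close> and the exceptional indices are one
  lower than for \<open>Aval\<close>. At \<open>j = 2*m - 2\<close> the coefficient is
  t_{2m(n+1)+m}, which may differ from 1/4; it is left free because
  \<open>Bval d (2*m - 1) = 0\<close>.\<close>

lemma Bval_rec:
  assumes "0 \<le> j" "j \<le> 2*m - 2"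
    and "j \<noteq> m - 2 \<Longrightarrow> j \<noteq> m - 1 \<Longrightarrow> j \<noteq> 2*m - 2 \<Longrightarrow> c = 1/4"
    and "j = m - 2 \<Longrightarrow> c = 1/4 - d" "j = m - 1 \<Longrightarrow> c = 1/4 + d"
  shows "c * Bval d (j + 1) = x * Bval d j - Bval d (j - 1)"
proof -
  consider "j \<le> m - 3" | "j = m - 2" | "j = m - 1" | "j \<ge> m" "j \<le> 2*m - 3" | "j = 2*m - 2"
    using assms by linarith
  then show ?thesis
  proof cases
    case 1
    have *: "u (2*m - 2 - (j - 1)) = x * u (2*m - 2 - j) - u (2*m - 2 - (j + 1)) / 4"
      "u (m - (j - 1) - 3) = x * u (m - j - 3) - u (m - (j + 1) - 3) / 4"
      "u (m - (j - 1) - 2) = x * u (m - j - 2) - u (m - (j + 1) - 2) / 4"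
      using u_rec[of "2*m - 2 - j"] u_rec[of "m - j - 3"] u_rec[of "m - j - 2"] assms 1
      by (simp_all add: algebra_simps)
    have c: "c = 1/4" using assms 1 by auto
    show ?thesis unfolding Bval_def * c by (simp add: field_simps)
  next
    case 2
    have "u (1 + m) = x * u m - u (m - 1) / 4" using u_rec[of m] m by (simp add: add.commute)
    moreover have c: "c = 1/4 - d" using assms 2 by simp
    ultimately show ?thesis unfolding 2 c using m
      by (simp add: Bval_def u_neg u_0 u_1 algebra_simps)
  next
    case 3
    then have c: "c = 1/4 + d" using assms by simp
    show ?thesis unfolding 3 c using m u_step[of m]
      by (simp add: Bval_def u_neg u_0 algebra_simps)
  next
    case 4
    have *: "u (2*m - 2 - (j - 1)) = x * u (2*m - 2 - j) - u (2*m - 2 - (j + 1)) / 4"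
      using u_rec[of "2*m - 2 - j"] 4 by (simp_all add: algebra_simps)
    have c: "c = 1/4" using assms 4 by auto
    show ?thesis unfolding Bval_def * c using 4 by (simp add: u_neg field_simps)
  next
    case 5
    then show ?thesis using m by (simp add: Bval_def u_neg u_0 u_1)
  qed
qed

text \<open>The indices -1 and 2m - 1 are the two ends of a block, where consecutive blocks are
  glued; \<open>j = m - 1\<close> belongs to P_{2m(n+1)}.\<close>

lemma Aval_minus_1: "Aval d (-1) = 0" and Aval_0: "Aval d 0 = 1"
  and Bval_minus_1: "Bval d (-1) = u (2*m - 1)"
  and Aval_last: "Aval d (2*m - 1) = u (2*m - 1)" and Bval_last: "Bval d (2*m - 1) = 0"
  and Bval_penultimate: "Bval d (2*m - 2) = 1"
  and Aval_mid: "Aval d (m - 1) = u (m - 1)" and Bval_mid: "Bval d (m - 1) = u (m - 1)"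
  using m by (simp_all add: Aval_def Bval_def u_neg u_0)

lemma Bval_0: "Bval d 0 = u (2*m - 2) - d * (1/4) ^ nat (m - 2)"
  using m u_turan[of "m - 2"] by (simp add: Bval_def power2_eq_square algebra_simps)

lemma Aval_penultimate: "Aval d (2*m - 2) = u (2*m - 2) + d * (1/4) ^ nat (m - 2)"
  using m u_turan[of "m - 2"] by (simp add: Aval_def power2_eq_square algebra_simps)

definition Tval where "Tval k = u k - u (k - 2) / 4"

lemma u_double: "u (2*m - 1) = u (m - 1) * Tval m"
  using u_add[of "m - 1" m] m by (simp add: Tval_def algebra_simps)

lemma Tval_double: "Tval (2*m) = x * u (2*m - 1) - u (2*m - 2) / 2"
  using u_rec[of "2*m - 1"] m by (simp add: Tval_def)

lemma u_mult_Tval: "u (m - 1) * Tval (m - 1) = u (2*m - 2) + (1/4) ^ nat (m - 1)"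
proof -
  have "nat (m - 1) = Suc (nat (m - 2))" using m by linarith
  then have e: "(1/4::'a) ^ nat (m - 1) = (u (m - 2) ^ 2 - u (m - 3) * u (m - 1)) / 4"
    using u_turan[of "m - 2"] m by simp
  have "u (2*m - 2) = u (m - 1) * u (m - 1) - u (m - 2) * u (m - 2) / 4"
    using u_add[of "m - 1" "m - 1"] m by (simp add: algebra_simps)
  then show ?thesis
    unfolding e by (simp add: Tval_def field_simps power2_eq_square)
qed

end

section \<open>The block structure of the recurrence\<close>

lemma monU_values_poly: "(m::int) \<ge> 2 \<Longrightarrow> monU_values x (\<lambda>k. poly (monU k) x) m"
  by unfold_locales (simp_all add: monU_neg monU_0 monU_rec)

lemma monT_eq_Tval:
  assumes "(m::int) \<ge> 2" "k \<ge> 1"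
  shows "poly (monT k) x = monU_values.Tval (\<lambda>k. poly (monU k) x) k"
proof -
  interpret monU_values x "\<lambda>k. poly (monU k) x" m
    by (rule monU_values_poly) fact
  show ?thesis using assms by (simp add: monT_eq_monU Tval_def)
qed

section \<open>The recurrence of P inside a block and across blocks\<close>

locale perturbed_chebyshev =
  fixes m :: nat and t :: "nat \<Rightarrow> complex"
  assumes m: "m \<ge> 2"
    and t0: "t 0 = 0"
    and t_nonzero: "\<forall>n\<ge>1. t n \<noteq> 0"
    and t_quarter: "\<forall>n. \<forall>j\<in>{0..2*m - 1} - {0, 1, m, m + 1}. t (2*m*n + j) = 1/4"
    and t_half: "\<forall>n. t (2*m*n) + t (2*m*n + 1) = 1/2 \<and> t (2*m*n + m) + t (2*m*n + m + 1) = 1/2"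
begin

abbreviation "P \<equiv> monic_op (\<lambda>_. 0) t"
abbreviation "Q \<equiv> monic_op (r_coeff m t) (s_coeff m t)"
abbreviation "\<delta> n \<equiv> 1/4 - t (2*m*(n + 1))"

text \<open>The hypothesis counts blocks from 2mn, the representation of P from 2mn + m. In the
  shifted count the inner exceptional pair sits at offsets m and m + 1, and offsets from m on belong
  to block n + 1 of the hypothesis.\<close>

lemma t_block:
  assumes "2 \<le> i" "i \<le> 2*m - 1" "i \<noteq> m" "i \<noteq> m + 1"
  shows "t (2*m*n + m + i) = 1/4"
proof (cases "i < m")
  case True
  then show ?thesis using t_quarter[rule_format, of "m + i" n] assms by (simp add: add.assoc)
next
  case False
  have "2*m*n + m + i = 2*m*(n + 1) + (i - m)" using False by (simp add: algebra_simps)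
  moreover have "i - m \<in> {0..2*m - 1} - {0, 1, m, m + 1}" using assms False by auto
  ultimately show ?thesis using t_quarter[rule_format, of "i - m" "n + 1"] by metis
qed

lemma t_block_m: "t (2*m*n + m + m) = 1/4 - \<delta> n"
  by (simp add: algebra_simps mult_2_right)

lemma t_block_Suc_m: "t (2*m*n + m + (m + 1)) = 1/4 + \<delta> n"
proof -
  have "t (2*m*n + m + (m + 1)) = 1/2 - t (2*m*(n + 1))"
    using t_half[rule_format, of "n + 1"] by (simp add: algebra_simps mult_2_right)
  then show ?thesis by simp
qed

lemma P_Suc:
  assumes "k \<ge> 1"
  shows "poly (P (k + 1)) x = x * poly (P k) x - t k * poly (P (k - 1)) x"
  using assms by (cases k) auto

lemma Q_Suc: "poly (Q (n + 2)) y = (y - r_coeff m t (n + 1)) * poly (Q (n + 1)) y - s_coeff m t (n + 1) * poly (Q n) y"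
  by (simp add: algebra_simps)

lemma prod_block:
  "(\<Prod>k=1..2*m - 1. t (2*m*n + m + k)) = t (2*m*n + m + 1) * t (2*m*(n+1)) * t (2*m*(n+1) + 1) / 4 ^ (2*m - 4)"
proof -
  have "{1..2*m - 1} = {1, m, m + 1} \<union> ({2..m - 1} \<union> {m + 2..2*m - 1})" using m by auto
  then have "(\<Prod>k=1..2*m - 1. t (2*m*n + m + k)) =
    (\<Prod>k\<in>{1, m, m + 1}. t (2*m*n + m + k)) * (\<Prod>k\<in>{2..m - 1} \<union> {m + 2..2*m - 1}. t (2*m*n + m + k))"
    using m by (simp only:, intro prod.union_disjoint) auto
  also have "(\<Prod>k\<in>{2..m - 1} \<union> {m + 2..2*m - 1}. t (2*m*n + m + k)) = (\<Prod>k\<in>{2..m - 1} \<union> {m + 2..2*m - 1}. 1/4)"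
    using m by (intro prod.cong refl t_block) auto
  also have "\<dots> = (1/4) ^ (2*m - 4)"
  proof -
    have "card ({2..m - 1} \<union> {m + 2..2*m - 1}) = 2*m - 4"
      using m by (subst card_Un_disjoint) auto
    then show ?thesis by simp
  qed
  also have "(\<Prod>k\<in>{1, m, m + 1}. t (2*m*n + m + k)) = t (2*m*n + m + 1) * t (2*m*(n+1)) * t (2*m*(n+1) + 1)"
    using m by (simp add: algebra_simps mult_2_right)
  finally show ?thesis by (simp add: power_one_over)
qed

text \<open>The origin of s_{n+1}: it is the product of all 2m coefficients t_{2mn+m+1}, ...,
  t_{2m(n+1)+m}, which Q_n has collected by the time P enters the next block.\<close>

lemma prod_eq_s_coeff:
  "t (2*m*(n+1) + m) * (\<Prod>k=1..2*m - 1. t (2*m*n + m + k)) = s_coeff m t (n + 1)"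
  unfolding prod_block s_coeff_def by simp

text \<open>From t_0 = 0 follows t_1 = 1/2, the one coefficient in which the recurrences of the
  monic T and the monic U differ. Since t_k = 1/4 is available only for 2 <= k <= m - 1, the claim
  stops at index m.\<close>

lemma P_eq_Tval:
  fixes x :: complex
  assumes "1 \<le> j" "j \<le> m"
  shows "poly (P j) x = monU_values.Tval (\<lambda>k. poly (monU k) x) (int j)"
proof -
  interpret monU_values x "\<lambda>k. poly (monU k) x" "int m"
    by (rule monU_values_poly) (use m in simp)
  have t1: "t 1 = 1/2" using t_half[rule_format, of 0] t0 by simp
  have u2: "poly (monU 2) x = x\<^sup>2 - 1/4"
    using u_rec[of 1] by (simp add: u_1 u_0 power2_eq_square)
  have "1 \<le> j \<longrightarrow> j \<le> m \<longrightarrow> poly (P j) x = Tval (int j)"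
  proof (induction j rule: less_induct)
    case (less j)
    show ?case
    proof (intro impI)
      assume j: "1 \<le> j" "j \<le> m"
      consider "j = 1" | "j = 2" | "j \<ge> 3" using j by linarith
      then show "poly (P j) x = Tval (int j)"
      proof cases
        case 1
        then show ?thesis by (simp add: Tval_def u_1 u_neg)
      next
        case 2
        then show ?thesis
          using t1 by (simp add: Tval_def u2 u_0 numeral_2_eq_2[symmetric] power2_eq_square)
             (simp add: numeral_2_eq_2 power2_eq_square)
      next
        case 3
        define k where "k = j - 1"
        have k: "j = k + 1" "k \<ge> 2" "k \<le> m - 1" using 3 j by (auto simp: k_def)
        have "k \<in> {0..2*m - 1} - {0, 1, m, m + 1}" using k m by auto
        then have "t k = 1/4" using t_quarter[rule_format, of k 0] by simp
        then have "poly (P j) x = x * poly (P k) x - poly (P (k - 1)) x / 4"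
          using P_Suc[of k x] k by simp
        also have "poly (P k) x = Tval (int k)" using less[of k] k j by auto
        also have "poly (P (k - 1)) x = Tval (int (k - 1))" using less[of "k - 1"] k j by auto
        also have "x * Tval (int k) - Tval (int (k - 1)) / 4 = Tval (int j)"
        proof -
          have *: "poly (monU (int j)) x = x * poly (monU (int k)) x - poly (monU (int k - 1)) x / 4"
            using u_rec[of "int k"] k by (simp add: add.commute)
          have **: "poly (monU (int k - 1)) x = x * poly (monU (int k - 2)) x - poly (monU (int k - 3)) x / 4"
            using u_rec[of "int k - 2"] k by simp
          have idx: "int j - 2 = int k - 1" "int (k - 1) = int k - 1" "int k - 1 - 2 = int k - 3"
            using k by auto
          show ?thesis unfolding Tval_def idx * ** by (simp add: field_simps)
        qed
        finally show ?thesis .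
      qed
    qed
  qed
  with assms show ?thesis by blast
qed

text \<open>The origin of r_n. The left side is the coefficient of Q_n after one step of P out of
  the previous block. The right side is what the representation in block \<open>n\<close> demands
  once Q_{n+1} is expanded by its recurrence. For \<open>n = 0\<close> the value 1/4 - t_0 = 1/4
  replaces the missing previous block.\<close>

lemma transition:
  fixes x :: complex
  shows "x * poly (monU (2 * int m - 1)) x
      - t (2*m*n + m) * (poly (monU (2 * int m - 2)) x + (1/4 - t (2*m*n)) * (1/4) ^ (m - 2))
    = poly (monT (2 * int m)) x - r_coeff m t n
      + t (2*m*n + m + 1) * (poly (monU (2 * int m - 2)) x - \<delta> n * (1/4) ^ (m - 2))"
proof -
  interpret monU_values x "\<lambda>k. poly (monU k) x" "int m"
    by (rule monU_values_poly) (use m in simp)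
  have y: "poly (monT (2 * int m)) x = x * poly (monU (2 * int m - 1)) x - poly (monU (2 * int m - 2)) x / 2"
    using Tval_double m by (subst monT_eq_Tval[where m = "int m"]) auto
  have a: "t (2*m*n + m + 1) = 1/2 - t (2*m*n + m)" and b: "t (2*m*n + 1) = 1/2 - t (2*m*n)"
    using t_half[rule_format, of n] by (simp_all add: algebra_simps)
  have "(2::complex) ^ (2*m - 4) = 4 ^ (m - 2)"
    using power_mult[of "2::complex" 2 "m - 2"] by (simp add: right_diff_distrib')
  then have r: "r_coeff m t n = (1/4) ^ (m - 2) * (t (2*m*n + m) * (1/2 - t (2*m*n)) + t (2*m*(n + 1)) * (1/2 - t (2*m*n + m)) - 1/8)"
    unfolding r_coeff_def a b by (simp add: power_one_over)
  show ?thesis unfolding y r a by (simp add: field_simps)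
qed

text \<open>Here \<open>i = j + 1\<close>: the case \<open>i = 0\<close>, where \<open>A\<^bsub>-1\<^esub> = 0\<close>, is the end of the previous block, so
  that the recurrence can be started inside a block.\<close>

definition block_formula :: "complex \<Rightarrow> nat \<Rightarrow> nat \<Rightarrow> bool" where
  "block_formula x n i \<longleftrightarrow> poly (monU (int m - 1)) x * poly (P (2*m*n + m + i)) x =
     monU_values.Aval (\<lambda>k. poly (monU k) x) (int m) (\<delta> n) (int i - 1) * poly (Q (n + 1)) (poly (monT (2 * int m)) x)
     + (\<Prod>k=1..i. t (2*m*n + m + k)) * monU_values.Bval (\<lambda>k. poly (monU k) x) (int m) (\<delta> n) (int i - 1)
       * poly (Q n) (poly (monT (2 * int m)) x)"

lemma block_formula_Suc:
  assumes "block_formula x n i" "block_formula x n (i + 1)" "i + 2 \<le> 2*m"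
  shows "block_formula x n (i + 2)"
proof -
  interpret monU_values x "\<lambda>k. poly (monU k) x" "int m"
    by (rule monU_values_poly) (use m in simp)
  define q where "q = poly (Q (n + 1)) (poly (monT (2 * int m)) x)"
  define q' where "q' = poly (Q n) (poly (monT (2 * int m)) x)"
  define \<pi> where "\<pi> i = (\<Prod>k=1..i. t (2*m*n + m + k))" for i
  define T where "T i = t (2*m*n + m + i)" for i
  have \<pi>: "\<pi> (i + 1) = T (i + 1) * \<pi> i" "\<pi> (i + 2) = T (i + 2) * T (i + 1) * \<pi> i"
    unfolding \<pi>_def T_def by simp_all
  have T: "T i = 1/4" if "2 \<le> i" "i \<le> 2*m - 1" "i \<noteq> m" "i \<noteq> m + 1" for i
    unfolding T_def using that by (rule t_block)
  have Tm: "T m = 1/4 - \<delta> n" "T (m + 1) = 1/4 + \<delta> n"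
    unfolding T_def using t_block_m t_block_Suc_m by auto
  have A: "Aval (\<delta> n) (int i + 1) = x * Aval (\<delta> n) (int i) - T (i + 1) * Aval (\<delta> n) (int i - 1)"
  proof (cases "i = 0")
    case True
    then show ?thesis using Aval_rec[of 0 "1/4" "\<delta> n"] m by (simp add: Aval_minus_1)
  next
    case False
    have "int i \<noteq> int m - 1 \<Longrightarrow> int i \<noteq> int m \<Longrightarrow> T (i + 1) = 1/4"
      using False assms(3) by (intro T) auto
    moreover have "T (i + 1) = 1/4 - \<delta> n" if "int i = int m - 1"
    proof -
      have "i + 1 = m" using that by linarith
      then show ?thesis using Tm by simp
    qed
    moreover have "int i = int m \<Longrightarrow> T (i + 1) = 1/4 + \<delta> n"
      using Tm by simp
    ultimately show ?thesis using assms(3) by (intro Aval_rec) auto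
  qed
  have B: "T (i + 2) * Bval (\<delta> n) (int i + 1) = x * Bval (\<delta> n) (int i) - Bval (\<delta> n) (int i - 1)"
  proof (rule Bval_rec)
    show "int i \<noteq> int m - 2 \<Longrightarrow> int i \<noteq> int m - 1 \<Longrightarrow> int i \<noteq> 2 * int m - 2 \<Longrightarrow> T (i + 2) = 1/4"
      using assms(3) by (intro T) auto
    show "T (i + 2) = 1/4 - \<delta> n" if "int i = int m - 2"
    proof -
      have "i + 2 = m" using that by linarith
      then show ?thesis using Tm by simp
    qed
    show "T (i + 2) = 1/4 + \<delta> n" if "int i = int m - 1"
    proof -
      have "i + 2 = m + 1" using that by linarith
      then show ?thesis using Tm by simp
    qed
  qed (use assms in auto)
  have P2: "poly (P (2*m*n + m + (i + 2))) x = x * poly (P (2*m*n + m + (i + 1))) x - T (i + 1) * poly (P (2*m*n + m + i)) x"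
    using P_Suc[of "2*m*n + m + (i + 1)" x] unfolding T_def by simp
  note L = assms(1,2)[unfolded block_formula_def, folded q_def q'_def, folded \<pi>_def]
  have i1: "int (i + 1) - 1 = int i" "int (i + 2) - 1 = int i + 1" by simp_all
  have "poly (monU (int m - 1)) x * poly (P (2*m*n + m + (i + 2))) x =
     x * (poly (monU (int m - 1)) x * poly (P (2*m*n + m + (i + 1))) x)
     - T (i + 1) * (poly (monU (int m - 1)) x * poly (P (2*m*n + m + i)) x)"
    by (simp only: P2 right_diff_distrib mult.left_commute)
  also have "\<dots> = x * (Aval (\<delta> n) (int i) * q + \<pi> (i + 1) * Bval (\<delta> n) (int i) * q')
     - T (i + 1) * (Aval (\<delta> n) (int i - 1) * q + \<pi> i * Bval (\<delta> n) (int i - 1) * q')"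
    unfolding L i1 ..
  also have "\<dots> = Aval (\<delta> n) (int i + 1) * q + \<pi> (i + 2) * Bval (\<delta> n) (int i + 1) * q'"
  proof -
    have C: "\<pi> (i + 2) * Bval (\<delta> n) (int i + 1) = T (i + 1) * \<pi> i * (x * Bval (\<delta> n) (int i) - Bval (\<delta> n) (int i - 1))"
      unfolding \<pi> B[symmetric] by simp
    show ?thesis unfolding A C \<pi>(1) by (simp add: algebra_simps)
  qed
  finally show ?thesis
    unfolding block_formula_def q_def[symmetric] q'_def[symmetric] \<pi>_def[symmetric] i1 .
qed

lemma block_formula_all_i:
  assumes "block_formula x n 0" "block_formula x n 1" "i \<le> 2*m"
  shows "block_formula x n i"
  using assms(3)
proof (induction i rule: less_induct)
  case (less i)
  consider "i = 0" | "i = 1" | "i \<ge> 2" by linarith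
  then show ?case
  proof cases
    case 3
    then show ?thesis using block_formula_Suc[of x n "i - 2"] less.IH[of "i - 2"] less.IH[of "i - 1"] less.prems
      by (simp add: Suc_diff_Suc numeral_2_eq_2)
  qed (use assms in auto)
qed

lemma block_formula: "i \<le> 2*m \<Longrightarrow> block_formula x n i"
proof (induction n arbitrary: i)
  case 0
  interpret monU_values x "\<lambda>k. poly (monU k) x" "int m"
    by (rule monU_values_poly) (use m in simp)
  have "block_formula x 0 0"
    unfolding block_formula_def using m
    by (simp add: Aval_minus_1 Bval_minus_1 P_eq_Tval u_double)
  moreover have "block_formula x 0 1"
  proof -
    have "poly (P (m + 1)) x = x * Tval (int m) - t m * Tval (int m - 1)"
      using P_Suc[of m x] P_eq_Tval[of m x] P_eq_Tval[of "m - 1" x] m by (simp add: of_nat_diff)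
    then have "poly (monU (int m - 1)) x * poly (P (m + 1)) x =
       x * poly (monU (2 * int m - 1)) x - t m * (poly (monU (2 * int m - 2)) x + (1/4 - 0) * (1/4) ^ (m - 2))"
    proof -
      have "(1/4) ^ nat (int m - 1) = (1/4 - 0) * (1/4::complex) ^ (m - 2)"
        using m by (simp add: nat_diff_distrib power_Suc[symmetric] Suc_diff_Suc numeral_2_eq_2 del: power_Suc)
      then show ?thesis
        unfolding \<open>poly (P (m + 1)) x = _\<close> u_double using u_mult_Tval by (simp add: algebra_simps)
    qed
    then show ?thesis
      unfolding block_formula_def using transition[of x 0] t0 m
      by (simp add: Aval_0 Bval_0 nat_diff_distrib)
  qed
  ultimately show ?case using block_formula_all_i 0 by blast
next
  case (Suc n)
  interpret monU_values x "\<lambda>k. poly (monU k) x" "int m"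
    by (rule monU_values_poly) (use m in simp)
  \<comment> \<open>Offsets 2m and 2m - 1 of block \<open>n\<close> are the two consecutive values
    from which the recurrence starts in block \<open>n + 1\<close>.\<close>
  have last: "block_formula x n (2*m)" "block_formula x n (2*m - 1)" using Suc.IH by auto
  have idx: "2*m*n + m + 2*m = 2*m*(n+1) + m" "2*m*n + m + (2*m - 1) = 2*m*(n+1) + m - 1"
    using m by (simp_all add: algebra_simps)
  have L: "poly (monU (int m - 1)) x * poly (P (2*m*(n+1) + m)) x =
      poly (monU (2 * int m - 1)) x * poly (Q (n + 1)) (poly (monT (2 * int m)) x)"
    using last(1) unfolding block_formula_def idx by (simp add: Aval_last Bval_last)
  have i2: "int (2*m - 1) - 1 = 2 * int m - 2" using m by linarith
  have n2: "nat (int m - 2) = m - 2" by (simp add: nat_diff_distrib)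
  have L': "poly (monU (int m - 1)) x * poly (P (2*m*(n+1) + m - 1)) x =
      (poly (monU (2 * int m - 2)) x + \<delta> n * (1/4) ^ (m - 2)) * poly (Q (n + 1)) (poly (monT (2 * int m)) x)
      + (\<Prod>k=1..2*m - 1. t (2*m*n + m + k)) * poly (Q n) (poly (monT (2 * int m)) x)"
    using last(2) unfolding block_formula_def idx i2 by (simp add: Aval_penultimate Bval_penultimate n2)
  have "block_formula x (n + 1) 0"
    unfolding block_formula_def using L by (simp add: Aval_minus_1 Bval_minus_1)
  moreover have "block_formula x (n + 1) 1"
  proof -
    have pe: "poly (P (2*m*(n+1) + m + 1)) x = x * poly (P (2*m*(n+1) + m)) x - t (2*m*(n+1) + m) * poly (P (2*m*(n+1) + m - 1)) x"
      using P_Suc[of "2*m*(n+1) + m" x] m by simp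
    have "poly (monU (int m - 1)) x * poly (P (2*m*(n+1) + m + 1)) x =
       x * (poly (monU (int m - 1)) x * poly (P (2*m*(n+1) + m)) x)
       - t (2*m*(n+1) + m) * (poly (monU (int m - 1)) x * poly (P (2*m*(n+1) + m - 1)) x)"
      by (simp only: pe right_diff_distrib mult.left_commute)
    also have "\<dots> = (x * poly (monU (2 * int m - 1)) x - t (2*m*(n+1) + m) * (poly (monU (2 * int m - 2)) x + \<delta> n * (1/4) ^ (m - 2)))
        * poly (Q (n + 1)) (poly (monT (2 * int m)) x)
        - s_coeff m t (n + 1) * poly (Q n) (poly (monT (2 * int m)) x)"
      unfolding L L' prod_eq_s_coeff[symmetric] by (simp add: algebra_simps)
    also have "\<dots> = poly (Q (n + 2)) (poly (monT (2 * int m)) x) + t (2*m*(n+1) + m + 1) *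
       (poly (monU (2 * int m - 2)) x - \<delta> (n + 1) * (1/4) ^ (m - 2)) * poly (Q (n + 1)) (poly (monT (2 * int m)) x)"
      unfolding transition Q_Suc by (simp add: algebra_simps)
    finally show ?thesis
      unfolding block_formula_def by (simp add: Aval_0 Bval_0 n2 del: monic_op.simps)
  qed
  ultimately show ?case using block_formula_all_i[of x "n + 1" i] Suc.prems by simp
qed

lemma P_block:
  assumes "j \<le> 2*m - 1"
  shows "poly (monU (int m - 1)) x * poly (P (2*m*n + m + j + 1)) x =
    poly (A_poly m t j n) x * poly (Q (n + 1)) (poly (monT (2 * int m)) x)
    + (\<Prod>i=1..j + 1. t (2*m*n + m + i)) * poly (B_poly m t j n) x * poly (Q n) (poly (monT (2 * int m)) x)"
proof -
  interpret monU_values x "\<lambda>k. poly (monU k) x" "int m"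
    by (rule monU_values_poly) (use m in simp)
  have "poly (A_poly m t j n) x = Aval (\<delta> n) (int j)" "poly (B_poly m t j n) x = Bval (\<delta> n) (int j)"
    by (simp_all add: A_poly_def B_poly_def Aval_def Bval_def)
  moreover have "block_formula x n (j + 1)" using assms m by (intro block_formula) linarith
  ultimately show ?thesis unfolding block_formula_def by (simp del: prod.atLeast_Suc_atMost prod.cl_ivl_Suc)
qed

lemma prod_quarter:
  assumes "j \<le> m - 2"
  shows "(\<Prod>i=1..j + 1. t (2*m*n + m + i)) = (1/4) ^ j * t (2*m*n + m + 1)"
  using assms
proof (induction j)
  case (Suc j)
  have "t (2*m*n + m + (j + 2)) = 1/4" using Suc.prems m by (intro t_block) auto
  then show ?case using Suc by simp
qed simp

lemma B_poly_last: "B_poly m t (2*m - 1) n = 0"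
  using m by (simp add: B_poly_def monU_neg of_nat_diff)

lemma P_init: "j \<le> m \<Longrightarrow> P j = monT (int j)"
proof (cases "j = 0")
  case False
  assume "j \<le> m"
  with False have "poly (P j) x = poly (monT (int j)) x" for x
    using P_eq_Tval[of j x] monT_eq_Tval[of 2 "int j" x] by simp
  then show ?thesis using poly_eq_poly_eq_iff by blast
qed (simp add: monT_0)

text \<open>Seen from the value at 1, which is (k + 1) / 2^k.\<close>

lemma monU_nonzero: "k \<ge> 0 \<Longrightarrow> (monU k :: complex poly) \<noteq> 0"
proof
  assume k: "k \<ge> 0" "(monU k :: complex poly) = 0"
  interpret monU_values "1::complex" "\<lambda>k. poly (monU k) 1" 2
    by (rule monU_values_poly) simp
  have "poly (monU (int a)) (1::complex) = of_nat (a + 1) * (1/2) ^ a \<and>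
     poly (monU (int a + 1)) (1::complex) = of_nat (a + 2) * (1/2) ^ (a + 1)" for a
  proof (induction a)
    case (Suc a)
    have "poly (monU (int a + 1 + 1)) (1::complex) = poly (monU (int a + 1)) 1 - poly (monU (int a)) 1 / 4"
      using u_rec[of "int a + 1"] by simp
    also have "\<dots> = of_nat (Suc a + 2) * (1/2) ^ (Suc a + 1)"
      unfolding conjunct1[OF Suc] conjunct2[OF Suc] by (simp add: field_simps)
    finally show ?case using Suc by (simp add: add.commute)
  qed (simp add: u_1 u_0)
  from this[of "nat k"] k have "of_nat (nat k + 1) * (1/2::complex) ^ nat k = 0" by simp
  then show False by (simp only: mult_eq_0_iff of_nat_eq_0_iff) simp
qed

lemma P_mult_cancel:
  assumes "\<And>x::complex. poly (monU (int m - 1)) x * poly p x = poly (monU (int m - 1)) x * poly q x"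
  shows "p = q"
proof -
  have "monU (int m - 1) * p = monU (int m - 1) * q"
    using assms by (simp add: poly_eq_poly_eq_iff[symmetric] fun_eq_iff)
  then show ?thesis using monU_nonzero[of "int m - 1"] m by simp
qed

lemma P_at_m: "P (2*m*n + m) = monT (int m) * (Q n \<circ>\<^sub>p monT (2 * int m))"
proof (rule P_mult_cancel)
  fix x :: complex
  interpret monU_values x "\<lambda>k. poly (monU k) x" "int m"
    by (rule monU_values_poly) (use m in simp)
  have "poly (monT (int m)) x = Tval (int m)" using m by (intro monT_eq_Tval[of 2]) auto
  then show "poly (monU (int m - 1)) x * poly (P (2*m*n + m)) x =
    poly (monU (int m - 1)) x * poly (monT (int m) * (Q n \<circ>\<^sub>p monT (2 * int m))) x"
    using block_formula[of 0 x n] unfolding block_formula_def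
    by (simp add: Aval_minus_1 Bval_minus_1 u_double poly_pcompose)
qed

text \<open>For n >= 1 the product of t over the m indices 2m(n-1)+m+1, ..., 2mn, with its m - 2
  inner factors 1/4 collected.\<close>

definition g_coeff :: "nat \<Rightarrow> complex" where
  "g_coeff n = (1/4) ^ (m - 2) * t (2*m*(n - 1) + m + 1) * t (2*m*n)"

text \<open>At \<open>j = m - 1\<close> both A_j and B_j reduce to U_{m-1}, so the division by
  U_{m-1} is exact.\<close>

lemma P_at_0:
  assumes "n \<ge> 1"
  shows "P (2*m*n) = (Q n + smult (g_coeff n) (Q (n - 1))) \<circ>\<^sub>p monT (2 * int m)"
proof (rule P_mult_cancel)
  fix x :: complex
  interpret monU_values x "\<lambda>k. poly (monU k) x" "int m"
    by (rule monU_values_poly) (use m in simp)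
  obtain l where n: "n = l + 1" using assms by (metis add.commute le_Suc_ex)
  have "(\<Prod>i=1..k + 1. t (2*m*l + m + i)) = (\<Prod>i=1..k. t (2*m*l + m + i)) * t (2*m*l + m + (k + 1))" for k
    by simp
  note p = this[of "m - 2 + 1", unfolded prod_quarter[OF order_refl]]
  have m1: "m - 2 + 1 + 1 = m" and mn: "2*m*l + m + m = 2*m*n" using m by (simp_all add: n algebra_simps)
  have "n - 1 = l" using n by simp
  then have prod: "(\<Prod>i=1..m. t (2*m*l + m + i)) = g_coeff n"
    using p unfolding g_coeff_def m1 mn by simp
  show "poly (monU (int m - 1)) x * poly (P (2*m*n)) x =
    poly (monU (int m - 1)) x * poly ((Q n + smult (g_coeff n) (Q (n - 1))) \<circ>\<^sub>p monT (2 * int m)) x"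
    using block_formula[of m x l] unfolding block_formula_def prod mn
    by (simp add: Aval_mid Bval_mid poly_pcompose n algebra_simps)
qed

end

section \<open>Monic three-term recurrences\<close>

lemma poly_monic_op_Suc_Suc:
  "poly (monic_op b c (Suc (Suc n))) x
    = (x - b (Suc n)) * poly (monic_op b c (Suc n)) x - c (Suc n) * poly (monic_op b c n) x"
  by (simp add: algebra_simps)

lemma monic_op_degree:
  fixes b c :: "nat \<Rightarrow> 'a::idom"
  shows "degree (monic_op b c n) = n \<and> lead_coeff (monic_op b c n) = 1"
proof (induction b c n rule: monic_op.induct)
  case (3 b c n)
  let ?p = "[:- b (Suc n), 1:] * monic_op b c (Suc n)" and ?q = "smult (c (Suc n)) (monic_op b c n)"
  have "monic_op b c (Suc n) \<noteq> 0" using 3(1) by auto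
  then have "degree ?p = Suc (Suc n)"
    using 3(1) by (subst degree_mult_eq) auto
  moreover have "lead_coeff ?p = 1"
    using 3(1) unfolding lead_coeff_mult by (auto simp del: monic_op.simps)
  moreover have q: "degree ?q < Suc (Suc n)"
    using 3(2) degree_smult_le[of "c (Suc n)" "monic_op b c n"] by simp
  ultimately have "coeff (?p - ?q) (Suc (Suc n)) = 1"
    using coeff_eq_0[OF q] by (metis coeff_diff diff_zero)
  moreover have "degree (?p - ?q) \<le> Suc (Suc n)"
    using \<open>degree ?p = Suc (Suc n)\<close> q by (intro degree_diff_le) auto
  ultimately have "degree (?p - ?q) = Suc (Suc n)" "coeff (?p - ?q) (Suc (Suc n)) = 1"
    by (metis le_antisym le_degree one_neq_zero)+
  then show ?case
    unfolding monic_op.simps by metis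
qed auto

text \<open>Leading terms are removed one degree at a time. The witness in each degree can be chosen
  freely, which later allows a basis mixing two families of products.\<close>

lemma poly_functional_eq_0:
  fixes D :: "'a::field poly \<Rightarrow> 'a"
  assumes add: "\<And>p q. D (p + q) = D p + D q" and smult: "\<And>a p. D (smult a p) = a * D p"
    and basis: "\<And>d. d < n \<Longrightarrow> \<exists>e. degree e = d \<and> e \<noteq> 0 \<and> D e = 0"
    and "degree p < n"
  shows "D p = 0"
  using \<open>degree p < n\<close>
proof (induction "degree p" arbitrary: p rule: less_induct)
  case less
  obtain e where e: "degree e = degree p" "e \<noteq> 0" "D e = 0"
    using basis less.prems by blast
  define a where "a = lead_coeff p / lead_coeff e"
  define r where "r = p - smult a e"
  have p: "p = r + smult a e" by (simp add: r_def)
  have "coeff r (degree p) = 0"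
    using e leading_coeff_neq_0[of e] by (simp add: r_def a_def)
  moreover have "degree r \<le> degree p"
    unfolding r_def using e by (intro degree_diff_le) auto
  ultimately have "r = 0 \<or> degree r < degree p"
    using eq_zero_or_degree_less by blast
  then have "D r = 0"
    using less.hyps[of r] less.prems smult[of 0 0] by auto
  then show ?case by (subst p) (simp add: add smult e)
qed

section \<open>Gauss quadrature and Favard's theorem\<close>

text \<open>For a square matrix, orthonormal columns give orthonormal rows: the Gram matrix \<open>G\<close> of the
  rows is a symmetric idempotent of trace \<open>N\<close>, hence the Frobenius norm of \<open>G - 1\<close> is \<open>0\<close>.\<close>

lemma orthonormal_columns_imp_rows:
  fixes V :: "nat \<Rightarrow> nat \<Rightarrow> real"
  assumes V: "\<And>i j. i < N \<Longrightarrow> j < N \<Longrightarrow> (\<Sum>k<N. V k i * V k j) = (if i = j then 1 else 0)"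
    and "k < N" "l < N"
  shows "(\<Sum>i<N. V k i * V l i) = (if k = l then 1 else 0)"
proof -
  define G where "G k l = (\<Sum>i<N. V k i * V l i)" for k l
  define I where "I k l = (if k = l then 1 else 0 :: real)" for k l :: nat
  have tr: "(\<Sum>k<N. G k k) = N"
  proof -
    have "(\<Sum>k<N. G k k) = (\<Sum>i<N. \<Sum>k<N. V k i * V k i)"
      unfolding G_def by (rule sum.swap)
    also have "\<dots> = N" using V by simp
    finally show ?thesis .
  qed
  have sq: "(\<Sum>k<N. \<Sum>l<N. (G k l)\<^sup>2) = N"
  proof -
    have "(\<Sum>k<N. \<Sum>l<N. (G k l)\<^sup>2) = (\<Sum>k<N. \<Sum>l<N. \<Sum>i<N. \<Sum>j<N. V k i * V l i * (V k j * V l j))"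
      unfolding G_def by (simp add: power2_eq_square sum_product)
    also have "\<dots> = (\<Sum>k<N. \<Sum>i<N. \<Sum>l<N. \<Sum>j<N. V k i * V l i * (V k j * V l j))"
      by (rule sum.cong[OF refl], rule sum.swap)
    also have "\<dots> = (\<Sum>k<N. \<Sum>i<N. \<Sum>j<N. \<Sum>l<N. V k i * V l i * (V k j * V l j))"
      by (intro sum.cong[OF refl] sum.swap)
    also have "\<dots> = (\<Sum>i<N. \<Sum>k<N. \<Sum>j<N. \<Sum>l<N. V k i * V l i * (V k j * V l j))"
      by (rule sum.swap)
    also have "\<dots> = (\<Sum>i<N. \<Sum>j<N. \<Sum>k<N. \<Sum>l<N. V k i * V l i * (V k j * V l j))"
      by (intro sum.cong[OF refl] sum.swap)
    also have "\<dots> = (\<Sum>i<N. \<Sum>j<N. (\<Sum>k<N. V k i * V k j) * (\<Sum>l<N. V l i * V l j))"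
      by (simp add: sum_product algebra_simps)
    also have "\<dots> = (\<Sum>i<N. \<Sum>j<N. if i = j then 1 else 0)"
      using V by (intro sum.cong refl) auto
    also have "\<dots> = N" by simp
    finally show ?thesis .
  qed
  have "(\<Sum>k<N. \<Sum>l<N. (G k l - I k l)\<^sup>2) = (\<Sum>k<N. \<Sum>l<N. (G k l)\<^sup>2 - 2 * (if k = l then G k l else 0) + (if k = l then 1 else 0))"
    by (intro sum.cong refl) (auto simp: I_def power2_diff)
  also have "\<dots> = 0"
    using tr sq by (simp add: sum.distrib sum_subtractf sum_distrib_left[symmetric])
  finally have "(\<Sum>k<N. \<Sum>l<N. (G k l - I k l)\<^sup>2) = 0" .
  then have "\<forall>k\<in>{..<N}. (\<Sum>l<N. (G k l - I k l)\<^sup>2) = 0"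
    by (subst (asm) sum_nonneg_eq_0_iff) (auto intro: sum_nonneg)
  then have "(\<Sum>l<N. (G k l - I k l)\<^sup>2) = 0" using \<open>k < N\<close> by auto
  then have "\<forall>l\<in>{..<N}. (G k l - I k l)\<^sup>2 = 0"
    by (subst (asm) sum_nonneg_eq_0_iff) auto
  then show ?thesis using \<open>l < N\<close> by (auto simp: G_def I_def)
qed

section \<open>Roots of polynomials with a bounded real recurrence\<close>

lemma monic_op_reflect:
  fixes b c :: "nat \<Rightarrow> 'a::idom"
  shows "poly (monic_op (\<lambda>n. - b n) c n) (- x) = (-1) ^ n * poly (monic_op b c n) x"
  by (induction b c n rule: monic_op.induct) (simp_all add: algebra_simps)

locale bounded_recurrence =
  fixes b c :: "nat \<Rightarrow> real" and B C :: real
  assumes b_bound: "\<And>n. \<bar>b n\<bar> \<le> B"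
    and c_pos: "\<And>n. n \<ge> 1 \<Longrightarrow> 0 < c n" and c_bound: "\<And>n. n \<ge> 1 \<Longrightarrow> c n \<le> C"
begin

text \<open>The squared norm of the k-th polynomial under the orthogonality measure of total mass
  1.\<close>

definition "h k = (\<Prod>i=1..k. c i)"
text \<open>For x >= \<open>R\<close> one has x - b_n >= 1 + C, and then (x - b_n) p_n outweighs c_n
  p_{n-1} <= C p_n by at least p_n. So the values are positive and nondecreasing in n, and all roots
  lie in (-R, R).\<close>

definition "R = B + 1 + C"
abbreviation "p n \<equiv> poly (monic_op b c n)"

lemma C_pos: "C > 0" using c_pos[of 1] c_bound[of 1] by simp

lemma B_nonneg: "B \<ge> 0" using b_bound[of 0] by simp

lemma R_pos: "R > 0" using C_pos B_nonneg by (simp add: R_def)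

lemma h_pos: "h k > 0" unfolding h_def by (intro prod_pos) (auto intro: c_pos)

lemma p_pos_right:
  assumes "x \<ge> R"
  shows "0 < p n x \<and> p n x \<le> p (Suc n) x"
proof (induction n)
  case 0
  show ?case using assms b_bound[of 0] C_pos by (auto simp: R_def)
next
  case (Suc n)
  have "c (Suc n) * p n x \<le> C * p (Suc n) x"
    using Suc c_pos[of "Suc n"] c_bound[of "Suc n"] C_pos by (intro mult_mono) auto
  moreover have "(1 + C) * p (Suc n) x \<le> (x - b (Suc n)) * p (Suc n) x"
    using Suc assms b_bound[of "Suc n"] by (intro mult_right_mono) (auto simp: R_def)
  ultimately have "p (Suc n) x \<le> p (Suc (Suc n)) x"
    unfolding poly_monic_op_Suc_Suc by (simp add: algebra_simps)
  with Suc show ?case by linarith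
qed

end

text \<open>Reflection at 0 negates \<open>b\<close> and keeps \<open>c\<close>, hence also the
  bounds and \<open>R\<close>.\<close>

lemma (in bounded_recurrence) p_pos_left:
  assumes "x \<le> - R"
  shows "0 < (-1) ^ n * p n x"
proof -
  interpret neg: bounded_recurrence "\<lambda>n. - b n" c B C
    using b_bound c_pos c_bound by unfold_locales auto
  have "neg.R = R" by (simp add: R_def neg.R_def)
  then show ?thesis
    using neg.p_pos_right[of "-x" n] assms by (simp add: monic_op_reflect)
qed

context bounded_recurrence
begin

lemma root_bound: "p n x = 0 \<Longrightarrow> \<bar>x\<bar> < R"
  using p_pos_right[of x n] p_pos_left[of x n] by (cases "x \<ge> R"; cases "x \<le> - R") auto

text \<open>The roots are listed in decreasing order.\<close>

lemma interlacing_roots: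
  "\<exists>x. (\<forall>i<Suc n. p (Suc n) (x i) = 0 \<and> 0 < (-1) ^ i * p n (x i)) \<and> (\<forall>i j. i < j \<longrightarrow> j < Suc n \<longrightarrow> x j < (x i :: real))"
proof (induction n)
  case 0
  show ?case by (rule exI[of _ "\<lambda>_. b 0"]) auto
next
  case (Suc n)
  then obtain x where x: "\<And>i. i < Suc n \<Longrightarrow> p (Suc n) (x i) = 0"
     "\<And>i. i < Suc n \<Longrightarrow> 0 < (-1) ^ i * p n (x i)"
     "\<And>i j. i < j \<Longrightarrow> j < Suc n \<Longrightarrow> x j < x i" by blast
  \<comment> \<open>The points R, the old roots in decreasing order, and -R. At an old root the
    recurrence leaves only - c p_n, whose sign is known by induction, so the new polynomial changes
    sign between neighbouring points.\<close>
  define w where "w i = (if i = 0 then R else if i = Suc (Suc n) then - R else x (i - 1))" for i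
  have w_sign: "0 < (-1) ^ i * p (Suc (Suc n)) (w i)" if "i \<le> Suc (Suc n)" for i
  proof -
    consider "i = 0" | "i = Suc (Suc n)" | k where "i = Suc k" "k < Suc n"
      using \<open>i \<le> Suc (Suc n)\<close> by (cases i) fastforce+
    then show ?thesis
    proof cases
      case 1
      then show ?thesis using p_pos_right[of R "Suc (Suc n)"] by (simp add: w_def)
    next
      case 2
      then show ?thesis using p_pos_left[of "- R" "Suc (Suc n)"] by (simp add: w_def del: monic_op.simps)
    next
      case 3
      then have "w i = x k" by (simp add: w_def)
      then have "(-1) ^ i * p (Suc (Suc n)) (w i) = c (Suc n) * ((-1) ^ k * p n (x k))"
        unfolding poly_monic_op_Suc_Suc using x(1)[of k] 3 by simp
      then show ?thesis using x(2)[of k] 3 c_pos[of "Suc n"] by (simp del: monic_op.simps)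
    qed
  qed
  have w_dec: "w (Suc i) < w i" if "i \<le> Suc n" for i
  proof -
    have xR: "\<bar>x k\<bar> < R" if "k < Suc n" for k using root_bound x(1) that by blast
    consider "i = 0" | "i = Suc n" | k where "i = Suc k" "k < n"
      using \<open>i \<le> Suc n\<close> by (cases i) fastforce+
    then show ?thesis
    proof cases
      case 1
      then show ?thesis using xR[of 0] by (auto simp: w_def)
    next
      case 2
      then show ?thesis using xR[of n] by (auto simp: w_def)
    next
      case 3
      then show ?thesis using x(3)[of k "Suc k"] by (auto simp: w_def)
    qed
  qed
  have "\<exists>y. w (Suc i) < y \<and> y < w i \<and> p (Suc (Suc n)) y = 0" if "i \<le> Suc n" for i
  proof -
    have s: "0 < (-1) ^ i * p (Suc (Suc n)) (w i)" "0 < (-1) ^ Suc i * p (Suc (Suc n)) (w (Suc i))"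
      using w_sign[of i] w_sign[of "Suc i"] that by auto
    then show ?thesis
    proof (cases "even i")
      case True
      then show ?thesis using poly_IVT_pos[OF w_dec[OF that], of "monic_op b c (Suc (Suc n))"] s by auto
    next
      case False
      then show ?thesis using poly_IVT_neg[OF w_dec[OF that], of "monic_op b c (Suc (Suc n))"] s by auto
    qed
  qed
  then obtain y where y: "\<And>i. i \<le> Suc n \<Longrightarrow> w (Suc i) < y i \<and> y i < w i \<and> p (Suc (Suc n)) (y i) = 0"
    by metis
  have w_mono: "i \<le> j \<Longrightarrow> j \<le> Suc (Suc n) \<Longrightarrow> w j \<le> w i" for i j
  proof (induction j rule: dec_induct)
    case (step j)
    then show ?case using w_dec[of j] by simp
  qed simp
  have y_dec: "y j < y i" if "i < j" "j < Suc (Suc n)" for i j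
    using y[of i] y[of j] w_mono[of "Suc i" j] that by fastforce
  \<comment> \<open>The sign condition of the next stage: \<open>y i\<close> has exactly
    \<open>i\<close> old roots above it, so the product of linear factors contributes
    (-1)^i.\<close>
  have fact: "monic_op b c (Suc n) = (\<Prod>k<Suc n. [:- x k, 1:])"
  proof (rule poly_eqI_degree_lead_coeff[where n = "Suc n" and A = "x ` {..<Suc n}"])
    have inj: "inj_on x {..<Suc n}"
      by (rule linorder_inj_onI) (use x(3) in \<open>fastforce+\<close>)
    show "Suc n \<le> card (x ` {..<Suc n})" using card_image[OF inj] by simp
    have deg: "degree (\<Prod>k<Suc n. [:- x k, 1:]) = Suc n"
      by (subst degree_prod_eq_sum_degree) auto
    then show "degree (\<Prod>k<Suc n. [:- x k, 1:]) \<le> Suc n" by simp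
    show "degree (monic_op b c (Suc n)) \<le> Suc n" using monic_op_degree[of b c "Suc n"] by simp
    have "lead_coeff (\<Prod>k<Suc n. [:- x k, 1:]) = 1" by (subst lead_coeff_prod) auto
    then show "coeff (monic_op b c (Suc n)) (Suc n) = coeff (\<Prod>k<Suc n. [:- x k, 1:]) (Suc n)"
      using monic_op_degree[of b c "Suc n"] deg by metis
    fix z assume "z \<in> x ` {..<Suc n}"
    then obtain k where k: "z = x k" "k < Suc n" by auto
    have "poly (\<Prod>k<Suc n. [:- x k, 1:]) z = 0"
      unfolding poly_prod using k by (intro prod_zero) auto
    then show "p (Suc n) z = poly (\<Prod>k<Suc n. [:- x k, 1:]) z" using x(1) k by simp
  qed
  have "0 < (-1) ^ i * p (Suc n) (y i)" if "i < Suc (Suc n)" for i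
  proof -
    have above: "y i < x k" if "k < i" for k
      using y[of i] w_mono[of "Suc k" i] that \<open>i < Suc (Suc n)\<close> by (auto simp: w_def split: if_splits)
    have below: "x k < y i" if "i \<le> k" "k < Suc n" for k
      using y[of i] w_mono[of "Suc i" "Suc k"] that by (auto simp: w_def split: if_splits)
    have sq: "(-1) ^ i * (-1) ^ i = (1::real)" by (simp add: power_mult_distrib[symmetric])
    have "p (Suc n) (y i) = (\<Prod>k<Suc n. y i - x k)"
      unfolding fact poly_prod by (intro prod.cong) auto
    also have "\<dots> = (\<Prod>k\<in>{..<i} \<union> {i..<Suc n}. y i - x k)"
      using that by (intro prod.cong) auto
    also have "\<dots> = (\<Prod>k\<in>{..<i}. y i - x k) * (\<Prod>k\<in>{i..<Suc n}. y i - x k)"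
      by (rule prod.union_disjoint) auto
    also have "(\<Prod>k\<in>{..<i}. y i - x k) = (\<Prod>k\<in>{..<i}. (-1) * (x k - y i))" by simp
    also have "\<dots> = (-1) ^ i * (\<Prod>k\<in>{..<i}. x k - y i)" by (simp only: prod.distrib prod_constant card_lessThan)
    finally have "(-1) ^ i * p (Suc n) (y i) = (\<Prod>k\<in>{..<i}. x k - y i) * (\<Prod>k\<in>{i..<Suc n}. y i - x k)"
      using sq by (simp only: mult.assoc[symmetric] mult_1_left)
    also have "\<dots> > 0" using above below by (intro mult_pos_pos prod_pos) auto
    finally show ?thesis .
  qed
  then show ?case using y y_dec by (intro exI[of _ y]) auto
qed

text \<open>Follows from the recurrence alone, without any measure. At two distinct roots of p_{n+1}
  the right side vanishes, which makes the kernel on the left vanish too.\<close>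

lemma christoffel_darboux:
  "(\<Sum>k<Suc n. p k x * p k y / h k) * (x - y) = (p (Suc n) x * p n y - p n x * p (Suc n) y) / h n"
proof (induction n)
  case 0
  show ?case by (simp add: h_def)
next
  case (Suc n)
  have h: "h (Suc n) = c (Suc n) * h n" by (simp add: h_def)
  have nz: "h n \<noteq> 0" "c (Suc n) \<noteq> 0" using h_pos[of n] c_pos[of "Suc n"] by auto
  have "(\<Sum>k<Suc (Suc n). p k x * p k y / h k) * (x - y) =
    (p (Suc n) x * p n y - p n x * p (Suc n) y) / h n + p (Suc n) x * p (Suc n) y / h (Suc n) * (x - y)"
    using Suc by (simp add: algebra_simps)
  also have "\<dots> = (p (Suc (Suc n)) x * p (Suc n) y - p (Suc n) x * p (Suc (Suc n)) y) / h (Suc n)"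
    unfolding poly_monic_op_Suc_Suc h using nz by (simp add: field_simps)
  finally show ?case .
qed

text \<open>The values of p_0, ..., p_n at the n + 1 roots of p_{n+1}, divided by sqrt(h k) and by
  the root of the kernel sum \<open>K i\<close>, form a matrix whose columns are orthonormal by
  Christoffel-Darboux. Its rows are then orthonormal too, which is the claim with the Christoffel
  numbers 1 / \<open>K i\<close> as weights.\<close>

lemma gauss_quadrature:
  "\<exists>w x. (\<forall>i<Suc n. \<bar>x i\<bar> < R \<and> 0 \<le> w i) \<and>
     (\<forall>k<Suc n. \<forall>l<Suc n. (\<Sum>i<Suc n. w i * (p k (x i) * p l (x i))) = (if k = l then h k else 0))"
proof -
  obtain x where x: "\<And>i. i < Suc n \<Longrightarrow> p (Suc n) (x i) = 0"
     "\<And>i j. i < j \<Longrightarrow> j < Suc n \<Longrightarrow> x j < x i" using interlacing_roots[of n] by blast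
  have inj: "x i = x j \<longleftrightarrow> i = j" if "i < Suc n" "j < Suc n" for i j
    using x(2)[of i j] x(2)[of j i] that by (cases i j rule: linorder_cases) auto
  define K where "K i = (\<Sum>k<Suc n. (p k (x i))\<^sup>2 / h k)" for i
  have K: "K i > 0" for i
  proof -
    have "(p 0 (x i))\<^sup>2 / h 0 \<le> K i"
      unfolding K_def using h_pos by (intro member_le_sum) (auto intro!: divide_nonneg_nonneg less_imp_le[OF h_pos])
    then show ?thesis by (simp add: h_def)
  qed
  define V where "V k i = p k (x i) / sqrt (h k) / sqrt (K i)" for k i
  have "(\<Sum>k<Suc n. V k i * V k j) = (if i = j then 1 else 0)" if "i < Suc n" "j < Suc n" for i j
  proof -
    have "V k i * V k j = (p k (x i) * p k (x j) / h k) / (sqrt (K i) * sqrt (K j))" for k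
      using h_pos[of k] by (simp add: V_def field_simps)
    then have *: "(\<Sum>k<Suc n. V k i * V k j) = (\<Sum>k<Suc n. p k (x i) * p k (x j) / h k) / (sqrt (K i) * sqrt (K j))"
      by (simp only: sum_divide_distrib)
    show ?thesis
    proof (cases "i = j")
      case True
      have "(\<Sum>k<Suc n. p k (x i) * p k (x j) / h k) = K i"
        unfolding True K_def by (simp only: power2_eq_square)
      then show ?thesis using True * K[of i] by (simp del: sum.lessThan_Suc)
    next
      case False
      then have "(\<Sum>k<Suc n. p k (x i) * p k (x j) / h k) = 0"
        using christoffel_darboux[where n = n and x = "x i" and y = "x j"] x(1) that inj[OF that] by (simp del: sum.lessThan_Suc)
      then show ?thesis using False * by (simp del: sum.lessThan_Suc)
    qed
  qed
  then have V: "(\<Sum>i<Suc n. V k i * V l i) = (if k = l then 1 else 0)" if "k < Suc n" "l < Suc n" for k l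
    using orthonormal_columns_imp_rows that by blast
  have "(\<Sum>i<Suc n. 1 / K i * (p k (x i) * p l (x i))) = (if k = l then h k else 0)" if "k < Suc n" "l < Suc n" for k l
  proof -
    have "1 / K i * (p k (x i) * p l (x i)) = sqrt (h k) * sqrt (h l) * (V k i * V l i)" for i
      using h_pos[of k] h_pos[of l] K[of i] by (simp add: V_def field_simps)
    then have "(\<Sum>i<Suc n. 1 / K i * (p k (x i) * p l (x i))) = sqrt (h k) * sqrt (h l) * (\<Sum>i<Suc n. V k i * V l i)"
      by (simp only: sum_distrib_left)
    then show ?thesis unfolding V[OF that] using h_pos[of k] by auto
  qed
  then have sums: "\<forall>k<Suc n. \<forall>l<Suc n. (\<Sum>i<Suc n. 1 / K i * (p k (x i) * p l (x i))) = (if k = l then h k else 0)"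
    by blast
  have "\<forall>i<Suc n. \<bar>x i\<bar> < R \<and> 0 \<le> 1 / K i"
  proof (intro allI impI conjI)
    fix i assume "i < Suc n"
    then show "\<bar>x i\<bar> < R" using x(1) by (intro root_bound[of "Suc n"])
    show "0 \<le> 1 / K i" using K[of i] by simp
  qed
  from conjI[OF this sums] show ?thesis
    by (rule exI[where x = x, THEN exI[where x = "\<lambda>i. 1 / K i"]])
qed

lemma favard:
  "\<exists>M. real_distribution M \<and> (AE x in M. \<bar>x\<bar> \<le> R) \<and>
     (\<forall>k l. (LINT x|M. p k x * p l x) = (if k = l then h k else 0))"
proof -
  define good where "good n w x \<longleftrightarrow> (\<forall>i<Suc n. \<bar>x i\<bar> < R \<and> 0 \<le> w i) \<and>
     (\<forall>k<Suc n. \<forall>l<Suc n. (\<Sum>i<Suc n. w i * (p k (x i) * p l (x i))) = (if k = l then h k else 0))"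
    for n :: nat and w x :: "nat \<Rightarrow> real"
  have "\<forall>n. \<exists>w x. good n w x" unfolding good_def using gauss_quadrature by blast
  then obtain w x where good: "\<And>n. good n (w n) (x n)" by metis
  have x: "\<bar>x n i\<bar> < R" and w: "0 \<le> w n i" if "i < Suc n" for n i
    using good[of n] that unfolding good_def by blast+
  have orth: "(\<Sum>i<Suc n. w n i * (p k (x n i) * p l (x n i))) = (if k = l then h k else 0)"
    if "k < Suc n" "l < Suc n" for n k l
    using good[of n] that unfolding good_def by blast
  have w_sum: "(\<Sum>i<Suc n. w n i) = 1" for n
    using orth[of 0 n 0] by (simp add: h_def del: sum.lessThan_Suc)
  define \<mu> where "\<mu> n = distr (point_measure {..<Suc n} (w n)) borel (x n)" for n
  have prob: "prob_space (point_measure {..<Suc n} (w n))" for n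
  proof (rule prob_spaceI)
    have "(\<Sum>i<Suc n. ennreal (w n i)) = ennreal (\<Sum>i<Suc n. w n i)"
      using w by (intro sum_ennreal) auto
    then show "emeasure (point_measure {..<Suc n} (w n)) (space (point_measure {..<Suc n} (w n))) = 1"
      unfolding w_sum by (simp add: space_point_measure emeasure_point_measure_finite del: sum.lessThan_Suc)
  qed
  have distr: "real_distribution (\<mu> n)" for n
    unfolding \<mu>_def by (rule prob_space.real_distribution_distr[OF prob]) (simp add: measurable_point_measure_eq1)
  have int: "integral\<^sup>L (\<mu> n) f = (\<Sum>i<Suc n. w n i * f (x n i))"
    if [measurable]: "f \<in> borel_measurable borel" for n and f :: "real \<Rightarrow> real"
  proof -
    have "integral\<^sup>L (\<mu> n) f = (LINT i|point_measure {..<Suc n} (w n). f (x n i))"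
      unfolding \<mu>_def by (rule integral_distr) (auto simp: measurable_point_measure_eq1)
    also have "\<dots> = (\<Sum>i<Suc n. w n i *\<^sub>R f (x n i))"
      using w by (intro lebesgue_integral_point_measure_finite) auto
    finally show ?thesis by simp
  qed
  have "tight \<mu>"
    unfolding tight_def
  proof (intro conjI allI impI distr)
    fix \<epsilon> :: real assume "\<epsilon> > 0"
    have "measure (\<mu> n) {- R<..R} = 1" for n
    proof -
      have "measure (\<mu> n) {- R<..R} = (LINT x|\<mu> n. indicator {- R<..R} x)"
        using real_distribution.events_eq_borel[OF distr] real_distribution.space_eq_univ[OF distr] by simp
      also have "\<dots> = (\<Sum>i<Suc n. w n i)"
      proof (subst int)
        have "x n i \<in> {- R<..R}" if "i < Suc n" for i
          using x[OF that] by auto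
        then show "(\<Sum>i<Suc n. w n i * indicator {- R<..R} (x n i)) = (\<Sum>i<Suc n. w n i)"
          by (intro sum.cong) auto
      qed simp
      finally show ?thesis using w_sum by simp
    qed
    then show "\<exists>a b. a < b \<and> (\<forall>n. measure (\<mu> n) {a<..b} > 1 - \<epsilon>)"
      using \<open>\<epsilon> > 0\<close> R_pos by (intro exI[of _ "- R"] exI[of _ R]) auto
  qed
  from tight_imp_convergent_subsubsequence[OF this strict_mono_id] obtain r M where
    r: "strict_mono r" and M: "real_distribution M" and lim: "weak_conv_m (\<mu> \<circ> id \<circ> r) M"
    by blast
  interpret M: real_distribution M by fact
  have conv: "(\<lambda>n. integral\<^sup>L (\<mu> (r n)) f) \<longlonglongrightarrow> integral\<^sup>L M f"
    if "\<And>x. isCont f x" "\<And>x. \<bar>f x\<bar> \<le> K" for f :: "real \<Rightarrow> real" and K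
    using weak_conv_imp_integral_bdd_continuous_conv[OF _ M lim, of f K] distr that by (simp add: o_def)
  have supp: "AE y in M. \<bar>y\<bar> \<le> R"
  proof -
    \<comment> \<open>The truncated distance from [-R, R]: bounded, continuous, and zero at every
      node, so its integral vanishes in the limit.\<close>
    define f where "f y = min 1 (max 0 (\<bar>y\<bar> - R))" for y :: real
    have f: "isCont f y" "\<bar>f y\<bar> \<le> 1" for y unfolding f_def by (auto intro!: continuous_intros)
    then have f_meas: "f \<in> borel_measurable borel"
      by (intro borel_measurable_continuous_onI continuous_at_imp_continuous_on) auto
    have "integral\<^sup>L (\<mu> n) f = 0" for n
      using x by (subst int[OF f_meas], intro sum.neutral) (auto simp: f_def less_imp_le)
    then have "integral\<^sup>L M f = 0" using conv[OF f] LIMSEQ_unique[OF _ tendsto_const[of 0]] by simp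
    moreover have "integrable M f"
      using f f_meas by (intro M.integrable_const_bound[of _ 1]) auto
    ultimately have "AE y in M. f y = 0"
      by (subst (asm) integral_nonneg_eq_0_iff_AE) (auto simp: f_def)
    then show ?thesis by (rule AE_mp) (auto simp: f_def min_def max_def split: if_splits)
  qed
  have "(LINT y|M. p k y * p l y) = (if k = l then h k else 0)" for k l
  proof -
    \<comment> \<open>Weak convergence controls only bounded continuous functions. Clamping the
      argument to [-R, R] makes the product bounded and changes neither the quadratures nor, up to a
      null set, the limit.\<close>
    define cl where "cl y = min R (max (- R) y)" for y :: real
    define f where "f y = p k (cl y) * p l (cl y)" for y
    have cl: "\<bar>cl y\<bar> \<le> R" "isCont cl y" "\<bar>y\<bar> \<le> R \<Longrightarrow> cl y = y" for y
      using R_pos unfolding cl_def by (auto intro!: continuous_intros)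
    have cont: "isCont f y" for y
      unfolding f_def by (intro isCont_mult isCont_o2[OF cl(2)] poly_isCont)
    then have f_meas: "f \<in> borel_measurable borel"
      by (intro borel_measurable_continuous_onI continuous_at_imp_continuous_on) auto
    have "compact ((\<lambda>y. p k y * p l y) ` {- R..R})"
      by (intro compact_continuous_image continuous_intros) auto
    then obtain K where K: "\<And>y. y \<in> {- R..R} \<Longrightarrow> \<bar>p k y * p l y\<bar> \<le> K"
      using compact_imp_bounded by (force simp: bounded_iff)
    have "\<bar>f y\<bar> \<le> K" for y
      unfolding f_def using K[of "cl y"] cl(1)[of y] by (simp add: abs_le_iff)
    then have "(\<lambda>n. integral\<^sup>L (\<mu> (r n)) f) \<longlonglongrightarrow> integral\<^sup>L M f"
      using conv cont by blast
    \<comment> \<open>The quadratures are exact as soon as their order reaches both \<open>k\<close>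
      and \<open>l\<close>, so the sequence is eventually constant.\<close>
    moreover have "\<forall>\<^sub>F n in sequentially. integral\<^sup>L (\<mu> (r n)) f = (if k = l then h k else 0)"
    proof (rule eventually_sequentiallyI)
      fix n assume "max k l \<le> n"
      then have "k < Suc (r n)" "l < Suc (r n)" using seq_suble[OF r, of n] by auto
      then have "(\<Sum>i<Suc (r n). w (r n) i * (p k (x (r n) i) * p l (x (r n) i))) = (if k = l then h k else 0)"
        by (rule orth)
      moreover have "integral\<^sup>L (\<mu> (r n)) f = (\<Sum>i<Suc (r n). w (r n) i * (p k (x (r n) i) * p l (x (r n) i)))"
        unfolding int[OF f_meas] using x cl(3) by (intro sum.cong) (auto simp: f_def less_imp_le)
      ultimately show "integral\<^sup>L (\<mu> (r n)) f = (if k = l then h k else 0)" by metis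
    qed
    ultimately have "integral\<^sup>L M f = (if k = l then h k else 0)"
      by (rule LIMSEQ_unique[OF _ tendsto_eventually])
    moreover have "integral\<^sup>L M f = (LINT y|M. p k y * p l y)"
    proof (rule integral_cong_AE)
      show "AE y in M. f y = p k y * p l y"
        using supp by eventually_elim (simp add: f_def cl(3))
    qed (use f_meas in \<open>auto intro!: M.measurable_finite_borel borel_measurable_continuous_onI continuous_intros\<close>)
    ultimately show ?thesis by simp
  qed
  with M supp show ?thesis by blast
qed

end

section \<open>From a real distribution to an orthogonality measure in the sense of
  \<open>orthogonal_wrt\<close>\<close>

lemma monic_op_nonzero: "monic_op b c n \<noteq> (0 :: 'a::idom poly)"
  using monic_op_degree[of b c n] by auto

lemma monic_op_of_real:
  assumes "\<And>n. b' n = of_real (b n)" "\<And>n. n \<ge> 1 \<Longrightarrow> c' n = of_real (c n)"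
  shows "poly (monic_op b' c' n) (of_real x :: complex) = of_real (poly (monic_op b c n) x)"
proof -
  have "poly (monic_op b' c' n) (of_real x :: complex) = of_real (poly (monic_op b c n) x) \<and>
    poly (monic_op b' c' (Suc n)) (of_real x :: complex) = of_real (poly (monic_op b c (Suc n)) x)"
    by (induction n) (use assms in \<open>simp_all add: poly_monic_op_Suc_Suc del: monic_op.simps(3)\<close>)
  then show ?thesis ..
qed

lemma integrable_poly:
  fixes M :: "real measure"
  assumes "\<And>k::nat. integrable M (\<lambda>x. x ^ k)"
  shows "integrable M (poly p)"
proof -
  have "poly p = (\<lambda>x. \<Sum>i\<le>degree p. coeff p i * x ^ i)"
    by (rule ext) (rule poly_altdef)
  then show ?thesis using assms by simp
qed

lemma orthogonal_to_lower_degree: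
  fixes M :: "real measure" and p :: "nat \<Rightarrow> real poly"
  assumes moments: "\<And>k::nat. integrable M (\<lambda>x. x ^ k)"
    and deg: "\<And>n. degree (p n) = n \<and> p n \<noteq> 0"
    and orth: "\<And>n k. n \<noteq> k \<Longrightarrow> (LINT x|M. poly (p n) x * poly (p k) x) = 0"
    and "degree q < n"
  shows "(LINT x|M. poly (p n) x * poly q x) = 0"
proof -
  define D where "D r = (LINT x|M. poly (p n * r) x)" for r
  have "D q = 0"
  proof (rule poly_functional_eq_0)
    show "D (r + s) = D r + D s" for r s
      unfolding D_def distrib_left poly_add by (intro Bochner_Integration.integral_add integrable_poly moments)
    show "D (smult a r) = a * D r" for a r
      unfolding D_def mult_smult_right poly_smult by (rule integral_mult_right_zero)
    show "\<exists>e. degree e = d \<and> e \<noteq> 0 \<and> D e = 0" if "d < n" for d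
      using that deg[of d] orth[of n d] by (intro exI[of _ "p d"]) (simp add: D_def)
  qed fact
  then show ?thesis by (simp add: D_def)
qed

text \<open>The complement of the support is a union of open null sets, and by Lindelof countably
  many of them suffice.\<close>

lemma null_outside_msupport:
  assumes [measurable_cong]: "sets M = sets borel"
  shows "- msupport M \<in> null_sets M"
proof -
  define F where "F = {V. open V \<and> emeasure M V = 0}"
  obtain F' where F': "F' \<subseteq> F" "countable F'" "\<Union>F' = \<Union>F"
    using Lindelof[of F] by (auto simp: F_def)
  have "\<Union>F = - msupport M"
    by (auto simp: F_def msupport_def zero_less_iff_neq_zero)
  moreover have "(\<Union>V\<in>F'. V) \<in> null_sets M"
    using F' assms by (intro null_sets_UN') (auto simp: F_def null_sets_def)
  ultimately show ?thesis using F' by simp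
qed

lemma (in bounded_recurrence) exists_orthogonality_measure:
  assumes "\<And>n. b' n = of_real (b n)" "\<And>n. n \<ge> 1 \<Longrightarrow> c' n = of_real (c n)"
  shows "\<exists>\<mu>. orthogonal_wrt \<mu> (monic_op b' c')"
proof -
  obtain M where M: "real_distribution M" and supp: "AE x in M. \<bar>x\<bar> \<le> R"
    and orth: "\<And>k l. (LINT x|M. p k x * p l x) = (if k = l then h k else 0)"
    using favard by blast
  interpret M: real_distribution M by fact
  have moments: "integrable M (\<lambda>x. x ^ k)" for k :: nat
  proof (rule M.integrable_const_bound)
    show "AE x in M. norm (x ^ k) \<le> R ^ k"
      using supp by eventually_elim (auto simp: power_abs intro: power_mono)
  qed simp
  \<comment> \<open>With a support of only d points, the monic polynomial \<open>q\<close> of degree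
    d vanishing on them would be null almost everywhere. But \<open>q\<close> differs from p_d by a
    polynomial of lower degree, so its integral against p_d is h_d > 0.\<close>
  have "infinite (msupport M)"
  proof
    assume fin: "finite (msupport M)"
    define d where "d = card (msupport M)"
    define q where "q = (\<Prod>s\<in>msupport M. [:- s, 1:])"
    have q: "degree q = d" "lead_coeff q = 1"
      unfolding q_def d_def by (subst degree_prod_eq_sum_degree; simp) (subst lead_coeff_prod; simp)
    have "AE x in M. x \<in> msupport M"
      using null_outside_msupport[of M] by (rule AE_I') auto
    then have "AE x in M. poly q x = 0"
      by eventually_elim (use fin in \<open>auto simp: q_def poly_prod intro!: prod_zero\<close>)
    then have "AE x in M. p d x * poly q x = 0" by eventually_elim simp
    then have 0: "(LINT x|M. p d x * poly q x) = 0"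
      by (rule integral_eq_zero_AE)
    have "(LINT x|M. p d x * poly q x) = (LINT x|M. p d x * p d x)"
    proof (cases "d = 0")
      case True
      then have "q = monic_op b c d"
        using q by (simp add: monic_op.simps(1)) (metis degree_eq_zeroE lead_coeff_pCons(2) one_pCons coeff_pCons_0 pCons_0_0)
      then show ?thesis by simp
    next
      case False
      define r where "r = q - monic_op b c d"
      have "coeff r d = 0" "degree r \<le> d"
        unfolding r_def using q monic_op_degree[of b c d] by (auto intro!: degree_diff_le)
      then have rd: "degree r < d"
        using False by (metis degree_0 eq_zero_or_degree_less neq0_conv)
      have "(LINT x|M. p d x * poly r x) = 0"
      proof (rule orthogonal_to_lower_degree[where p = "monic_op b c", OF moments _ _ rd])
        show "degree (monic_op b c n) = n \<and> monic_op b c n \<noteq> 0" for n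
          using monic_op_degree[of b c n] monic_op_nonzero[of b c n] by simp
        show "n \<noteq> k \<Longrightarrow> (LINT x|M. p n x * p k x) = 0" for n k
          using orth[of n k] by simp
      qed
      moreover have "(LINT x|M. p d x * poly q x) = (LINT x|M. p d x * poly r x) + (LINT x|M. p d x * p d x)"
      proof -
        have "(LINT x|M. p d x * poly q x) = (LINT x|M. poly (monic_op b c d * r) x + poly (monic_op b c d * monic_op b c d) x)"
          by (intro Bochner_Integration.integral_cong refl) (simp only: r_def poly_mult poly_diff right_diff_distrib diff_add_cancel)
        also have "\<dots> = (LINT x|M. poly (monic_op b c d * r) x) + (LINT x|M. poly (monic_op b c d * monic_op b c d) x)"
          by (intro Bochner_Integration.integral_add integrable_poly moments)
        finally show ?thesis by simp
      qed
      ultimately show ?thesis by simp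
    qed
    then show False using 0 orth[of d d] h_pos[of d] by simp
  qed
  moreover have "(LINT x|M. poly (monic_op b' c' n) (of_real x) * poly (monic_op b' c' k) (of_real x)) = 0"
    if "n \<noteq> k" for n k
  proof -
    have "poly (monic_op b' c' n) (of_real x) * poly (monic_op b' c' k) (of_real x) = of_real (p n x * p k x)" for x
      using assms by (simp add: monic_op_of_real[where b = b and c = c])
    then show ?thesis using orth[of n k] that by (simp del: of_real_mult)
  qed
  ultimately have "orthogonal_wrt M (monic_op b' c')"
    using moments monic_op_degree[of b' c'] by (simp add: orthogonal_wrt_def)
  then show ?thesis by blast
qed

section \<open>Determinacy of compactly supported measures\<close>

text \<open>Markov's inequality for x^(2k) bounds the mass beyond S > R by (R / S)^(2k) for every k.
  Orthogonality measures come with finite moments but no given support, so the bound has to be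
  inherited from the measure they are compared with.\<close>

lemma compact_support_of_moments:
  assumes "real_distribution M" "real_distribution N"
    and moments: "\<And>k::nat. integrable M (\<lambda>x. x ^ k)" "\<And>k::nat. (LINT x|M. x ^ k) = (LINT x|N. x ^ k)"
    and supp: "AE x in N. \<bar>x\<bar> \<le> R" and "R > 0"
  shows "AE x in M. \<bar>x\<bar> \<le> R"
proof -
  interpret M: real_distribution M by fact
  interpret N: real_distribution N by fact
  have N_int: "integrable N (\<lambda>x. x ^ k)" for k
  proof (rule N.integrable_const_bound)
    show "AE x in N. norm (x ^ k) \<le> R ^ k"
      using supp by eventually_elim (auto simp: power_abs intro: power_mono)
  qed simp
  have bound: "(LINT x|M. x ^ (2*k)) \<le> R ^ (2*k)" for k
  proof -
    have "(LINT x|N. x ^ (2*k)) \<le> (LINT x|N. R ^ (2*k))"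
    proof (rule integral_mono_AE[OF N_int])
      show "AE x in N. x ^ (2*k) \<le> R ^ (2*k)"
        using supp by eventually_elim (metis power_even_abs power_mono abs_ge_zero even_mult_iff even_numeral)
    qed simp
    then show ?thesis using moments(2) N.prob_space by simp
  qed
  have null: "measure M {x. S \<le> \<bar>x\<bar>} = 0" if "S > R" for S
  proof -
    have "measure M {x. S \<le> \<bar>x\<bar>} \<le> ((R / S)\<^sup>2) ^ k" for k
    proof -
      have "measure M {x. S \<le> \<bar>x\<bar>} * S ^ (2*k) = (LINT x|M. S ^ (2*k) * indicator {x. S \<le> \<bar>x\<bar>} x)"
        by simp
      also have "\<dots> \<le> (LINT x|M. x ^ (2*k))"
      proof (rule integral_mono)
        show "integrable M (\<lambda>x. S ^ (2*k) * indicator {x. S \<le> \<bar>x\<bar>} x :: real)"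
          by (intro integrable_mult_right integrable_real_indicator) (auto simp: M.emeasure_eq_measure)
        show "S ^ (2*k) * indicator {x. S \<le> \<bar>x\<bar>} x \<le> x ^ (2*k)" for x
          using that \<open>R > 0\<close> power_mono[of S "\<bar>x\<bar>" "2*k"] by (auto simp: indicator_def power_even_abs)
      qed (rule moments)
      also have "\<dots> \<le> R ^ (2*k)" by (rule bound)
      finally show ?thesis
        using that \<open>R > 0\<close> by (simp add: power_mult[symmetric] power_divide field_simps)
    qed
    moreover have "(\<lambda>k. ((R / S)\<^sup>2) ^ k) \<longlonglongrightarrow> 0"
      using that \<open>R > 0\<close> by (intro LIMSEQ_realpow_zero) (auto simp: power_less_one_iff abs_square_less_1)
    ultimately have "measure M {x. S \<le> \<bar>x\<bar>} \<le> 0"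
      by (intro LIMSEQ_le_const) auto
    then show ?thesis using measure_nonneg[of M] by (simp add: antisym)
  qed
  have "AE x in M. \<not> R + 1 / Suc n \<le> \<bar>x\<bar>" for n
    by (rule AE_I[where N = "{x. R + 1 / Suc n \<le> \<bar>x\<bar>}"]) (auto simp: M.emeasure_eq_measure null)
  then have "AE x in M. \<forall>n. \<not> R + 1 / Suc n \<le> \<bar>x\<bar>"
    by (simp add: AE_all_countable)
  then show ?thesis
  proof eventually_elim
    case (elim x)
    show ?case
    proof (rule ccontr)
      assume "\<not> \<bar>x\<bar> \<le> R"
      then obtain n where "1 / Suc n < \<bar>x\<bar> - R"
        using reals_Archimedean[of "\<bar>x\<bar> - R"] unfolding inverse_eq_divide by (metis diff_gt_0_iff_gt not_le)
      then show False using elim[rule_format, of n] by simp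
    qed
  qed
qed

text \<open>By Weierstrass approximation on [-R, R], equal moments give equal integrals of bounded
  continuous functions. Taking cos and sin yields equal characteristic functions, and Levy
  uniqueness applies.\<close>

lemma real_distribution_eqI_moments:
  assumes "real_distribution M" "real_distribution N"
    and moments: "\<And>k::nat. integrable M (\<lambda>x. x ^ k)" "\<And>k::nat. (LINT x|M. x ^ k) = (LINT x|N. x ^ k)"
    and supp_N: "AE x in N. \<bar>x\<bar> \<le> R" and "R > 0"
  shows "M = N"
proof (rule Levy_uniqueness[OF assms(1,2)])
  interpret M: real_distribution M by fact
  interpret N: real_distribution N by fact
  have supp_M: "AE x in M. \<bar>x\<bar> \<le> R"
    by (rule compact_support_of_moments[OF assms])
  have N_int: "integrable N (\<lambda>x. x ^ k)" for k :: nat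
  proof (rule N.integrable_const_bound)
    show "AE x in N. norm (x ^ k) \<le> R ^ k"
      using supp_N by eventually_elim (auto simp: power_abs intro: power_mono)
  qed simp
  have *: "(LINT x|M. f x) = (LINT x|N. f x)" if f: "continuous_on UNIV f" "\<And>x. \<bar>f x\<bar> \<le> 1" for f :: "real \<Rightarrow> real"
  proof -
    have f_meas: "f \<in> borel_measurable borel" using f by (intro borel_measurable_continuous_onI)
    have "\<bar>(LINT x|M. f x) - (LINT x|N. f x)\<bar> \<le> 2 * e" if "e > 0" for e
    proof -
      have "continuous_on {- R..R} f" using f(1) by (rule continuous_on_subset) simp
      then obtain g where g: "real_polynomial_function g" "\<And>x. x \<in> {- R..R} \<Longrightarrow> \<bar>f x - g x\<bar> < e"
        using \<open>e > 0\<close> Stone_Weierstrass_real_polynomial_function[OF compact_Icc, of "- R" R f e] by metis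
      then obtain a n where a: "g = (\<lambda>x. \<Sum>i\<le>n. a i * x ^ i)"
        by (subst (asm) real_polynomial_function_iff_sum) (elim exE)
      have eq: "(LINT x|M. g x) = (LINT x|N. g x)"
        unfolding a using moments N_int by simp
      have close: "\<bar>(LINT x|K. f x) - (LINT x|K. g x)\<bar> \<le> e"
        if "real_distribution K" "integrable K g" "AE x in K. \<bar>x\<bar> \<le> R" for K
      proof -
        interpret K: real_distribution K by fact
        have f_int: "integrable K f" using f f_meas by (intro K.integrable_const_bound[of _ 1]) auto
        have "\<bar>(LINT x|K. f x) - (LINT x|K. g x)\<bar> = \<bar>LINT x|K. f x - g x\<bar>"
          using f_int that(2) by simp
        also have "\<dots> \<le> (LINT x|K. \<bar>f x - g x\<bar>)"
          by (rule integral_abs_bound)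
        also have "\<dots> \<le> (LINT x|K. e)"
        proof (rule integral_mono_AE)
          show "AE x in K. \<bar>f x - g x\<bar> \<le> e"
            using that(3)
          proof eventually_elim
            case (elim x)
            then show ?case using g(2)[of x] by (auto simp: abs_le_iff)
          qed
        qed (use f_int that(2) in auto)
        finally show ?thesis using K.prob_space by simp
      qed
      have "integrable M g" "integrable N g" unfolding a using moments N_int by auto
      then show ?thesis
        using close[OF assms(1) _ supp_M] close[OF assms(2) _ supp_N] eq by linarith
    qed
    from this[of "\<bar>(LINT x|M. f x) - (LINT x|N. f x)\<bar> / 4"] show ?thesis by fastforce
  qed
  show "char M = char N"
  proof
    fix t
    have cs: "complex_of_real (cos (t * x)) + \<i> * complex_of_real (sin (t * x)) = iexp (t * x)" for x
      unfolding cis_conv_exp[symmetric] by (simp add: complex_eq_iff)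
    have "char K t = complex_of_real (LINT x|K. cos (t * x)) + \<i> * complex_of_real (LINT x|K. sin (t * x))"
      if "real_distribution K" for K
    proof -
      interpret K: real_distribution K by fact
      have "integrable K (\<lambda>x. cos (t * x))" "integrable K (\<lambda>x. sin (t * x))"
        by (auto intro!: K.integrable_const_bound[of _ 1])
      then show ?thesis
        unfolding char_def cs[symmetric] by (subst Bochner_Integration.integral_add) auto
    qed
    moreover have "(LINT x|M. cos (t * x)) = (LINT x|N. cos (t * x))" "(LINT x|M. sin (t * x)) = (LINT x|N. sin (t * x))"
      by (auto intro!: * continuous_intros)
    ultimately show "char M t = char N t" using assms(1,2) by metis
  qed
qed

section \<open>Folding the arc\<close>

text \<open>The angles are the zeros of cos(m \<theta>) in (0, pi). Multiplication by 2 sin \<beta>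
  telescopes the sum, and 1 <= k < 2m keeps \<beta> inside (0, pi), where the sine is
  nonzero.\<close>

lemma sum_cos_odd_multiples:
  fixes m k :: nat
  assumes "1 \<le> k" "k < 2*m"
  shows "(\<Sum>i<m. cos (real k * ((2 * real i + 1) * pi / (2 * real m)))) = 0"
proof -
  define \<beta> where "\<beta> = real k * pi / (2 * real m)"
  have "0 < \<beta>" "\<beta> < pi" using assms by (auto simp: \<beta>_def field_simps)
  then have nz: "sin \<beta> \<noteq> 0" using sin_gt_zero by fastforce
  have "2 * sin \<beta> * (\<Sum>i<m. cos (real k * ((2 * real i + 1) * pi / (2 * real m)))) =
     (\<Sum>i<m. sin (2 * real (Suc i) * \<beta>) - sin (2 * real i * \<beta>))"
    unfolding sum_distrib_left
  proof (rule sum.cong[OF refl])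
    fix i
    have e: "real k * ((2 * real i + 1) * pi / (2 * real m)) = (2 * real i + 1) * \<beta>" by (simp add: \<beta>_def)
    have "sin (2 * real (Suc i) * \<beta>) = sin ((2 * real i + 1) * \<beta> + \<beta>)"
      "sin (2 * real i * \<beta>) = sin ((2 * real i + 1) * \<beta> - \<beta>)"
      by (simp_all add: algebra_simps)
    then show "2 * sin \<beta> * cos (real k * ((2 * real i + 1) * pi / (2 * real m))) =
      sin (2 * real (Suc i) * \<beta>) - sin (2 * real i * \<beta>)"
      unfolding e by (simp only: sin_add sin_diff) (simp add: algebra_simps)
  qed
  also have "\<dots> = sin (2 * real m * \<beta>)" by (subst sum_lessThan_telescope) simp
  also have "2 * real m * \<beta> = real k * pi" using assms by (simp add: \<beta>_def)
  finally show ?thesis using nz by simp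
qed

text \<open>For 0 <= \<phi> <= pi / (2m) these are the 2m angles in [0, pi] at which the monic
  T_{2m}(cos \<theta>) takes one common value. Centring each pair at the midpoint of its interval
  leaves a multiple of the preceding sum and a telescoping sum of sines.\<close>

lemma sum_cos_fold:
  fixes m k :: nat
  assumes "1 \<le> k" "k < 2*m"
  shows "(\<Sum>i<m. cos (real k * (real i * (pi / real m) + \<phi>)) + cos (real k * (real (Suc i) * (pi / real m) - \<phi>))) = 0"
proof -
  define A where "A i = real k * (real i * (pi / real m))" for i
  have "cos (real k * (real i * (pi / real m) + \<phi>)) + cos (real k * (real (Suc i) * (pi / real m) - \<phi>))
    = 2 * cos (real k * (pi / (2 * real m))) * cos (real k * \<phi>) * cos (real k * ((2 * real i + 1) * pi / (2 * real m)))
      + sin (real k * \<phi>) * (sin (A (Suc i)) - sin (A i))" for i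
  proof -
    define a where "a = real k * ((2 * real i + 1) * pi / (2 * real m))"
    define b where "b = real k * (pi / (2 * real m))"
    have A: "A i = a - b" "A (Suc i) = a + b"
      using assms by (simp_all add: A_def a_def b_def field_simps)
    have e: "real k * (real i * (pi / real m) + \<phi>) = A i + real k * \<phi>"
      "real k * (real (Suc i) * (pi / real m) - \<phi>) = A (Suc i) - real k * \<phi>"
      by (simp_all add: A_def algebra_simps)
    show ?thesis
      unfolding a_def[symmetric] b_def[symmetric] e A cos_add cos_diff sin_add sin_diff
      by (simp add: ring_distribs mult_ac)
  qed
  then have "(\<Sum>i<m. cos (real k * (real i * (pi / real m) + \<phi>)) + cos (real k * (real (Suc i) * (pi / real m) - \<phi>)))
    = 2 * cos (real k * (pi / (2 * real m))) * cos (real k * \<phi>) * (\<Sum>i<m. cos (real k * ((2 * real i + 1) * pi / (2 * real m))))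
      + sin (real k * \<phi>) * (\<Sum>i<m. sin (A (Suc i)) - sin (A i))"
    by (simp only: sum.distrib sum_distrib_left)
  also have "(\<Sum>i<m. sin (A (Suc i)) - sin (A i)) = 0"
    using assms by (subst sum_lessThan_telescope) (simp add: A_def)
  finally show ?thesis using sum_cos_odd_multiples[OF assms] by simp
qed

lemma nn_integral_Icc_split:
  fixes F :: "real \<Rightarrow> ennreal"
  assumes [measurable]: "F \<in> borel_measurable borel" and "a \<le> b" "b \<le> c"
  shows "(\<integral>\<^sup>+x. F x * indicator {a..c} x \<partial>lborel) =
    (\<integral>\<^sup>+x. F x * indicator {a..b} x \<partial>lborel) + (\<integral>\<^sup>+x. F x * indicator {b..c} x \<partial>lborel)"
proof -
  have "(\<integral>\<^sup>+x. F x * indicator {a..c} x \<partial>lborel) = (\<integral>\<^sup>+x. F x * indicator {a..b} x + F x * indicator {b..c} x \<partial>lborel)"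
  proof (rule nn_integral_cong_AE)
    show "AE x in lborel. F x * indicator {a..c} x = F x * indicator {a..b} x + F x * indicator {b..c} x"
      using AE_lborel_singleton[of b] by eventually_elim (use assms in \<open>auto simp: indicator_def\<close>)
  qed
  then show ?thesis by (simp add: nn_integral_add)
qed

text \<open>The second half of every interval is reflected, so that all pieces become integrals over
  the same [0, \<delta> / 2].\<close>

lemma nn_integral_fold:
  fixes F :: "real \<Rightarrow> ennreal"
  assumes [measurable]: "F \<in> borel_measurable borel" and "\<delta> > 0"
  shows "(\<integral>\<^sup>+x. F x * indicator {0..real m * \<delta>} x \<partial>lborel) =
    (\<Sum>i<m. (\<integral>\<^sup>+x. F (real i * \<delta> + x) * indicator {0..\<delta> / 2} x \<partial>lborel)
        + (\<integral>\<^sup>+x. F (real (Suc i) * \<delta> - x) * indicator {0..\<delta> / 2} x \<partial>lborel))"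
proof (induction m)
  case 0
  have "(\<integral>\<^sup>+x. F x * indicator {0} x \<partial>lborel) = (\<integral>\<^sup>+x. 0 \<partial>(lborel :: real measure))"
    using AE_lborel_singleton[of "0::real"] by (intro nn_integral_cong_AE) (auto simp: indicator_def)
  then show ?case by simp
next
  case (Suc m)
  have "(\<integral>\<^sup>+x. F x * indicator {0..real (Suc m) * \<delta>} x \<partial>lborel) =
     (\<integral>\<^sup>+x. F x * indicator {0..real m * \<delta>} x \<partial>lborel) +
     (\<integral>\<^sup>+x. F x * indicator {real m * \<delta>..real (Suc m) * \<delta>} x \<partial>lborel)"
    using \<open>\<delta> > 0\<close> by (intro nn_integral_Icc_split) (auto simp: algebra_simps)
  also have "(\<integral>\<^sup>+x. F x * indicator {real m * \<delta>..real (Suc m) * \<delta>} x \<partial>lborel) =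
     (\<integral>\<^sup>+x. F x * indicator {real m * \<delta>..real m * \<delta> + \<delta> / 2} x \<partial>lborel) +
     (\<integral>\<^sup>+x. F x * indicator {real m * \<delta> + \<delta> / 2..real (Suc m) * \<delta>} x \<partial>lborel)"
    using \<open>\<delta> > 0\<close> by (intro nn_integral_Icc_split) (auto simp: algebra_simps)
  also have "(\<integral>\<^sup>+x. F x * indicator {real m * \<delta>..real m * \<delta> + \<delta> / 2} x \<partial>lborel) =
     (\<integral>\<^sup>+x. F (real m * \<delta> + x) * indicator {0..\<delta> / 2} x \<partial>lborel)"
    by (subst nn_integral_real_affine[where c = 1 and t = "real m * \<delta>"]) (auto intro!: nn_integral_cong simp: indicator_def)
  also have "(\<integral>\<^sup>+x. F x * indicator {real m * \<delta> + \<delta> / 2..real (Suc m) * \<delta>} x \<partial>lborel) =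
     (\<integral>\<^sup>+x. F (real (Suc m) * \<delta> - x) * indicator {0..\<delta> / 2} x \<partial>lborel)"
    by (subst nn_integral_real_affine[where c = "-1" and t = "real (Suc m) * \<delta>"])
       (auto intro!: nn_integral_cong simp: indicator_def algebra_simps)
  finally show ?case using Suc by (simp add: add.assoc del: of_nat_Suc)
qed

lemma nn_integral_cos_substitution:
  fixes G :: "real \<Rightarrow> real"
  assumes [measurable]: "G \<in> borel_measurable borel" and "a > 0" "n > 0"
  shows "(\<integral>\<^sup>+y. ennreal (G y * indicator {-a..a} y) \<partial>lborel) =
    (\<integral>\<^sup>+\<phi>. ennreal (G (a * cos (n * \<phi>)) * (n * a * sin (n * \<phi>)) * indicator {0..pi / n} \<phi>) \<partial>lborel)"
proof -
  \<comment> \<open>The substitution is made on [-pi / n, 0], where this function is nondecreasing;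
    the reflection of the variable comes afterwards.\<close>
  define g where "g s = a * cos (n * s)" for s
  have g: "g (- (pi / n)) = - a" "g 0 = a" using assms by (simp_all add: g_def)
  have "(\<integral>\<^sup>+y. ennreal (G y * indicator {g (- (pi / n))..g 0} y) \<partial>lborel) =
    (\<integral>\<^sup>+s. ennreal (G (g s) * (- n * a * sin (n * s)) * indicator {- (pi / n)..0} s) \<partial>lborel)"
  proof (rule nn_integral_substitution)
    show "set_borel_measurable borel {g (- (pi / n))..g 0} G"
      unfolding set_borel_measurable_def by measurable
    show "(g has_real_derivative - n * a * sin (n * s)) (at s)" for s
      unfolding g_def by (auto intro!: derivative_eq_intros)
    show "continuous_on {- (pi / n)..0} (\<lambda>s. - n * a * sin (n * s))" by (intro continuous_intros)
    show "- (pi / n) \<le> 0" using assms by simp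
    fix s assume s: "s \<in> {- (pi / n)..0}"
    then have "0 \<le> n * (- s)" "n * (- s) \<le> pi" using assms by (auto simp: field_simps mult_le_0_iff)
    then have "0 \<le> sin (n * (- s))" by (intro sin_ge_zero)
    then show "0 \<le> - n * a * sin (n * s)" using assms by (simp add: mult_le_0_iff)
  qed
  also have "\<dots> = (\<integral>\<^sup>+\<phi>. ennreal (G (g (0 + (-1) * \<phi>)) * (- n * a * sin (n * (0 + (-1) * \<phi>))) * indicator {- (pi / n)..0} (0 + (-1) * \<phi>)) \<partial>lborel)"
    by (subst nn_integral_real_affine[where c = "-1" and t = 0]) (auto simp: g_def)
  also have "\<dots> = (\<integral>\<^sup>+\<phi>. ennreal (G (a * cos (n * \<phi>)) * (n * a * sin (n * \<phi>)) * indicator {0..pi / n} \<phi>) \<partial>lborel)"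
    by (intro nn_integral_cong) (auto simp: g_def indicator_def)
  finally show ?thesis unfolding g .
qed

text \<open>Carries an identity for nonnegative integrands over to signed ones by positive and
  negative parts. It serves for pulling measures back along finitely many maps, and for a sum of two
  measures.\<close>

lemma lebesgue_integral_of_nn_images:
  fixes M :: "'a measure" and N :: "'i \<Rightarrow> 'b measure" and X :: "'i \<Rightarrow> 'b \<Rightarrow> 'a"
  assumes nn: "\<And>f :: 'a \<Rightarrow> real. f \<in> borel_measurable M \<Longrightarrow> (\<And>x. 0 \<le> f x) \<Longrightarrow>
      (\<integral>\<^sup>+x. ennreal (f x) \<partial>M) = (\<Sum>i\<in>I. \<integral>\<^sup>+y. ennreal (f (X i y)) \<partial>N i)"
    and I: "finite I"
    and f: "f \<in> borel_measurable M" and int: "\<And>i. i \<in> I \<Longrightarrow> integrable (N i) (\<lambda>y. f (X i y))"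
  shows "integrable M (f :: 'a \<Rightarrow> real)" and "(LINT x|M. f x) = (\<Sum>i\<in>I. LINT y|N i. f (X i y))"
proof -
  have eq: "(\<integral>\<^sup>+x. ennreal (g x) \<partial>M) = (\<Sum>i\<in>I. \<integral>\<^sup>+y. ennreal (g (X i y)) \<partial>N i)"
    if g: "g \<in> borel_measurable M" for g :: "'a \<Rightarrow> real"
  proof -
    have "(\<integral>\<^sup>+x. ennreal (max 0 (g x)) \<partial>M) = (\<Sum>i\<in>I. \<integral>\<^sup>+y. ennreal (max 0 (g (X i y))) \<partial>N i)"
      using g by (intro nn) auto
    then show ?thesis by (simp add: ennreal_max_0)
  qed
  have fin: "(\<integral>\<^sup>+y. ennreal (f (X i y)) \<partial>N i) < \<infinity>" "(\<integral>\<^sup>+y. ennreal (- f (X i y)) \<partial>N i) < \<infinity>" if "i \<in> I" for i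
    using int[OF that] by (auto simp: real_integrable_def top.not_eq_extremum)
  show intM: "integrable M f"
    unfolding real_integrable_def using f fin eq[OF f] eq[of "\<lambda>x. - f x"] I
    by (auto simp: less_top[symmetric] ennreal_sum_less_top)
  have "(LINT x|M. f x) = enn2real (\<Sum>i\<in>I. \<integral>\<^sup>+y. ennreal (f (X i y)) \<partial>N i) - enn2real (\<Sum>i\<in>I. \<integral>\<^sup>+y. ennreal (- f (X i y)) \<partial>N i)"
    using f by (simp add: real_lebesgue_integral_def[OF intM] eq)
  also have "\<dots> = (\<Sum>i\<in>I. enn2real (\<integral>\<^sup>+y. ennreal (f (X i y)) \<partial>N i)) - (\<Sum>i\<in>I. enn2real (\<integral>\<^sup>+y. ennreal (- f (X i y)) \<partial>N i))"
    using fin by (subst (1 2) enn2real_sum) auto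
  also have "\<dots> = (\<Sum>i\<in>I. LINT y|N i. f (X i y))"
    using int by (simp add: real_lebesgue_integral_def sum_subtractf)
  finally show "(LINT x|M. f x) = (\<Sum>i\<in>I. LINT y|N i. f (X i y))" .
qed

section \<open>Chebyshev polynomials in trigonometric form\<close>

lemma chebT_cos: "poly (chebT (int n)) (cos \<theta>) = cos (real n * \<theta>)"
  using cheb_rec_T[of n \<theta>, where 'a = real] by (simp add: chebT_of_nat)

lemma chebU_cos: "poly (chebU (int n)) (cos \<theta>) * sin \<theta> = sin (real (Suc n) * \<theta>)"
proof (cases "sin \<theta> = 0")
  case True
  then obtain i :: int where "\<theta> = of_int i * pi" using sin_zero_iff_int2 by blast
  then have "real (Suc n) * \<theta> = of_int (int (Suc n) * i) * pi" by (simp only: of_int_mult of_int_of_nat_eq mult.assoc)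
  then have "sin (real (Suc n) * \<theta>) = 0" using sin_zero_iff_int2 by blast
  then show ?thesis using True by simp
next
  case False
  then show ?thesis using cheb_rec_U[of \<theta> n, where 'a = real] by (simp add: chebU_of_nat add.commute)
qed

lemma monT_cos: "n \<ge> 1 \<Longrightarrow> poly (monT (int n)) (cos \<theta>) = 2 powi (1 - int n) * cos (real n * \<theta>)"
  by (simp add: monT_def chebT_cos)

lemma monU_cos: "poly (monU (int n)) (cos \<theta>) * sin \<theta> = (1/2) ^ n * sin (real (Suc n) * \<theta>)"
proof (cases "n = 0")
  case False
  have "poly (monU (int n)) (cos \<theta>) = (1/2) ^ n * poly (chebU (int n)) (cos \<theta>)"
    using False by (simp add: monU_def power_int_minus power_one_over inverse_eq_divide)
  then show ?thesis using chebU_cos[of n \<theta>] by simp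
qed (simp add: monU_def)

lemma chebT_mult:
  assumes "k \<le> n"
  shows "chebT (int n) * chebT (int k) = smult (1/2) (chebT (int (n + k)) + chebT (int (n - k)) :: real poly)"
proof (rule poly_eq_on_cos)
  fix \<theta> :: real
  have "cos (real n * \<theta>) * cos (real k * \<theta>) = (cos (real (n + k) * \<theta>) + cos (real (n - k) * \<theta>)) / 2"
    using assms by (simp add: of_nat_diff distrib_right left_diff_distrib cos_add cos_diff)
  then show "poly (chebT (int n) * chebT (int k)) (of_real (cos \<theta>)) =
    poly (smult (1/2) (chebT (int (n + k)) + chebT (int (n - k)) :: real poly)) (of_real (cos \<theta>))"
    by (simp add: chebT_cos del: of_nat_add)
qed

lemma chebT_degree: "degree (chebT (int n) :: real poly) = n \<and> lead_coeff (chebT (int n) :: real poly) > 0"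
proof -
  have "degree (cheb_rec [:0, 1:] n :: real poly) = n \<and> lead_coeff (cheb_rec [:0, 1:] n :: real poly) > 0 \<and>
     degree (cheb_rec [:0, 1:] (Suc n) :: real poly) = Suc n \<and> lead_coeff (cheb_rec [:0, 1:] (Suc n) :: real poly) > 0"
  proof (induction n)
    case (Suc n)
    let ?p = "[:0, 2:] * cheb_rec [:0, 1:] (Suc n) :: real poly" and ?q = "cheb_rec [:0, 1:] n :: real poly"
    have nz: "cheb_rec [:0, 1:] (Suc n) \<noteq> (0 :: real poly)" using Suc by auto
    have p: "degree ?p = Suc (Suc n)" using Suc nz by (subst degree_mult_eq) auto
    have "lead_coeff ?p > 0" using Suc unfolding lead_coeff_mult by (auto simp del: cheb_rec.simps)
    then have c: "coeff (?p - ?q) (Suc (Suc n)) > 0"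
      using Suc p by (simp del: cheb_rec.simps mult_pCons_left add: coeff_eq_0)
    moreover have "degree (?p - ?q) \<le> Suc (Suc n)"
      using Suc p by (intro degree_diff_le) auto
    ultimately have d: "degree (?p - ?q) = Suc (Suc n)"
      by (intro antisym le_degree) auto
    have e: "cheb_rec [:0, 1:] (Suc (Suc n)) = ?p - ?q" by simp
    show ?case unfolding e d using Suc c by (auto simp del: cheb_rec.simps mult_pCons_left)
  qed simp
  then show ?thesis unfolding chebT_of_nat by blast
qed

lemma borel_measurable_poly [measurable]: "poly (p :: real poly) \<in> borel_measurable borel"
  by (intro borel_measurable_continuous_onI continuous_intros)

text \<open>\<open>W\<close> stands for w_Q extended by zero, so that integrals run over the whole
  line; the last assumption is the finiteness of C.\<close>

locale arc_weight =
  fixes m :: nat and W :: "real \<Rightarrow> real" and \<alpha> :: real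
  assumes m: "m \<ge> 1"
    and \<alpha>: "\<alpha> = 2 powi (1 - 2 * int m)"
    and W_meas [measurable]: "W \<in> borel_measurable borel"
    and W_nonneg: "\<And>y. 0 \<le> W y"
    and W_supp: "\<And>y. \<not> (- \<alpha> < y \<and> y < \<alpha>) \<Longrightarrow> W y = 0"
    and W_int: "integrable lborel (\<lambda>y. W y / (y + \<alpha>))"
begin

abbreviation "T2 \<equiv> monT (2 * int m) :: real poly"

text \<open>\<open>dens\<close> is w_P times the characteristic function of E, and \<open>K\<close>
  is the same weight in the angle (\<open>dens_cos\<close>). \<open>\<kappa>\<close> keeps one of 2m
  congruent arcs, \<open>\<nu>\<close> is the continuous part of the claimed measure, and
  \<open>\<rho>\<close> is the image of \<open>\<kappa>\<close> under y = \<alpha> cos(2m \<phi>).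
  At the zeros of T_m the quotient in \<open>dens\<close> and the tangent in \<open>K\<close> both
  take the default value 0 of a division by zero, so the two agree there as well.\<close>

definition "dens x = \<bar>poly (chebU (int m - 1)) x / poly (chebT (int m)) x\<bar> * W (poly T2 x)"
definition "K \<phi> = \<bar>tan (real m * \<phi>)\<bar> * W (\<alpha> * cos (2 * real m * \<phi>))"
definition "\<kappa> = density lborel (\<lambda>\<phi>. ennreal (K \<phi> * indicator {0..pi / (2 * real m)} \<phi>))"
definition "\<nu> = density lborel (\<lambda>x. ennreal (dens x))"
definition "\<rho> = density lborel (\<lambda>y. ennreal (W y / (y + \<alpha>) / (2 * real m)))"

lemma \<alpha>_pos: "\<alpha> > 0" by (simp add: \<alpha>)

lemma dens_meas [measurable]: "dens \<in> borel_measurable borel"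
  unfolding dens_def by measurable

lemma K_meas [measurable]: "K \<in> borel_measurable borel"
  unfolding K_def tan_def by measurable

lemma sets_measures [measurable_cong, simp]: "sets \<kappa> = sets borel" "sets \<nu> = sets borel" "sets \<rho> = sets borel"
  and space_measures [simp]: "space \<kappa> = UNIV" "space \<nu> = UNIV" "space \<rho> = UNIV"
  by (simp_all add: \<kappa>_def \<nu>_def \<rho>_def)

lemma T2_cos: "poly T2 (cos \<theta>) = \<alpha> * cos (2 * real m * \<theta>)"
  using monT_cos[of "2 * m" \<theta>] m by (simp add: \<alpha>)

text \<open>Pell's identity T_{2m} - 1 = 2 (x^2 - 1) U_{m-1}^2 in monic normalisation. It shows that
  y >= \<alpha> for |x| > 1, so \<open>dens\<close> lives on [-1, 1] and x = cos \<theta> loses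
  nothing.\<close>

lemma T2_minus_\<alpha>: "T2 - [:\<alpha>:] = [:-1, 0, 1:] * monU (int m - 1) ^ 2"
proof (rule poly_eq_on_cos)
  fix \<theta> :: real assume "0 < \<theta>" "\<theta> < pi"
  have m1: "int m - 1 = int (m - 1)" "Suc (m - 1) = m" using m by auto
  have "poly (monU (int m - 1)) (cos \<theta>) * sin \<theta> = (1/2) ^ (m - 1) * sin (real m * \<theta>)"
    using monU_cos[of "m - 1" \<theta>] unfolding m1 .
  then have A: "(poly (monU (int m - 1)) (cos \<theta>) * sin \<theta>)\<^sup>2 = (1/4) ^ (m - 1) * (sin (real m * \<theta>))\<^sup>2"
    by (simp add: power_mult_distrib power_divide) (simp add: power_mult[symmetric] mult.commute power_mult)
  have "\<alpha> = 2 * 2 powi (- int (2 * m))" using power_int_add[of "2::real" 1 "- int (2 * m)"] by (simp add: \<alpha>)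
  also have "2 powi (- int (2 * m)) = (1/4 :: real) ^ m"
    by (simp only: power_int_minus power_int_of_nat) (simp add: power_mult power_one_over inverse_eq_divide)
  also have "2 * (1/4 :: real) ^ m = (1/4) ^ (m - 1) / 2"
    using m by (cases m) auto
  finally have a: "\<alpha> = (1/4) ^ (m - 1) / 2" .
  have "poly (T2 - [:\<alpha>:]) (cos \<theta>) = \<alpha> * cos (2 * real m * \<theta>) - \<alpha>"
    by (simp only: poly_diff T2_cos) simp
  also have "cos (2 * real m * \<theta>) = 1 - 2 * (sin (real m * \<theta>))\<^sup>2"
    using cos_double_sin[of "real m * \<theta>"] by (simp add: mult.assoc)
  also have "\<alpha> * (1 - 2 * (sin (real m * \<theta>))\<^sup>2) - \<alpha> = - (poly (monU (int m - 1)) (cos \<theta>) * sin \<theta>)\<^sup>2"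
    unfolding A a by (simp add: field_simps)
  also have "\<dots> = ((cos \<theta>)\<^sup>2 - 1) * (poly (monU (int m - 1)) (cos \<theta>))\<^sup>2"
    by (simp add: power_mult_distrib sin_squared_eq algebra_simps)
  also have "\<dots> = poly ([:-1, 0, 1:] * monU (int m - 1) ^ 2) (cos \<theta>)"
    by (simp add: power2_eq_square algebra_simps)
  finally show "poly (T2 - [:\<alpha>:]) (of_real (cos \<theta>)) = poly ([:-1, 0, 1:] * monU (int m - 1) ^ 2) (of_real (cos \<theta>))"
    by (simp only: of_real_eq_id id_apply)
qed

lemma dens_supp: "\<bar>x\<bar> > 1 \<Longrightarrow> dens x = 0"
proof -
  assume "\<bar>x\<bar> > 1"
  then have "x\<^sup>2 - 1 > 0" using abs_square_le_1[of x] by force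
  have "poly T2 x - \<alpha> = (x\<^sup>2 - 1) * (poly (monU (int m - 1)) x)\<^sup>2"
    using arg_cong[OF T2_minus_\<alpha>, of "\<lambda>p. poly p x"] by (simp add: power2_eq_square algebra_simps)
  also have "\<dots> \<ge> 0" using \<open>x\<^sup>2 - 1 > 0\<close> by simp
  finally show ?thesis using W_supp[of "poly T2 x"] by (simp add: dens_def)
qed

lemma dens_nonneg: "0 \<le> dens x" and K_nonneg: "0 \<le> K \<phi>"
  using W_nonneg by (simp_all add: dens_def K_def)

lemma dens_cos:
  assumes "\<phi> \<in> {0..pi}"
  shows "dens (cos \<phi>) * sin \<phi> = K \<phi>"
proof -
  have s: "0 \<le> sin \<phi>" using assms by (intro sin_ge_zero) auto
  have m1: "int m - 1 = int (m - 1)" "Suc (m - 1) = m" using m by auto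
  have "\<bar>poly (chebU (int m - 1)) (cos \<phi>) / poly (chebT (int m)) (cos \<phi>)\<bar> * sin \<phi>
     = \<bar>poly (chebU (int m - 1)) (cos \<phi>) * sin \<phi> / poly (chebT (int m)) (cos \<phi>)\<bar>"
    using s by (simp add: abs_mult)
  also have "\<dots> = \<bar>tan (real m * \<phi>)\<bar>"
    using chebU_cos[of "m - 1" \<phi>] unfolding m1 by (simp add: chebT_cos tan_def)
  finally have E: "\<bar>poly (chebU (int m - 1)) (cos \<phi>) / poly (chebT (int m)) (cos \<phi>)\<bar> * sin \<phi> = \<bar>tan (real m * \<phi>)\<bar>" .
  show ?thesis unfolding dens_def K_def T2_cos E[symmetric] by (simp only: mult_ac)
qed

lemma K_shift: "K (real i * (pi / real m) + \<phi>) = K \<phi>" and K_reflect: "K (real i * (pi / real m) - \<phi>) = K \<phi>"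
proof -
  have a: "real m * (real i * (pi / real m) + \<phi>) = real m * \<phi> + of_int (int i) * pi"
     "real m * (real i * (pi / real m) - \<phi>) = - (real m * \<phi>) + of_int (int i) * pi"
    using m by (simp_all add: field_simps)
  have c: "cos (2 * (real m * \<phi>)) = 2 * (cos (real m * \<phi>))\<^sup>2 - 1" for \<phi> by (rule cos_double_cos)
  have tn: "tan (x + of_int (int i) * pi) = tan x" for x
    using tan_periodic_int[of x "int i"] by simp
  have cs: "(cos (x + of_int (int i) * pi))\<^sup>2 = (cos x)\<^sup>2" for x
    by (simp add: cos_add power_mult_distrib flip: power_mult)
  show "K (real i * (pi / real m) + \<phi>) = K \<phi>" "K (real i * (pi / real m) - \<phi>) = K \<phi>"
    unfolding K_def mult.assoc c unfolding a tn cs by simp_all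
qed

text \<open>The 2m inverse branches of \<open>T2\<close>. A pair \<open>(i, True)\<close> runs
  forward from the angle i pi / m and \<open>(i, False)\<close> backward from (i + 1) pi / m, so
  that \<phi> in [0, pi / (2m)] covers [0, pi].\<close>

definition branch :: "nat \<times> bool \<Rightarrow> real \<Rightarrow> real" where
  "branch b \<phi> = (if snd b then cos (real (fst b) * (pi / real m) + \<phi>) else cos (real (Suc (fst b)) * (pi / real m) - \<phi>))"

lemma sum_times_bool: "(\<Sum>b\<in>A \<times> UNIV. g b) = (\<Sum>i\<in>A. g (i, True) + g (i, False))"
proof -
  have "(\<Sum>b\<in>A \<times> UNIV. g b) = (\<Sum>i\<in>A. \<Sum>c\<in>UNIV. g (i, c))"
    by (simp add: sum.cartesian_product)
  then show ?thesis by (simp add: UNIV_bool add.commute)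
qed

lemma nn_integral_\<nu>:
  fixes f :: "real \<Rightarrow> real"
  assumes [measurable]: "f \<in> borel_measurable borel" and f: "\<And>x. 0 \<le> f x"
  shows "(\<integral>\<^sup>+x. ennreal (f x) \<partial>\<nu>) = (\<Sum>b\<in>{..<m} \<times> UNIV. \<integral>\<^sup>+\<phi>. ennreal (f (branch b \<phi>)) \<partial>\<kappa>)"
proof -
  define \<delta> where "\<delta> = pi / real m"
  have \<delta>: "\<delta> > 0" "real m * \<delta> = pi" "\<delta> / 2 = pi / (2 * real m)" using m by (auto simp: \<delta>_def)
  have "(\<integral>\<^sup>+x. ennreal (f x) \<partial>\<nu>) = (\<integral>\<^sup>+x. ennreal (dens x) * ennreal (f x) \<partial>lborel)"
    unfolding \<nu>_def by (subst nn_integral_density) auto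
  also have "\<dots> = (\<integral>\<^sup>+x. ennreal (f x * dens x * indicator {-1..1} x) \<partial>lborel)"
    using dens_supp f dens_nonneg
    by (intro nn_integral_cong) (auto simp: indicator_def ennreal_mult' mult.commute abs_le_iff not_le abs_if split: if_splits)
  also have "\<dots> = (\<integral>\<^sup>+\<phi>. ennreal (f (cos \<phi>) * dens (cos \<phi>) * sin \<phi> * indicator {0..pi} \<phi>) \<partial>lborel)"
    using nn_integral_cos_substitution[of "\<lambda>x. f x * dens x" 1 1] by simp
  also have "\<dots> = (\<integral>\<^sup>+\<phi>. ennreal (f (cos \<phi>) * K \<phi>) * indicator {0..real m * \<delta>} \<phi> \<partial>lborel)"
    unfolding \<delta> by (intro nn_integral_cong) (auto simp: indicator_def dens_cos mult.assoc)
  also have "\<dots> = (\<Sum>i<m. (\<integral>\<^sup>+\<phi>. ennreal (f (cos (real i * \<delta> + \<phi>)) * K (real i * \<delta> + \<phi>)) * indicator {0..\<delta> / 2} \<phi> \<partial>lborel)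
      + (\<integral>\<^sup>+\<phi>. ennreal (f (cos (real (Suc i) * \<delta> - \<phi>)) * K (real (Suc i) * \<delta> - \<phi>)) * indicator {0..\<delta> / 2} \<phi> \<partial>lborel))"
    by (rule nn_integral_fold) (use \<delta> in auto)
  also have "\<dots> = (\<Sum>i<m. (\<integral>\<^sup>+\<phi>. ennreal (f (branch (i, True) \<phi>)) \<partial>\<kappa>) + (\<integral>\<^sup>+\<phi>. ennreal (f (branch (i, False) \<phi>)) \<partial>\<kappa>))"
  proof (rule sum.cong[OF refl])
    have *: "(\<integral>\<^sup>+\<phi>. ennreal (g \<phi> * K \<phi>) * indicator {0..\<delta> / 2} \<phi> \<partial>lborel) = (\<integral>\<^sup>+\<phi>. ennreal (g \<phi>) \<partial>\<kappa>)"
      if [measurable]: "g \<in> borel_measurable borel" and "\<And>x. 0 \<le> g x" for g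
      unfolding \<kappa>_def \<delta>(3) using that K_nonneg
      by (subst nn_integral_density) (auto intro!: nn_integral_cong simp: indicator_def ennreal_mult' mult.commute)
    fix i
    show "(\<integral>\<^sup>+\<phi>. ennreal (f (cos (real i * \<delta> + \<phi>)) * K (real i * \<delta> + \<phi>)) * indicator {0..\<delta> / 2} \<phi> \<partial>lborel)
      + (\<integral>\<^sup>+\<phi>. ennreal (f (cos (real (Suc i) * \<delta> - \<phi>)) * K (real (Suc i) * \<delta> - \<phi>)) * indicator {0..\<delta> / 2} \<phi> \<partial>lborel)
      = (\<integral>\<^sup>+\<phi>. ennreal (f (branch (i, True) \<phi>)) \<partial>\<kappa>) + (\<integral>\<^sup>+\<phi>. ennreal (f (branch (i, False) \<phi>)) \<partial>\<kappa>)"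
      unfolding \<delta>_def K_shift K_reflect using f
      by (subst (1 2) *[unfolded \<delta>_def]) (auto simp: branch_def)
  qed
  also have "\<dots> = (\<Sum>b\<in>{..<m} \<times> UNIV. \<integral>\<^sup>+\<phi>. ennreal (f (branch b \<phi>)) \<partial>\<kappa>)"
    by (simp only: sum_times_bool)
  finally show ?thesis .
qed

text \<open>Here the denominator y + \<alpha> appears: tan(m \<phi>) = sin(2m \<phi>) / (1 + cos(2m
  \<phi>)), and \<alpha> (1 + cos(2m \<phi>)) is y + \<alpha>. The sine is absorbed by the Jacobian
  2m \<alpha> sin(2m \<phi>), whose factor 2m is the one divided out in
  \<open>\<rho>\<close>.\<close>

lemma nn_integral_\<rho>:
  fixes h :: "real \<Rightarrow> real"
  assumes [measurable]: "h \<in> borel_measurable borel" and h: "\<And>x. 0 \<le> h x"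
  shows "(\<integral>\<^sup>+y. ennreal (h y) \<partial>\<rho>) = (\<integral>\<^sup>+\<phi>. ennreal (h (\<alpha> * cos (2 * real m * \<phi>))) \<partial>\<kappa>)"
proof -
  define G where "G y = h y * (W y / (y + \<alpha>) / (2 * real m))" for y
  have [measurable]: "G \<in> borel_measurable borel" unfolding G_def by measurable
  have "(\<integral>\<^sup>+y. ennreal (h y) \<partial>\<rho>) = (\<integral>\<^sup>+y. ennreal (W y / (y + \<alpha>) / (2 * real m)) * ennreal (h y) \<partial>lborel)"
    unfolding \<rho>_def by (subst nn_integral_density) auto
  also have "\<dots> = (\<integral>\<^sup>+y. ennreal (G y * indicator {-\<alpha>..\<alpha>} y) \<partial>lborel)"
  proof (rule nn_integral_cong)
    fix y
    show "ennreal (W y / (y + \<alpha>) / (2 * real m)) * ennreal (h y) = ennreal (G y * indicator {-\<alpha>..\<alpha>} y)"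
    proof (cases "y \<in> {-\<alpha>..\<alpha>}")
      case True
      then have e: "G y * indicator {-\<alpha>..\<alpha>} y = W y / (y + \<alpha>) / (2 * real m) * h y"
        by (simp add: G_def)
      show ?thesis unfolding e by (rule ennreal_mult''[OF h, symmetric])
    next
      case False
      then have "W y = 0" using W_supp[of y] by auto
      then show ?thesis by (simp add: G_def)
    qed
  qed
  also have "\<dots> = (\<integral>\<^sup>+\<phi>. ennreal (G (\<alpha> * cos (2 * real m * \<phi>)) * (2 * real m * \<alpha> * sin (2 * real m * \<phi>)) * indicator {0..pi / (2 * real m)} \<phi>) \<partial>lborel)"
    using m \<alpha>_pos by (intro nn_integral_cos_substitution) auto
  also have "\<dots> = (\<integral>\<^sup>+\<phi>. ennreal (K \<phi> * indicator {0..pi / (2 * real m)} \<phi>) * ennreal (h (\<alpha> * cos (2 * real m * \<phi>))) \<partial>lborel)"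
  proof (rule nn_integral_cong)
    fix \<phi> :: real
    show "ennreal (G (\<alpha> * cos (2 * real m * \<phi>)) * (2 * real m * \<alpha> * sin (2 * real m * \<phi>)) * indicator {0..pi / (2 * real m)} \<phi>) =
      ennreal (K \<phi> * indicator {0..pi / (2 * real m)} \<phi>) * ennreal (h (\<alpha> * cos (2 * real m * \<phi>)))"
    proof (cases "\<phi> \<in> {0..pi / (2 * real m)}")
      case True
      then have "0 \<le> real m * \<phi>" "real m * \<phi> \<le> pi / 2" using m by (auto simp: field_simps)
      then have "0 \<le> tan (real m * \<phi>)"
        unfolding tan_def by (intro divide_nonneg_nonneg sin_ge_zero cos_ge_zero) auto
      then have "K \<phi> = tan (real m * \<phi>) * W (\<alpha> * cos (2 * real m * \<phi>))"
        by (simp add: K_def)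
      then have "K \<phi> = sin (2 * real m * \<phi>) / (cos (2 * real m * \<phi>) + 1) * W (\<alpha> * cos (2 * real m * \<phi>))"
        unfolding tan_half[of "real m * \<phi>"] by (simp only: mult.assoc)
      moreover have "\<alpha> * cos (2 * real m * \<phi>) + \<alpha> = \<alpha> * (cos (2 * real m * \<phi>) + 1)" by (simp add: algebra_simps)
      ultimately have "G (\<alpha> * cos (2 * real m * \<phi>)) * (2 * real m * \<alpha> * sin (2 * real m * \<phi>)) = K \<phi> * h (\<alpha> * cos (2 * real m * \<phi>))"
        unfolding G_def using m \<alpha>_pos by simp
      then show ?thesis using True h K_nonneg by (simp add: ennreal_mult')
    qed simp
  qed
  also have "\<dots> = (\<integral>\<^sup>+\<phi>. ennreal (h (\<alpha> * cos (2 * real m * \<phi>))) \<partial>\<kappa>)"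
    unfolding \<kappa>_def by (subst nn_integral_density) auto
  finally show ?thesis .
qed

lemma weight_nonneg: "0 \<le> W y / (y + \<alpha>)"
  using W_nonneg[of y] W_supp[of y] by (cases "- \<alpha> < y \<and> y < \<alpha>") auto

lemma finite_\<kappa>: "finite_measure \<kappa>"
proof
  have "emeasure \<kappa> (space \<kappa>) = (\<integral>\<^sup>+\<phi>. ennreal 1 \<partial>\<kappa>)" by simp
  also have "\<dots> = (\<integral>\<^sup>+y. ennreal 1 \<partial>\<rho>)" by (subst nn_integral_\<rho>) auto
  also have "\<dots> = (\<integral>\<^sup>+y. ennreal (W y / (y + \<alpha>) / (2 * real m)) \<partial>lborel)"
    unfolding \<rho>_def by (subst nn_integral_density) auto
  also have "\<dots> < \<infinity>"
    using integrable_divide[OF W_int, of "2 * real m"]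
    by (subst nn_integral_eq_integral) (auto intro!: divide_nonneg_nonneg[OF weight_nonneg] simp del: divide_divide_eq_left)
  finally show "emeasure \<kappa> (space \<kappa>) \<noteq> \<infinity>" by simp
qed

lemma integrable_\<kappa>:
  fixes X :: "real \<Rightarrow> real"
  assumes [measurable]: "X \<in> borel_measurable borel" and "\<And>\<phi>. \<bar>X \<phi>\<bar> \<le> r"
  shows "integrable \<kappa> (\<lambda>\<phi>. poly p (X \<phi>))"
proof -
  interpret finite_measure \<kappa> by (rule finite_\<kappa>)
  have "compact (poly p ` {- r..r})" by (intro compact_continuous_image continuous_at_imp_continuous_on ballI poly_isCont compact_Icc)
  then obtain B where B: "\<And>y. y \<in> {- r..r} \<Longrightarrow> \<bar>poly p y\<bar> \<le> B"
    using compact_imp_bounded by (force simp: bounded_iff)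
  have "X \<phi> \<in> {- r..r}" for \<phi> using assms(2)[of \<phi>] by auto
  then show ?thesis using B by (intro integrable_const_bound[of _ B]) auto
qed

lemma branch_meas [measurable]: "branch b \<in> borel_measurable borel"
  unfolding branch_def by measurable

lemma branch_bound: "\<bar>branch b \<phi>\<bar> \<le> 1"
  by (auto simp: branch_def)

lemma T2_branch: "poly T2 (branch b \<phi>) = \<alpha> * cos (2 * real m * \<phi>)"
proof -
  have a: "2 * real m * (real i * (pi / real m) + \<phi>) = 2 * real m * \<phi> + of_int (int i) * (2 * pi)"
     "2 * real m * (real i * (pi / real m) - \<phi>) = - (2 * real m * \<phi>) + of_int (int i) * (2 * pi)" for i
    using m by (simp_all add: field_simps)
  have c: "cos (x + of_int (int i) * (2 * pi)) = cos x" for x i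
    using cos_add[of x "of_int (int i) * (2 * pi)"] cos_int_2pin[of "int i"] sin_int_2pin[of "int i"] by (simp add: mult_ac)
  show ?thesis
    by (cases "snd b") (simp_all only: branch_def if_True if_False T2_cos a c cos_minus)
qed

lemma integrable_\<nu>: "integrable \<nu> (poly p)"
  and integral_\<nu>: "(LINT x|\<nu>. poly p x) = (\<Sum>b\<in>{..<m} \<times> UNIV. LINT \<phi>|\<kappa>. poly p (branch b \<phi>))"
proof -
  have nn: "(\<integral>\<^sup>+x. ennreal (f x) \<partial>\<nu>) = (\<Sum>b\<in>{..<m} \<times> UNIV. \<integral>\<^sup>+\<phi>. ennreal (f (branch b \<phi>)) \<partial>\<kappa>)"
    if "f \<in> borel_measurable \<nu>" "\<And>x. 0 \<le> f x" for f :: "real \<Rightarrow> real"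
    using that by (intro nn_integral_\<nu>) auto
  show "integrable \<nu> (poly p)"
    by (rule lebesgue_integral_of_nn_images(1)[OF nn]) (auto intro!: integrable_\<kappa>[of _ 1] branch_bound)
  show "(LINT x|\<nu>. poly p x) = (\<Sum>b\<in>{..<m} \<times> UNIV. LINT \<phi>|\<kappa>. poly p (branch b \<phi>))"
    by (rule lebesgue_integral_of_nn_images(2)[OF nn]) (auto intro!: integrable_\<kappa>[of _ 1] branch_bound)
qed

lemma integral_\<nu>_chebT:
  assumes "1 \<le> k" "k < 2 * m"
  shows "(LINT x|\<nu>. poly (chebT (int k) * (H \<circ>\<^sub>p T2)) x) = 0"
proof -
  define p where "p = chebT (int k) * (H \<circ>\<^sub>p T2)"
  have "(LINT x|\<nu>. poly p x) = (LINT \<phi>|\<kappa>. (\<Sum>b\<in>{..<m} \<times> UNIV. poly p (branch b \<phi>)))"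
    unfolding integral_\<nu> by (subst Bochner_Integration.integral_sum) (auto intro!: integrable_\<kappa>[of _ 1] branch_bound)
  also have "\<dots> = (LINT \<phi>|\<kappa>. 0)"
  proof (rule Bochner_Integration.integral_cong[OF refl])
    fix \<phi>
    have "(\<Sum>b\<in>{..<m} \<times> UNIV. poly p (branch b \<phi>)) = (\<Sum>b\<in>{..<m} \<times> UNIV. poly (chebT (int k)) (branch b \<phi>)) * poly H (\<alpha> * cos (2 * real m * \<phi>))"
      by (simp add: p_def poly_pcompose T2_branch sum_distrib_right)
    also have "(\<Sum>b\<in>{..<m} \<times> UNIV. poly (chebT (int k)) (branch b \<phi>)) =
      (\<Sum>i<m. cos (real k * (real i * (pi / real m) + \<phi>)) + cos (real k * (real (Suc i) * (pi / real m) - \<phi>)))"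
      by (simp add: sum_times_bool branch_def chebT_cos del: of_nat_Suc)
    also have "\<dots> = 0" by (rule sum_cos_fold[OF assms])
    finally show "(\<Sum>b\<in>{..<m} \<times> UNIV. poly p (branch b \<phi>)) = 0" by simp
  qed
  finally show ?thesis by (simp add: p_def)
qed

lemma integral_\<nu>_pcompose:
  "integrable lborel (\<lambda>y. poly H y * (W y / (y + \<alpha>)))"
  "(LINT x|\<nu>. poly (H \<circ>\<^sub>p T2) x) = (LINT y|lborel. poly H y * (W y / (y + \<alpha>)))"
proof -
  have nn: "(\<integral>\<^sup>+y. ennreal (h y) \<partial>\<rho>) = (\<Sum>u\<in>{()}. \<integral>\<^sup>+\<phi>. ennreal (h (\<alpha> * cos (2 * real m * \<phi>))) \<partial>\<kappa>)"
    if "h \<in> borel_measurable \<rho>" "\<And>x. 0 \<le> h x" for h :: "real \<Rightarrow> real"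
    using that by (simp add: nn_integral_\<rho>)
  have int: "integrable \<kappa> (\<lambda>\<phi>. poly H (\<alpha> * cos (2 * real m * \<phi>)))"
    using \<alpha>_pos by (intro integrable_\<kappa>[of _ \<alpha>]) (auto simp: abs_mult)
  have 1: "integrable \<rho> (poly H)"
    by (rule lebesgue_integral_of_nn_images(1)[OF nn]) (use int in auto)
  have "(LINT y|\<rho>. poly H y) = (\<Sum>u\<in>{()}. LINT \<phi>|\<kappa>. poly H (\<alpha> * cos (2 * real m * \<phi>)))"
    by (rule lebesgue_integral_of_nn_images(2)[OF nn]) (use int in auto)
  then have 2: "(LINT y|\<rho>. poly H y) = (LINT \<phi>|\<kappa>. poly H (\<alpha> * cos (2 * real m * \<phi>)))" by simp
  have nn': "0 \<le> W y / (y + \<alpha>) / (2 * real m)" for y by (intro divide_nonneg_nonneg[OF weight_nonneg]) simp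
  have 3: "integrable lborel (\<lambda>y. W y / (y + \<alpha>) / (2 * real m) * poly H y)"
    using 1 unfolding \<rho>_def by (subst (asm) integrable_density) (use nn' in \<open>auto simp del: divide_divide_eq_left\<close>)
  have 4: "(LINT y|\<rho>. poly H y) = (LINT y|lborel. W y / (y + \<alpha>) / (2 * real m) * poly H y)"
    unfolding \<rho>_def by (subst integral_density) (use nn' in \<open>auto simp del: divide_divide_eq_left\<close>)
  have e: "poly H y * (W y / (y + \<alpha>)) = 2 * real m * (W y / (y + \<alpha>) / (2 * real m) * poly H y)" for y
    using m by simp
  show "integrable lborel (\<lambda>y. poly H y * (W y / (y + \<alpha>)))"
    unfolding e by (rule integrable_mult_right[OF 3])
  have "(LINT x|\<nu>. poly (H \<circ>\<^sub>p T2) x) = (\<Sum>b\<in>{..<m} \<times> (UNIV :: bool set). LINT \<phi>|\<kappa>. poly H (\<alpha> * cos (2 * real m * \<phi>)))"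
    unfolding integral_\<nu> by (simp add: poly_pcompose T2_branch)
  also have "\<dots> = 2 * real m * (LINT y|\<rho>. poly H y)"
    unfolding 2 by (simp add: card_cartesian_product)
  also have "\<dots> = (LINT y|lborel. poly H y * (W y / (y + \<alpha>)))"
    unfolding e 4 by (rule integral_mult_right_zero[symmetric])
  finally show "(LINT x|\<nu>. poly (H \<circ>\<^sub>p T2) x) = (LINT y|lborel. poly H y * (W y / (y + \<alpha>)))" .
qed

end

section \<open>The orthogonality measure\<close>

lemma cheb_rec_of_real:
  "poly (cheb_rec [:0, 1:] n) (of_real x :: complex) = of_real (poly (cheb_rec [:0, 1:] n) x)"
proof -
  have "poly (cheb_rec [:0, 1:] n) (of_real x :: complex) = of_real (poly (cheb_rec [:0, 1:] n) x) \<and>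
    poly (cheb_rec [:0, 1:] (Suc n)) (of_real x :: complex) = of_real (poly (cheb_rec [:0, 1:] (Suc n)) x)"
    by (induction n) simp_all
  then show ?thesis ..
qed

lemma monT_of_real: "poly (monT (int n)) (of_real x :: complex) = of_real (poly (monT (int n)) x)"
  by (cases n) (simp_all only: monT_of_nat_Suc monT_0 of_nat_0 poly_smult cheb_rec_of_real poly_1 of_real_1 of_real_mult
    of_real_power of_real_divide of_real_numeral)

lemma monT_eq_smult_chebT:
  "\<exists>c. c \<noteq> 0 \<and> (monT (int n) :: real poly) = smult c (chebT (int n))"
proof (cases "n = 0")
  case True
  have "chebT 0 = (1 :: real poly)" using chebT_of_nat[of 0, where 'a = real] by simp
  then show ?thesis using True by (intro exI[of _ 1]) (simp add: monT_def)
next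
  case False
  then show ?thesis by (intro exI[of _ "2 powi (1 - int n)"]) (simp add: monT_def)
qed

text \<open>Used to assemble the claimed measure from its continuous part and its point
  masses.\<close>

lemma sum_of_measures:
  fixes M1 M2 :: "real measure"
  assumes sets: "sets M1 = sets borel" "sets M2 = sets borel"
  obtains N where "sets N = sets borel"
    "\<And>S. S \<in> sets borel \<Longrightarrow> emeasure N S = emeasure M1 S + emeasure M2 S"
    "\<And>f. f \<in> borel_measurable borel \<Longrightarrow> (\<integral>\<^sup>+x. f x \<partial>N) = (\<integral>\<^sup>+x. f x \<partial>M1) + (\<integral>\<^sup>+x. f x \<partial>M2)"
proof -
  note [measurable_cong] = sets
  define N where "N = measure_of UNIV (sets borel) (\<lambda>S. emeasure M1 S + emeasure M2 S)"
  have sets_N [measurable_cong]: "sets N = sets borel"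
    unfolding N_def by (metis sets.sets_measure_of_eq space_borel)
  have em: "emeasure N S = emeasure M1 S + emeasure M2 S" if S: "S \<in> sets borel" for S
  proof (rule emeasure_measure_of[OF N_def])
    show "positive (sets N) (\<lambda>S. emeasure M1 S + emeasure M2 S)"
      by (simp add: positive_def)
    show "countably_additive (sets N) (\<lambda>S. emeasure M1 S + emeasure M2 S)"
    proof (rule countably_additiveI)
      fix A :: "nat \<Rightarrow> real set" assume A: "range A \<subseteq> sets N" "disjoint_family A"
      then have "(\<Sum>i. emeasure M1 (A i)) = emeasure M1 (\<Union>(range A))" "(\<Sum>i. emeasure M2 (A i)) = emeasure M2 (\<Union>(range A))"
        using sets sets_N by (auto intro!: suminf_emeasure)
      then show "(\<Sum>i. emeasure M1 (A i) + emeasure M2 (A i)) = emeasure M1 (\<Union>(range A)) + emeasure M2 (\<Union>(range A))"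
        by (simp add: suminf_add[symmetric])
    qed
    show "S \<in> sets N" using S sets_N by simp
  qed auto
  have nn: "(\<integral>\<^sup>+x. f x \<partial>N) = (\<integral>\<^sup>+x. f x \<partial>M1) + (\<integral>\<^sup>+x. f x \<partial>M2)" if "f \<in> borel_measurable borel" for f
    using that
  proof (induction rule: borel_measurable_induct)
    case (cong f g)
    then have "f = g" by auto
    with cong show ?case by simp
  next
    case (set A)
    then show ?case using em sets sets_N by simp
  next
    case (mult u c)
    then show ?case by (simp add: nn_integral_cmult distrib_left)
  next
    case (add u v)
    then show ?case by (simp add: nn_integral_add ac_simps)
  next
    case (seq U)
    have sup: "(\<integral>\<^sup>+x. (SUP i. U i) x \<partial>K) = (SUP i. \<integral>\<^sup>+x. U i x \<partial>K)" if "sets K = sets borel" for K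
      unfolding SUP_apply using seq that
      by (intro nn_integral_monotone_convergence_SUP) (auto simp: measurable_cong_sets[OF that refl])
    have mono: "incseq (\<lambda>i. \<integral>\<^sup>+x. U i x \<partial>K)" for K :: "real measure"
      using seq by (auto intro!: nn_integral_mono simp: incseq_def le_fun_def)
    show ?case
      unfolding sup[OF sets_N] sup[OF sets(1)] sup[OF sets(2)] using seq
      by (simp add: ennreal_SUP_add[OF mono mono])
  qed
  show ?thesis using that[OF sets_N em nn] by blast
qed

section \<open>Real forms of the recurrences and existence of the measures\<close>

locale positive_perturbed_chebyshev = perturbed_chebyshev +
  assumes t_pos: "\<forall>n\<ge>1. t n \<in> \<real> \<and> 0 < Re (t n)"
begin

lemmas m2 = m

definition "\<tau> n = Re (t n)"

lemma t_eq_\<tau>: "t n = of_real (\<tau> n)"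
  using t_pos[rule_format, of n] t0 by (cases "n = 0") (auto simp: \<tau>_def)

lemma \<tau>_pos: "n \<ge> 1 \<Longrightarrow> 0 < \<tau> n" and \<tau>_0: "\<tau> 0 = 0"
  using t_pos t0 by (auto simp: \<tau>_def)

lemma \<tau>_nonneg: "0 \<le> \<tau> n"
  using \<tau>_pos[of n] \<tau>_0 by (cases "n = 0") auto

lemma \<tau>_half: "\<tau> (2*m*n) + \<tau> (2*m*n + 1) = 1/2" "\<tau> (2*m*n + m) + \<tau> (2*m*n + m + 1) = 1/2"
  using arg_cong[OF conjunct1[OF t_half[rule_format, of n]], of Re]
    arg_cong[OF conjunct2[OF t_half[rule_format, of n]], of Re] by (simp_all add: \<tau>_def)

text \<open>Every value is either 1/4 or a member of a pair of nonnegative numbers with sum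
  1/2.\<close>

lemma \<tau>_le: "\<tau> n \<le> 1/2"
proof -
  define k j where "k = n div (2*m)" and "j = n mod (2*m)"
  have n: "n = 2*m*k + j" by (simp add: k_def j_def)
  have j: "j < 2*m" using m by (simp add: j_def)
  note nn = \<tau>_nonneg[of "2*m*k"] \<tau>_nonneg[of "2*m*k + 1"] \<tau>_nonneg[of "2*m*k + m"] \<tau>_nonneg[of "2*m*k + m + 1"]
  consider "j = 0" | "j = 1" | "j = m" | "j = m + 1" | "j \<in> {0..2*m - 1} - {0, 1, m, m + 1}"
    using j by fastforce
  then show ?thesis
  proof cases
    case 5
    then have "t n = 1/4" using t_quarter n by simp
    then show ?thesis by (simp only: \<tau>_def) simp
  qed (use n nn \<tau>_half[of k] in \<open>simp_all add: add.assoc\<close>)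
qed

text \<open>The factor 2^(4-2m) in r_n. Since 2^(1-2m) = \<open>e\<close> / 8, the term -1/8 in r_n
  is precisely the shift by -2^(1-2m).\<close>

definition "e = (1/4 :: real) ^ (m - 2)"
text \<open>The recurrence coefficients of \<open>Q\<close>, shifted by \<open>2\<^bsup>1-2m\<^esup>\<close>, factor as \<open>f\<^sub>n + g\<^bsub>n+1\<^esub>\<close> and \<open>f\<^sub>n g\<^sub>n\<close>.\<close>

definition "f n = e * \<tau> (2*m*n + m) * \<tau> (2*m*n + 1)"
definition "g n = e * \<tau> (2*m*(n - 1) + m + 1) * \<tau> (2*m*n)"
definition "rr n = f n + g (n + 1) - e / 8"
definition "ss n = f n * g n"

lemma e_bounds: "0 < e" "e \<le> 1"
  by (auto simp: e_def power_le_one)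

lemma power_eq_e: "(2::complex) ^ (2*m - 4) = 1 / of_real e" "(4::complex) ^ (2*m - 4) = 1 / of_real (e\<^sup>2)"
proof -
  have "2*m - 4 = 2 * (m - 2)" by simp
  then show "(2::complex) ^ (2*m - 4) = 1 / of_real e" "(4::complex) ^ (2*m - 4) = 1 / of_real (e\<^sup>2)"
    by (simp_all add: e_def power_mult power_one_over power2_eq_square flip: power_mult_distrib)
qed

lemma r_coeff_of_real: "r_coeff m t n = of_real (rr n)"
  unfolding r_coeff_def power_eq_e by (simp add: t_eq_\<tau> rr_def f_def g_def algebra_simps)

lemma s_coeff_of_real: "s_coeff m t n = of_real (ss n)"
  unfolding s_coeff_def power_eq_e by (simp add: t_eq_\<tau> ss_def f_def g_def power2_eq_square algebra_simps)

lemma g_coeff_of_real: "g_coeff n = of_real (g n)"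
  by (simp add: g_coeff_def t_eq_\<tau> g_def e_def)

lemma product_bounds: "0 \<le> e * \<tau> i * \<tau> j" "e * \<tau> i * \<tau> j \<le> 1/4"
proof -
  show "0 \<le> e * \<tau> i * \<tau> j" using e_bounds \<tau>_nonneg by simp
  have "e * \<tau> i \<le> 1 * (1/2)" using e_bounds \<tau>_nonneg \<tau>_le by (intro mult_mono) auto
  then have "e * \<tau> i * \<tau> j \<le> 1/2 * (1/2)" using e_bounds \<tau>_nonneg \<tau>_le by (intro mult_mono) auto
  then show "e * \<tau> i * \<tau> j \<le> 1/4" by simp
qed

lemma f_bounds: "0 \<le> f n" "f n \<le> 1/4" and g_bounds: "0 \<le> g n" "g n \<le> 1/4"
  unfolding f_def g_def by (rule product_bounds)+

sublocale P: bounded_recurrence "\<lambda>_. 0" \<tau> 0 "1/2"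
  using \<tau>_pos \<tau>_le by unfold_locales auto

sublocale Q: bounded_recurrence rr ss 1 1
proof
  show "\<bar>rr n\<bar> \<le> 1" for n
    using f_bounds[of n] g_bounds[of "n + 1"] e_bounds by (simp add: rr_def abs_le_iff)
  show "ss n \<le> 1" for n
    using mult_mono[of "f n" "1/4" "g n" "1/4"] f_bounds[of n] g_bounds[of n] by (simp add: ss_def)
  show "0 < ss n" if "n \<ge> 1" for n
    using that e_bounds m unfolding ss_def f_def g_def by (intro mult_pos_pos \<tau>_pos) auto
qed

abbreviation "PR \<equiv> monic_op (\<lambda>_. 0) \<tau>"
abbreviation "QR \<equiv> monic_op rr ss"

lemma P_of_real: "poly (P n) (of_real x) = of_real (poly (PR n) x)"
  by (rule monic_op_of_real) (simp_all add: t_eq_\<tau>)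

lemma Q_of_real: "poly (Q n) (of_real x) = of_real (poly (QR n) x)"
  by (rule monic_op_of_real) (simp_all add: r_coeff_of_real s_coeff_of_real)

abbreviation "T2R \<equiv> monT (2 * int m) :: real poly"

lemma T2_of_real: "poly (monT (2 * int m)) (of_real x :: complex) = of_real (poly T2R x)"
  using monT_of_real[of "2 * m" x] by simp

definition "G n = (if n = 0 then 1 else QR n + smult (g n) (QR (n - 1)))"

lemma PR_eqI: "(\<And>x::real. of_real (poly (PR n) x) = (of_real (poly p x) :: complex)) \<Longrightarrow> PR n = p"
  by (simp add: poly_eq_poly_eq_iff[symmetric] fun_eq_iff)

lemma PR_init: "j \<le> m \<Longrightarrow> PR j = monT (int j)"
  by (rule PR_eqI) (simp only: P_of_real[symmetric] P_init monT_of_real)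

lemma PR_at_m: "PR (2*m*n + m) = monT (int m) * (QR n \<circ>\<^sub>p T2R)"
  by (rule PR_eqI) (simp only: P_of_real[symmetric] P_at_m poly_mult poly_pcompose monT_of_real T2_of_real Q_of_real of_real_mult)

lemma PR_at_0: "PR (2*m*n) = G n \<circ>\<^sub>p T2R"
proof (cases "n = 0")
  case False
  then have "n \<ge> 1" by simp
  show ?thesis
    by (rule PR_eqI) (use False in \<open>simp only: P_of_real[symmetric] P_at_0[OF \<open>n \<ge> 1\<close>] poly_mult poly_pcompose T2_of_real Q_of_real
      of_real_mult G_def if_False poly_add poly_smult g_coeff_of_real of_real_add\<close>)
qed (simp add: G_def pcompose_1)

lemma exists_measures: "(\<exists>\<mu>. orthogonal_wrt \<mu> P) \<and> (\<exists>\<mu>. orthogonal_wrt \<mu> Q)"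
  by (intro conjI P.exists_orthogonality_measure Q.exists_orthogonality_measure)
     (simp_all add: t_eq_\<tau> r_coeff_of_real s_coeff_of_real)

end

lemma orthogonal_wrt_real:
  assumes "orthogonal_wrt \<mu> p'" and p: "\<And>n x. poly (p' n) (of_real x) = of_real (poly (p n) x)"
  shows "sets \<mu> = sets borel" "\<And>q. integrable \<mu> (poly q)"
    "\<And>n k. n \<noteq> k \<Longrightarrow> (LINT x|\<mu>. poly (p n) x * poly (p k) x) = 0"
    "emeasure \<mu> UNIV \<noteq> \<infinity>" "0 < measure \<mu> UNIV"
proof -
  show sets: "sets \<mu> = sets borel" using assms by (simp add: orthogonal_wrt_def)
  show int: "integrable \<mu> (poly q)" for q
    using assms by (intro integrable_poly) (simp add: orthogonal_wrt_def)
  have space: "space \<mu> = UNIV" using sets_eq_imp_space_eq[OF sets] by simp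
  show "(LINT x|\<mu>. poly (p n) x * poly (p k) x) = 0" if "n \<noteq> k" for n k
  proof -
    have "(LINT x|\<mu>. complex_of_real (poly (p n) x * poly (p k) x)) = 0"
      using assms that by (simp add: orthogonal_wrt_def)
    then show ?thesis by (simp only: integral_complex_of_real of_real_eq_0_iff)
  qed
  have "poly 1 = (\<lambda>x. 1 :: real)" by auto
  then have "integrable \<mu> (\<lambda>x. 1 :: real)" using int[of 1] by simp
  then show fin: "emeasure \<mu> UNIV \<noteq> \<infinity>" by (simp add: integrable_iff_bounded space)
  have "emeasure \<mu> UNIV \<noteq> 0"
  proof
    assume "emeasure \<mu> UNIV = 0"
    then have "emeasure \<mu> V = 0" if "open V" for V
      using that sets emeasure_mono[of V UNIV \<mu>] by auto
    then have "msupport \<mu> = {}" by (auto simp: msupport_def)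
    then show False using assms by (simp add: orthogonal_wrt_def)
  qed
  then show "0 < measure \<mu> UNIV"
    using fin by (simp add: measure_def enn2real_positive_iff zero_less_iff_neq_zero top.not_eq_extremum)
qed

section \<open>The functional of the claimed measure\<close>

locale chebyshev_measures = positive_perturbed_chebyshev +
  fixes \<mu>P \<mu>Q :: "real measure" and W :: "real \<Rightarrow> real" and \<alpha> :: real
  assumes orthP: "orthogonal_wrt \<mu>P P" and orthQ: "orthogonal_wrt \<mu>Q Q"
    and \<mu>Q: "\<mu>Q = density lborel (\<lambda>y. ennreal (W y))"
    and arc: "arc_weight m W \<alpha>"
begin

sublocale arc_weight m W \<alpha> by (rule arc)

definition "p0 = measure \<mu>P UNIV"
definition "q0 = measure \<mu>Q UNIV"
definition "C = (LINT y|lborel. W y / (y + \<alpha>))"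
text \<open>The total mass C + m M of the claimed measure, that is
  \<open>\<Lambda> 1\<close>.\<close>

definition "\<kappa>0 = 2 ^ (2*m - 3) / \<tau> m * q0"
definition "M = 1 / real m * (\<kappa>0 - C)"
definition "z j = cos ((2 * real j - 1) * pi / (2 * real m))"
definition "\<Lambda> p = (LINT x|\<nu>. poly p x) + M * (\<Sum>j=1..m. poly p (z j))"

lemmas P_facts = orthogonal_wrt_real[OF orthP P_of_real]
lemmas Q_facts = orthogonal_wrt_real[OF orthQ Q_of_real]

lemma m_pos: "real m > 0" using m by simp

lemma p0_pos: "p0 > 0" and q0_pos: "q0 > 0"
  using P_facts(5) Q_facts(5) by (simp_all add: p0_def q0_def)

lemma \<kappa>0_pos: "\<kappa>0 > 0"
  using \<tau>_pos[of m] m_pos q0_pos by (simp add: \<kappa>0_def)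

lemma \<alpha>_eq_e: "\<alpha> = e / 8"
proof -
  have "\<alpha> = 2 * 2 powi (- int (2 * m))" using power_int_add[of "2::real" 1 "- int (2 * m)"] by (simp add: \<alpha>)
  also have "2 powi (- int (2 * m)) = (1/4 :: real) ^ m"
    by (simp only: power_int_minus power_int_of_nat) (simp add: power_mult power_one_over inverse_eq_divide)
  also have "(1/4 :: real) ^ m = e / 16"
  proof -
    have "m = Suc (Suc (m - 2))" using m2 by simp
    then have "(1/4 :: real) ^ m = (1/4) ^ Suc (Suc (m - 2))" by simp
    then show ?thesis by (simp add: e_def)
  qed
  finally show ?thesis by simp
qed

lemma \<Lambda>_add: "\<Lambda> (p + q) = \<Lambda> p + \<Lambda> q"
  unfolding \<Lambda>_def poly_add
  by (subst Bochner_Integration.integral_add) (auto simp: integrable_\<nu> sum.distrib algebra_simps)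

lemma \<Lambda>_smult: "\<Lambda> (smult a p) = a * \<Lambda> p"
  unfolding \<Lambda>_def poly_smult by (simp add: sum_distrib_left[symmetric] algebra_simps)

lemma T2_z: "poly T2R (z j) = - \<alpha>"
proof -
  have "2 * real m * ((2 * real j - 1) * pi / (2 * real m)) = - pi + of_int (int j) * (2 * pi)"
    using m_pos by (simp add: field_simps)
  then have "cos (2 * real m * ((2 * real j - 1) * pi / (2 * real m))) = - 1"
    using cos_add[of "- pi" "of_int (int j) * (2 * pi)"] cos_int_2pin[of "int j"] sin_int_2pin[of "int j"] by (simp add: mult_ac)
  then show ?thesis unfolding z_def T2_cos by simp
qed

lemma sum_chebT_z:
  assumes "1 \<le> k" "k < 2*m"
  shows "(\<Sum>j=1..m. poly (chebT (int k)) (z j)) = 0"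
proof -
  have "(\<Sum>j=1..m. poly (chebT (int k)) (z j)) = (\<Sum>j=1..m. cos (real k * ((2 * real j - 1) * pi / (2 * real m))))"
    by (simp add: z_def chebT_cos)
  also have "\<dots> = (\<Sum>i<m. cos (real k * ((2 * real i + 1) * pi / (2 * real m))))"
    by (rule sum.reindex_bij_witness[of _ Suc "\<lambda>j. j - 1"]) (auto simp: of_nat_diff)
  also have "\<dots> = 0" by (rule sum_cos_odd_multiples[OF assms])
  finally show ?thesis .
qed

lemma \<Lambda>_chebT:
  assumes "1 \<le> k" "k < 2*m"
  shows "\<Lambda> (chebT (int k) * (H \<circ>\<^sub>p T2R)) = 0"
proof -
  have "(\<Sum>j=1..m. poly (chebT (int k) * (H \<circ>\<^sub>p T2R)) (z j)) = (\<Sum>j=1..m. poly (chebT (int k)) (z j)) * poly H (- \<alpha>)"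
    by (simp add: poly_pcompose T2_z sum_distrib_right)
  then show ?thesis
    unfolding \<Lambda>_def integral_\<nu>_chebT[OF assms] sum_chebT_z[OF assms] by simp
qed

lemma \<Lambda>_pcompose: "\<Lambda> (H \<circ>\<^sub>p T2R) = (LINT y|lborel. poly H y * (W y / (y + \<alpha>))) + (\<kappa>0 - C) * poly H (- \<alpha>)"
  unfolding \<Lambda>_def integral_\<nu>_pcompose(2) M_def using m_pos by (simp add: poly_pcompose T2_z)

lemma \<Lambda>_1: "\<Lambda> 1 = \<kappa>0"
  using \<Lambda>_pcompose[of 1] by (simp add: C_def pcompose_1)

text \<open>The factor y + \<alpha> cancels the denominator and kills the mass at -\<alpha>, leaving
  the integral of Q_n against mu_Q. At y = -\<alpha> the cancellation is harmless because
  \<open>W\<close> vanishes there.\<close>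

lemma \<Lambda>_shift: "\<Lambda> (([:\<alpha>, 1:] * QR n) \<circ>\<^sub>p T2R) = (if n = 0 then q0 else 0)"
proof -
  have "(LINT y|lborel. poly ([:\<alpha>, 1:] * QR n) y * (W y / (y + \<alpha>))) = (LINT y|lborel. W y * poly (QR n) y)"
  proof (rule Bochner_Integration.integral_cong[OF refl])
    fix y
    show "poly ([:\<alpha>, 1:] * QR n) y * (W y / (y + \<alpha>)) = W y * poly (QR n) y"
      using W_supp[of y] by (cases "y + \<alpha> = 0") (auto simp: field_simps)
  qed
  also have "\<dots> = (LINT y|\<mu>Q. poly (QR n) y)"
    unfolding \<mu>Q using W_nonneg by (subst integral_density) auto
  also have "\<dots> = (if n = 0 then q0 else 0)"
    using Q_facts(3)[of n 0] sets_eq_imp_space_eq[OF Q_facts(1)] by (auto simp: q0_def)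
  finally show ?thesis unfolding \<Lambda>_pcompose by simp
qed

lemma rr_shift: "- \<alpha> - rr n = - (f n + g (n + 1))"
  by (simp add: rr_def \<alpha>_eq_e)

text \<open>Write y - r_n = (y + \<alpha>) - (f_n + g_{n+1}). For n >= 1 the first part contributes
  nothing, and by the induction hypothesis - f_n \<Lambda>(Q_n) cancels the term - f_n g_n
  \<Lambda>(Q_{n-1}) coming from s_n, so only - g_{n+1} \<Lambda>(Q_n) remains. For n = 0 the same
  cancellation needs f_0 \<Lambda>(1) = mu_Q(R).\<close>

lemma \<Lambda>_Q_Suc: "\<Lambda> (QR (n + 1) \<circ>\<^sub>p T2R) = - g (n + 1) * \<Lambda> (QR n \<circ>\<^sub>p T2R)"
proof (induction n)
  case 0
  have "QR 1 = [:\<alpha>, 1:] * QR 0 + smult (- \<alpha> - rr 0) (QR 0)" by simp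
  then have "\<Lambda> (QR 1 \<circ>\<^sub>p T2R) = q0 + (- \<alpha> - rr 0) * \<kappa>0"
    using \<Lambda>_shift[of 0] \<Lambda>_1 by (simp only: pcompose_add pcompose_smult \<Lambda>_add \<Lambda>_smult) (simp add: pcompose_1)
  also have "\<dots> = q0 - f 0 * \<kappa>0 - g 1 * \<kappa>0" unfolding rr_shift by (simp add: algebra_simps)
  \<comment> \<open>This fixes the constant 2^(2m-3) / t_m in M: t_m cancels, and e 2^(2m-3) t_1 = 2
    * 1/2 = 1.\<close>
  also have "f 0 * \<kappa>0 = q0"
  proof -
    have "\<tau> 1 = 1/2" using \<tau>_half(1)[of 0] \<tau>_0 by simp
    moreover have "e * 2 ^ (2*m - 3) = 2"
    proof -
      have "2*m - 3 = Suc (2 * (m - 2))" using m2 by simp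
      then have "(2::real) ^ (2*m - 3) = 2 * 4 ^ (m - 2)" by (simp add: power_mult)
      then show ?thesis by (simp add: e_def power_one_over)
    qed
    moreover have "f 0 * \<kappa>0 = (e * 2 ^ (2*m - 3)) * \<tau> 1 * q0"
      using \<tau>_pos[of m] m by (simp add: f_def \<kappa>0_def)
    ultimately show ?thesis by simp
  qed
  finally show ?case using \<Lambda>_1 by (simp add: pcompose_1)
next
  case (Suc n)
  have "QR (n + 2) = [:\<alpha>, 1:] * QR (n + 1) + smult (- \<alpha> - rr (n + 1)) (QR (n + 1)) - smult (ss (n + 1)) (QR n)"
    by (simp add: poly_eq_poly_eq_iff[symmetric] fun_eq_iff algebra_simps)
  also have "\<dots> = [:\<alpha>, 1:] * QR (n + 1) + (smult (- \<alpha> - rr (n + 1)) (QR (n + 1)) + smult (- ss (n + 1)) (QR n))"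
    by simp
  finally have "\<Lambda> (QR (n + 2) \<circ>\<^sub>p T2R) = (- \<alpha> - rr (n + 1)) * \<Lambda> (QR (n + 1) \<circ>\<^sub>p T2R) - ss (n + 1) * \<Lambda> (QR n \<circ>\<^sub>p T2R)"
    using \<Lambda>_shift[of "n + 1"] by (simp only: pcompose_add pcompose_smult \<Lambda>_add \<Lambda>_smult) simp
  also have "\<dots> = - g (n + 2) * \<Lambda> (QR (n + 1) \<circ>\<^sub>p T2R)"
    unfolding rr_shift ss_def Suc by (simp add: algebra_simps)
  finally show ?case by (simp only: add_Suc add_Suc_right add_2_eq_Suc' Suc_eq_plus1[symmetric])
qed

lemma \<Lambda>_G: "n \<ge> 1 \<Longrightarrow> \<Lambda> (G n \<circ>\<^sub>p T2R) = 0"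
  using \<Lambda>_Q_Suc[of "n - 1"] by (simp add: G_def pcompose_add pcompose_smult \<Lambda>_add \<Lambda>_smult)

lemma PR_orth:
  assumes "degree q < n"
  shows "(LINT x|\<mu>P. poly (PR n) x * poly q x) = 0"
proof (rule orthogonal_to_lower_degree[where p = PR, OF _ _ _ assms])
  show "integrable \<mu>P (\<lambda>x. x ^ k)" for k :: nat using orthP by (simp add: orthogonal_wrt_def)
  show "degree (PR k) = k \<and> PR k \<noteq> 0" for k
    using monic_op_degree[of "\<lambda>_. 0" \<tau> k] monic_op_nonzero[of "\<lambda>_. 0" \<tau> k] by simp
  show "(LINT x|\<mu>P. poly (PR i) x * poly (PR k) x) = 0" if "i \<noteq> k" for i k
    using that by (rule P_facts(3))
qed

text \<open>Both functionals agree up to the ratio of their total masses. The difference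
  \<open>D\<close> is cross-multiplied so that it vanishes at 1, and every other basis element is
  annihilated by both sides.\<close>

lemma integral_\<mu>P: "\<kappa>0 * (LINT x|\<mu>P. poly p x) = p0 * \<Lambda> p"
proof -
  define D where "D p = \<kappa>0 * (LINT x|\<mu>P. poly p x) - p0 * \<Lambda> p" for p
  have "D p = 0"
  proof (rule poly_functional_eq_0)
    show "D (p + q) = D p + D q" for p q
      unfolding D_def poly_add \<Lambda>_add
      by (subst Bochner_Integration.integral_add) (auto simp: P_facts(2) algebra_simps)
    show "D (smult a p) = a * D p" for a p
      unfolding D_def poly_smult \<Lambda>_smult by (simp add: algebra_simps)
    show "degree p < Suc (degree p)" by simp
    fix d
    define n j where "n = d div (2*m)" and "j = d mod (2*m)"
    have d: "d = 2*m*n + j" by (simp add: n_def j_def)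
    have j: "j < 2*m" using m by (simp add: j_def)
    have PR_deg: "degree (PR k) = k" "PR k \<noteq> 0" for k
      using monic_op_degree[of "\<lambda>_. 0" \<tau>] monic_op_nonzero[of "\<lambda>_. 0" \<tau>] by auto
    have T_deg: "degree (chebT (int k) :: real poly) = k" "(chebT (int k) :: real poly) \<noteq> 0" for k
      using chebT_degree[of k] by auto
    have \<Lambda>_PR: "\<Lambda> (PR (2*m*n)) = (if n = 0 then \<kappa>0 else 0)" for n
      unfolding PR_at_0 using \<Lambda>_G[of n] \<Lambda>_1 by (simp add: G_def pcompose_1)
    consider "j = 0" "n = 0" | "j = 0" "n \<ge> 1" | "1 \<le> j" "j \<le> m" | "m < j" by linarith
    then show "\<exists>e. degree e = d \<and> e \<noteq> 0 \<and> D e = 0"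
    proof cases
      case 1
      have "(LINT x|\<mu>P. 1) = p0" using sets_eq_imp_space_eq[OF P_facts(1)] by (simp add: p0_def)
      then have "D 1 = 0" by (simp add: D_def \<Lambda>_1)
      then show ?thesis using 1 d by (intro exI[of _ 1]) simp
    next
      case 2
      then have "2*m*n \<noteq> 0" using m by simp
      then have "D (PR (2*m*n)) = 0" using P_facts(3)[of "2*m*n" 0] \<Lambda>_PR[of n] 2 by (simp add: D_def)
      then show ?thesis using 2 d PR_deg by (intro exI[of _ "PR (2*m*n)"]) simp
    next
      case 3
      \<comment> \<open>For n = 0 the factor P_0 gives no orthogonality; there T_j is a multiple of
        P_j because j <= m. For n >= 1 the degree j lies below 2mn.\<close>
      have "(LINT x|\<mu>P. poly (PR (2*m*n) * chebT (int j)) x) = 0"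
      proof (cases "n = 0")
        case True
        obtain c where c: "c \<noteq> 0" "(monT (int j) :: real poly) = smult c (chebT (int j))"
          using monT_eq_smult_chebT by blast
        have "0 = (LINT x|\<mu>P. poly (PR j) x * poly (PR 0) x)" using P_facts(3)[of j 0] 3 by simp
        also have "\<dots> = c * (LINT x|\<mu>P. poly (chebT (int j)) x)"
          unfolding PR_init[OF 3(2)] c(2) by simp
        finally show ?thesis using c True by simp
      next
        case False
        then have "j < 2*m*n" using 3 j by (cases n) auto
        then show ?thesis using PR_orth[of "chebT (int j)" "2*m*n"] T_deg by simp
      qed
      moreover have "\<Lambda> (PR (2*m*n) * chebT (int j)) = 0"
        using \<Lambda>_chebT[of j "G n"] 3 j unfolding PR_at_0 by (simp add: mult.commute)
      ultimately have "D (PR (2*m*n) * chebT (int j)) = 0" by (simp only: D_def)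
      then show ?thesis using d PR_deg[of "2*m*n"] T_deg[of j]
        by (intro exI[of _ "PR (2*m*n) * chebT (int j)"]) (simp add: degree_mult_eq)
    next
      case 4
      \<comment> \<open>For n = 0 and j > m, orthogonality says nothing directly about T_j. T_m T_k
        is used instead: it is a multiple of P_m T_k with k < m, and it splits into T_{m+k} and
        T_{m-k}, whose indices lie between 1 and 2m - 1.\<close>
      define k where "k = j - m"
      have k: "1 \<le> k" "k < m" "j = m + k" using 4 j by (auto simp: k_def)
      have "(LINT x|\<mu>P. poly (PR (2*m*n + m) * chebT (int k)) x) = 0"
        using PR_orth[of "chebT (int k)" "2*m*n + m"] T_deg k by simp
      moreover have "\<Lambda> (PR (2*m*n + m) * chebT (int k)) = 0"
      proof -
        obtain c where c: "(monT (int m) :: real poly) = smult c (chebT (int m))"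
          using monT_eq_smult_chebT by blast
        have "PR (2*m*n + m) * chebT (int k) = smult c ((chebT (int m) * chebT (int k)) * (QR n \<circ>\<^sub>p T2R))"
          unfolding PR_at_m c by (simp add: mult_ac)
        also have "\<dots> = smult (c / 2) (chebT (int (m + k)) * (QR n \<circ>\<^sub>p T2R) + chebT (int (m - k)) * (QR n \<circ>\<^sub>p T2R))"
          using k by (subst chebT_mult) (auto simp: distrib_right)
        finally show ?thesis
          using \<Lambda>_chebT[of "m + k" "QR n"] \<Lambda>_chebT[of "m - k" "QR n"] k by (simp only: \<Lambda>_smult \<Lambda>_add) simp
      qed
      ultimately have "D (PR (2*m*n + m) * chebT (int k)) = 0" by (simp only: D_def)
      then show ?thesis using d k PR_deg[of "2*m*n + m"] T_deg[of k]
        by (intro exI[of _ "PR (2*m*n + m) * chebT (int k)"]) (simp add: degree_mult_eq)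
    qed
  qed
  then show ?thesis by (simp add: D_def)
qed

section \<open>Sign of the mass and identification of mu_P\<close>

lemma M_nonneg: "0 \<le> M"
proof -
  \<comment> \<open>Even powers of \<open>L\<close> peak at the point mass \<open>-\<alpha>\<close> and vanish in the limit elsewhere.\<close>
  define L where "L = [:1/2, - 1 / (2 * \<alpha>):]"
  have L: "poly L y = (\<alpha> - y) / (2 * \<alpha>)" for y
    using \<alpha>_pos by (simp add: L_def field_simps)
  have "0 \<le> (LINT y|lborel. poly (L ^ (2 * k)) y * (W y / (y + \<alpha>))) + (\<kappa>0 - C)" for k
  proof -
    have "0 \<le> (LINT x|\<mu>P. poly ((L ^ (2 * k)) \<circ>\<^sub>p T2R) x)"
      by (rule Bochner_Integration.integral_nonneg) (simp add: poly_pcompose poly_power zero_le_even_power)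
    then have "0 \<le> p0 * \<Lambda> ((L ^ (2 * k)) \<circ>\<^sub>p T2R)"
      using integral_\<mu>P \<kappa>0_pos by (metis mult_nonneg_nonneg less_imp_le)
    then have "0 \<le> \<Lambda> ((L ^ (2 * k)) \<circ>\<^sub>p T2R)" using p0_pos by (simp add: zero_le_mult_iff)
    moreover have "poly (L ^ (2 * k)) (- \<alpha>) = 1" using \<alpha>_pos by (simp add: L poly_power)
    ultimately show ?thesis by (simp add: \<Lambda>_pcompose)
  qed
  moreover have "(\<lambda>k. LINT y|lborel. poly (L ^ (2 * k)) y * (W y / (y + \<alpha>))) \<longlonglongrightarrow> (LINT y|(lborel :: real measure). (0::real))"
  proof (rule integral_dominated_convergence[where w = "\<lambda>y. W y / (y + \<alpha>)"])
    show "AE y in lborel. (\<lambda>k. poly (L ^ (2 * k)) y * (W y / (y + \<alpha>))) \<longlonglongrightarrow> (0::real)"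
    proof (rule AE_I2)
      fix y
      show "(\<lambda>k. poly (L ^ (2 * k)) y * (W y / (y + \<alpha>))) \<longlonglongrightarrow> (0::real)"
      proof (cases "- \<alpha> < y \<and> y < \<alpha>")
        case True
        then have "0 \<le> poly L y" "poly L y < 1" using \<alpha>_pos by (auto simp: L field_simps)
        then have "(\<lambda>k. (poly L y ^ 2) ^ k) \<longlonglongrightarrow> 0" by (intro LIMSEQ_realpow_zero) (auto simp: power_less_one_iff)
        then show ?thesis by (intro tendsto_mult_left_zero) (simp add: poly_power power_mult)
      next
        case False
        then show ?thesis using W_supp[of y] by simp
      qed
    qed
    show "AE y in lborel. norm (poly (L ^ (2 * k)) y * (W y / (y + \<alpha>))) \<le> W y / (y + \<alpha>)" for k
    proof (rule AE_I2)
      fix y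
      show "norm (poly (L ^ (2 * k)) y * (W y / (y + \<alpha>))) \<le> W y / (y + \<alpha>)"
      proof (cases "- \<alpha> < y \<and> y < \<alpha>")
        case True
        then have "0 \<le> poly L y" "poly L y \<le> 1" using \<alpha>_pos by (auto simp: L field_simps)
        then have "0 \<le> poly (L ^ (2 * k)) y" "poly (L ^ (2 * k)) y \<le> 1" by (auto simp: poly_power power_le_one)
        then have "poly (L ^ (2 * k)) y * (W y / (y + \<alpha>)) \<in> {0..W y / (y + \<alpha>)}"
          unfolding atLeastAtMost_iff using weight_nonneg[of y] by (intro conjI mult_nonneg_nonneg mult_left_le_one_le) auto
        then show ?thesis by (simp only: atLeastAtMost_iff real_norm_def abs_of_nonneg)
      next
        case False
        then show ?thesis using W_supp[of y] by simp
      qed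
    qed
  qed (use W_int in auto)
  ultimately have "0 \<le> \<kappa>0 - C"
    using LIMSEQ_le_const[of _ "0 + (\<kappa>0 - C)" 0, OF tendsto_add[OF _ tendsto_const]] by simp
  then show ?thesis using m_pos by (simp add: M_def)
qed

text \<open>Both measures are scaled to total mass 1, where equal moments decide; undoing the
  scaling gives the factor \<open>p0 / \<kappa>0\<close>. Bounded support has to be checked only for
  the claimed measure, which lives on [-1, 1].\<close>

lemma emeasure_\<mu>P:
  assumes "S \<in> sets borel"
  shows "emeasure \<mu>P S = ennreal (p0 / \<kappa>0) * (emeasure \<nu> S + ennreal M * (\<Sum>j=1..m. indicator S (z j)))"
proof -
  define D where "D = distr (point_measure {1..m} (\<lambda>_. ennreal M)) borel z"
  have sets_D [measurable_cong, simp]: "sets D = sets borel" by (simp add: D_def)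
  have D_em: "emeasure D A = ennreal M * (\<Sum>j=1..m. indicator A (z j))" if [measurable]: "A \<in> sets borel" for A
  proof -
    have "emeasure D A = emeasure (point_measure {1..m} (\<lambda>_. ennreal M)) (z -` A \<inter> {1..m})"
      unfolding D_def by (subst emeasure_distr) (auto simp: measurable_point_measure_eq1 space_point_measure)
    also have "\<dots> = (\<Sum>j\<in>z -` A \<inter> {1..m}. ennreal M)"
      by (subst emeasure_point_measure_finite) auto
    also have "\<dots> = (\<Sum>j=1..m. ennreal M * indicator A (z j))"
      by (rule sum.mono_neutral_cong_left) (auto simp: indicator_def)
    finally show ?thesis by (simp only: sum_distrib_left)
  qed
  have D_int: "(LINT x|D. poly p x) = M * (\<Sum>j=1..m. poly p (z j))" for p
  proof -
    have "(LINT x|D. poly p x) = (LINT j|point_measure {1..m} (\<lambda>_. ennreal M). poly p (z j))"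
      unfolding D_def by (rule integral_distr) (auto simp: measurable_point_measure_eq1)
    also have "\<dots> = (\<Sum>j=1..m. M *\<^sub>R poly p (z j))"
      using M_nonneg by (intro lebesgue_integral_point_measure_finite) auto
    finally show ?thesis by (simp add: sum_distrib_left)
  qed
  have D_integrable: "integrable D (poly p)" for p
    unfolding D_def by (subst integrable_distr_eq) (auto simp: measurable_point_measure_eq1 integrable_point_measure_finite)
  obtain N where sets_N [measurable_cong, simp]: "sets N = sets borel"
    and em_N: "\<And>S. S \<in> sets borel \<Longrightarrow> emeasure N S = emeasure \<nu> S + emeasure D S"
    and nn_N: "\<And>f. f \<in> borel_measurable borel \<Longrightarrow> (\<integral>\<^sup>+x. f x \<partial>N) = (\<integral>\<^sup>+x. f x \<partial>\<nu>) + (\<integral>\<^sup>+x. f x \<partial>D)"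
    using sum_of_measures[of \<nu> D] by auto
  have space_N: "space N = UNIV" using sets_eq_imp_space_eq[OF sets_N] by simp
  \<comment> \<open>The sum over \<open>bool\<close> presents the two parts as a family of measures
    with identity maps, so that \<open>lebesgue_integral_of_nn_images\<close> applies.\<close>
  have nn: "(\<integral>\<^sup>+x. ennreal (f x) \<partial>N) = (\<Sum>b\<in>UNIV. \<integral>\<^sup>+x. ennreal (f x) \<partial>(if b then \<nu> else D))"
    if "f \<in> borel_measurable N" "\<And>x. 0 \<le> f x" for f :: "real \<Rightarrow> real"
  proof -
    have "f \<in> borel_measurable borel" using that(1) by simp
    then show ?thesis by (subst nn_N) (simp_all add: UNIV_bool add.commute)
  qed
  have N_integrable: "integrable N (poly p)" for p
    by (rule lebesgue_integral_of_nn_images(1)[OF nn]) (auto simp: integrable_\<nu> D_integrable)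
  have N_int: "(LINT x|N. poly p x) = \<Lambda> p" for p
  proof -
    have "(LINT x|N. poly p x) = (\<Sum>b\<in>UNIV. LINT x|(if b then \<nu> else D). poly p x)"
      by (rule lebesgue_integral_of_nn_images(2)[OF nn]) (auto simp: integrable_\<nu> D_integrable)
    then show ?thesis by (simp add: UNIV_bool \<Lambda>_def D_int)
  qed
  define \<mu>' where "\<mu>' = density \<mu>P (\<lambda>_. ennreal (1 / p0))"
  define N' where "N' = density N (\<lambda>_. ennreal (1 / \<kappa>0))"
  note [measurable_cong] = P_facts(1)
  have space_P: "space \<mu>P = UNIV" using sets_eq_imp_space_eq[OF P_facts(1)] by simp
  have em_\<mu>': "emeasure \<mu>' A = ennreal (1 / p0) * emeasure \<mu>P A" if "A \<in> sets borel" for A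
    unfolding \<mu>'_def using that P_facts(1) by (subst emeasure_density) (auto simp: nn_integral_cmult_indicator)
  have em_N': "emeasure N' A = ennreal (1 / \<kappa>0) * emeasure N A" if "A \<in> sets borel" for A
    unfolding N'_def using that by (subst emeasure_density) (auto simp: nn_integral_cmult_indicator)
  have int_\<mu>': "integrable \<mu>' (poly p)" "(LINT x|\<mu>'. poly p x) = (LINT x|\<mu>P. poly p x) / p0" for p
    unfolding \<mu>'_def using p0_pos P_facts(2)[of p] by (simp_all add: integrable_density integral_density)
  have int_N': "integrable N' (poly p)" "(LINT x|N'. poly p x) = \<Lambda> p / \<kappa>0" for p
    unfolding N'_def using \<kappa>0_pos N_integrable[of p] by (simp_all add: integrable_density integral_density N_int)
  have prob: "real_distribution K" if sets: "sets K = sets borel" and int: "integrable K (poly 1)" "(LINT x|K. poly 1 x) = 1" for K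
  proof -
    have [simp]: "space K = UNIV" using sets_eq_imp_space_eq[OF sets] by simp
    have "emeasure K UNIV < \<infinity>" using int(1) by (simp add: integrable_iff_bounded)
    then have "emeasure K UNIV = 1" using int(2) by (simp add: emeasure_eq_ennreal_measure)
    then show ?thesis
      using sets by (intro real_distribution.intro prob_spaceI real_distribution_axioms.intro) auto
  qed
  have \<mu>_prob: "real_distribution \<mu>'"
    using int_\<mu>'[of 1] p0_pos space_P by (intro prob) (auto simp: \<mu>'_def P_facts(1) p0_def)
  have N_prob: "real_distribution N'"
    using int_N'[of 1] \<kappa>0_pos \<Lambda>_1 by (intro prob) (auto simp: N'_def)
  have "\<mu>' = N'"
  proof (rule real_distribution_eqI_moments[OF \<mu>_prob N_prob])
    have x: "poly ([:0, 1:] ^ k) = (\<lambda>x. x ^ k)" for k :: nat and x :: real by (auto simp: poly_power)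
    show "integrable \<mu>' (\<lambda>x. x ^ k)" for k :: nat
      using int_\<mu>'(1)[of "[:0, 1:] ^ k"] by (simp add: x)
    have ratio: "(LINT x|\<mu>P. poly p x) / p0 = \<Lambda> p / \<kappa>0" for p
      using integral_\<mu>P[of p] p0_pos \<kappa>0_pos by (simp add: frac_eq_eq mult.commute)
    show "(LINT x|\<mu>'. x ^ k) = (LINT x|N'. x ^ k)" for k :: nat
      using int_\<mu>'(2)[of "[:0, 1:] ^ k"] int_N'(2)[of "[:0, 1:] ^ k"] ratio[of "[:0, 1:] ^ k"] by (simp add: x)
    have "emeasure \<nu> {x. \<not> \<bar>x\<bar> \<le> 1} = 0"
      unfolding \<nu>_def by (subst emeasure_density) (auto simp: nn_integral_0_iff_AE indicator_def dens_supp)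
    moreover have "emeasure D {x. \<not> \<bar>x\<bar> \<le> 1} = 0"
      by (subst D_em) (auto simp: z_def indicator_def)
    ultimately have "emeasure N' {x. \<not> \<bar>x\<bar> \<le> 1} = 0"
      by (simp add: em_N' em_N)
    then show "AE x in N'. \<bar>x\<bar> \<le> 1"
      by (intro AE_I[where N = "{x. \<not> \<bar>x\<bar> \<le> 1}"]) (auto simp: N'_def)
  qed simp
  then have eq: "ennreal (1 / p0) * emeasure \<mu>P S = ennreal (1 / \<kappa>0) * emeasure N S"
    using em_\<mu>'[OF assms] em_N'[OF assms] by simp
  have "emeasure \<mu>P S = ennreal p0 * (ennreal (1 / p0) * emeasure \<mu>P S)"
    using p0_pos by (simp add: mult.assoc[symmetric] ennreal_mult'[symmetric])
  also have "\<dots> = ennreal (p0 / \<kappa>0) * emeasure N S"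
    unfolding eq using p0_pos \<kappa>0_pos by (simp add: mult.assoc[symmetric] ennreal_mult'[symmetric])
  finally show ?thesis using assms by (simp add: em_N D_em)
qed

end

section \<open>Assembly of both parts of the proposition\<close>

theorem proposition1p1:
  fixes m :: nat
    and t :: "nat \<Rightarrow> complex"
    and P Q :: "nat \<Rightarrow> complex poly"
  assumes m: "m \<ge> 2"
    and t0: "t 0 = 0"
    and t_nonzero: "\<forall>n\<ge>1. t n \<noteq> 0"
    and t_quarter: "\<forall>n. \<forall>j\<in>{0..2*m - 1} - {0, 1, m, m + 1}. t (2*m*n + j) = 1/4"
    and t_half: "\<forall>n. t (2*m*n) + t (2*m*n + 1) = 1/2 \<and> t (2*m*n + m) + t (2*m*n + m + 1) = 1/2"
    and P: "P = monic_op (\<lambda>_. 0) t"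
    and Q: "Q = monic_op (r_coeff m t) (s_coeff m t)"
  shows
    "(\<forall>j\<in>{0..m}. P j = monT (int j))
     \<and> (\<forall>n. \<forall>j\<in>{0..2*m - 1}. \<forall>x. poly (monU (int m - 1)) x \<noteq> 0 \<longrightarrow>
          poly (P (2*m*n + m + j + 1)) x =
            (poly (A_poly m t j n) x * poly (Q (n + 1)) (poly (monT (2 * int m)) x)
             + (\<Prod>i=1..j + 1. t (2*m*n + m + i)) *
                 poly (B_poly m t j n) x * poly (Q n) (poly (monT (2 * int m)) x))
            / poly (monU (int m - 1)) x)
     \<and> (\<forall>n. \<forall>j\<in>{0..m - 2} \<union> {2*m - 1}. \<forall>x. poly (monU (int m - 1)) x \<noteq> 0 \<longrightarrow>
          poly (P (2*m*n + m + j + 1)) x =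
            (poly (A_poly m t j n) x * poly (Q (n + 1)) (poly (monT (2 * int m)) x)
             + (1/4) ^ j * t (2*m*n + m + 1) *
                 poly (B_poly m t j n) x * poly (Q n) (poly (monT (2 * int m)) x))
            / poly (monU (int m - 1)) x)
     \<and> ((\<forall>n\<ge>1. t n \<in> \<real> \<and> 0 < Re (t n)) \<longrightarrow>
          (\<exists>\<mu>. orthogonal_wrt \<mu> P) \<and> (\<exists>\<mu>. orthogonal_wrt \<mu> Q)
          \<and> (\<forall>\<mu>P \<mu>Q (w :: real \<Rightarrow> real) \<xi> \<eta>.
               orthogonal_wrt \<mu>P P \<and> orthogonal_wrt \<mu>Q Q
               \<and> - (2 powi (1 - 2 * int m)) \<le> \<xi> \<and> \<xi> < \<eta> \<and> \<eta> \<le> 2 powi (1 - 2 * int m)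
               \<and> set_borel_measurable borel {\<xi><..<\<eta>} w \<and> (\<forall>y\<in>{\<xi><..<\<eta>}. 0 \<le> w y)
               \<and> \<mu>Q = density lborel (\<lambda>y. ennreal (w y) * indicator {\<xi><..<\<eta>} y)
               \<and> set_integrable lborel {\<xi><..<\<eta>} (\<lambda>y. w y / (y + 2 powi (1 - 2 * int m)))
               \<longrightarrow>
               (let C = (LINT y:{\<xi><..<\<eta>}|lborel. w y / (y + 2 powi (1 - 2 * int m)));
                    M = 1 / real m * (2 ^ (2*m - 3) * measure \<mu>Q UNIV / Re (t m) - C);
                    E = {x. poly (monT (2 * int m)) x \<in> {\<xi><..<\<eta>}};
                    wP = (\<lambda>x. \<bar>poly (chebU (int m - 1)) x / poly (chebT (int m)) x\<bar>
                                * w (poly (monT (2 * int m)) x))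
                in 0 \<le> M \<and>
                   (\<exists>c>0. \<forall>S\<in>sets borel.
                      emeasure \<mu>P S = ennreal c *
                        (emeasure (density lborel (\<lambda>x. ennreal (wP x) * indicator E x)) S
                         + ennreal M * (\<Sum>j=1..m. indicator S (cos ((2 * real j - 1) * pi / (2 * real m)))))))))"
proof -
  interpret perturbed_chebyshev m t
    using m t0 t_nonzero t_quarter t_half by unfold_locales
  have block: "poly (monic_op (\<lambda>_. 0) t (2*m*n + m + j + 1)) x =
     (poly (A_poly m t j n) x * poly (monic_op (r_coeff m t) (s_coeff m t) (n + 1)) (poly (monT (2 * int m)) x)
     + (\<Prod>i=1..j + 1. t (2*m*n + m + i)) * poly (B_poly m t j n) x
       * poly (monic_op (r_coeff m t) (s_coeff m t) n) (poly (monT (2 * int m)) x)) / poly (monU (int m - 1)) x"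
    if "j \<le> 2*m - 1" "poly (monU (int m - 1)) x \<noteq> 0" for n j x
    unfolding P_block[OF that(1), symmetric] using that(2) by (rule nonzero_mult_div_cancel_left[symmetric])
  show ?thesis
    unfolding P Q
  proof (intro conjI ballI allI impI, goal_cases)
    case (1 j)
    then show ?case by (intro P_init) simp
  next
    case (2 n j x)
    then show ?case by (intro block) auto
  next
    case (3 n j x)
    show ?case
    proof (cases "j = 2*m - 1")
      case True
      then show ?thesis using block[of j x n] 3 by (simp only: B_poly_last) simp
    next
      case False
      then have "j \<le> m - 2" using 3 by auto
      from block[of j x n, unfolded prod_quarter[OF this]] show ?thesis
        using 3 \<open>j \<le> m - 2\<close> by simp
    qed
  next
    case 4
    interpret positive_perturbed_chebyshev m t by unfold_locales fact
    show ?case using exists_measures by blast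
  next
    case 5
    interpret positive_perturbed_chebyshev m t by unfold_locales fact
    show ?case using exists_measures by blast
  next
    case (6 \<mu>P \<mu>Q w \<xi> \<eta>)
    interpret positive_perturbed_chebyshev m t by unfold_locales (use 6 in blast)
    define \<alpha> :: real where "\<alpha> = 2 powi (1 - 2 * int m)"
    \<comment> \<open>The hypotheses constrain \<open>w\<close> only on the open interval; outside
      it \<open>w\<close> may be neither measurable nor nonnegative, hence the extension by
      zero.\<close>
    define W where "W y = indicator {\<xi><..<\<eta>} y * w y" for y
    have W_ennreal: "ennreal (w y) * indicator {\<xi><..<\<eta>} y = ennreal (W y)" for y
      by (auto simp: W_def indicator_def)
    have W_div: "indicator {\<xi><..<\<eta>} y *\<^sub>R (w y / (y + \<alpha>)) = W y / (y + \<alpha>)" for y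
      by (simp add: W_def)
    note hyps = 6(2)[folded \<alpha>_def]
    have arc: "arc_weight m W \<alpha>"
    proof
      show "W \<in> borel_measurable borel"
        using hyps unfolding set_borel_measurable_def W_def by simp
      show "integrable lborel (\<lambda>y. W y / (y + \<alpha>))"
        using hyps unfolding set_integrable_def W_div by blast
      show "0 \<le> W y" for y using hyps by (auto simp: W_def indicator_def)
      show "W y = 0" if "\<not> (- \<alpha> < y \<and> y < \<alpha>)" for y
        using hyps that by (auto simp: W_def indicator_def)
    qed (use m \<alpha>_def in auto)
    interpret chebyshev_measures m t \<mu>P \<mu>Q W \<alpha>
      using hyps arc unfolding W_ennreal by unfold_locales (auto simp: arc_weight_def)
    have C: "(LINT y:{\<xi><..<\<eta>}|lborel. w y / (y + \<alpha>)) = C"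
      unfolding set_lebesgue_integral_def W_div C_def ..
    have M: "1 / real m * (2 ^ (2*m - 3) * measure \<mu>Q UNIV / Re (t m) - C) = M"
      unfolding M_def \<kappa>0_def q0_def \<tau>_def by simp
    have dens: "ennreal (\<bar>poly (chebU (int m - 1)) x / poly (chebT (int m)) x\<bar> * w (poly (monT (2 * int m)) x))
       * indicator {x. poly (monT (2 * int m)) x \<in> {\<xi><..<\<eta>}} x = ennreal (dens x)" for x
      by (auto simp: dens_def W_def indicator_def)
    show ?case
      unfolding Let_def \<alpha>_def[symmetric] C M dens \<nu>_def[symmetric] z_def[symmetric]
      using M_nonneg emeasure_\<mu>P p0_pos \<kappa>0_pos by (intro conjI exI[of _ "p0 / \<kappa>0"]) auto
  qed
qed

end
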